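(* Let $V$ be a nonempty open subset of $\ell^2$. If $V$ is a pseudo-convex domain of $\ell^2$, then there exists an exhaustion function $\eta\in C^\infty_{F^\infty}(V)$ (in particular $\eta\in C^2(V)$) on $V$ such that $\eta$ is plurisubharmonic on $V$.
   Context: $\ell^2$ is the complex Hilbert space of square-summable complex sequences $\mathbf z=(z_j)_{j\ge1}$, $z_j=x_j+\sqrt{-1}\,y_j$ with $x_j,y_j\in\mathbb R$, with its canonical norm $\|\cdot\|$. Plurisubharmonic: a real-valued continuous function $f$ on an open subset $O$ of a complex Banach space $X$ is plurisubharmonic on $O$ if $f(a)\le\frac1{2\pi}\int_0^{2\pi}f(a+e^{\sqrt{-1}\theta}b)\,d\theta$ for all $a\in O$, $b\in X$ with $\{a+\lambda b:\lambda\in\mathbb C,|\lambda|\le1\}\subset O$. Pseudo-convex: an open subset $O$ of a finite-dimensional complex normed space is pseudo-convex if there is a plurisubharmonic function $\eta$ on $O$ such that $\{x\in O:\eta(x)<t\}$ is relatively compact in $O$ for all $t\in\mathbb R$ (the empty set is regarded as pseudo-convex). A nonempty open subset $V$ of $\ell^2$ is a pseudo-convex domain if $V\cap M$ is pseudo-convex in $M$ for each finite-dimensional complex linear subspace $M$ of $\ell^2$. (Connectedness is not required.) Uniform inclusion: for a nonempty bounded $S\subset V$ put $d(S,\partial V)=\inf\{\|\mathbf z_1-\mathbf z_2\|:\mathbf z_1\in S,\mathbf z_2\in\partial V\}$ if $V\ne\ell^2$ and $d(S,\partial V)=+\infty$ if $V=\ell^2$. $S$ is uniformly included in $V$, written $S\stackrel{\circ}{\subset}V$,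 if $S$ is bounded and $d(S,\partial V)>0$; the empty set is also counted as uniformly included. Exhaustion function on $V$: a real-valued function $\eta$ on $V$ such that $\{\mathbf z\in V:\eta(\mathbf z)\le t\}\stackrel{\circ}{\subset}V$ for every $t\in\mathbb R$. Function spaces: partial derivatives $\partial/\partial x_j$ and $\partial/\partial y_j$ are the usual limits of difference quotients in the $j$-th coordinate along real increments $\tau$ and imaginary increments $\sqrt{-1}\,\tau$ ($\tau\in\mathbb R$). $C^k(V)$ is the set of $f:V\to\mathbb C$ such that $f$ and all its partial derivatives (in the variables $x_j,y_j$, $j\ge1$) of order up to $k$ exist and are continuous on $V$; $C^\infty(V)=\bigcap_kC^k(V)$. Put $\partial_j=\frac12(\frac{\partial}{\partial x_j}-\sqrt{-1}\frac{\partial}{\partial y_j})$, $\overline\partial_j=\frac12(\frac{\partial}{\partial x_j}+\sqrt{-1}\frac{\partial}{\partial y_j})$ and, for finitely supported sequences $\alpha,\beta$ of nonnegative integers, $\partial_\alpha=\prod_j\partial_j^{\alpha_j}$, $\overline\partial_\beta=\prod_j\overline\partial_j^{\beta_j}$. $C^1_F(V)$ is the set of $f\in C^1(V)$ with $\sup_S\{|f|+\sum_{j\ge1}(|\partial_jf|^2+|\overline\partial_jf|^2)\}<\infty$ for every $S\stackrel{\circ}{\subset}V$. $C^\infty_{F^\infty}(V)$ is the set of $f\in C^\infty(V)$ such that $\partial_\alpha\overline\partial_\beta f\in C^1_F(V)$ for all finitely supported multi-indices $\alpha,\beta$. *)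

theory Defs
  imports "HOL-Analysis.Analysis"
begin

section \<open>The complex Hilbert space of square-summable sequences\<close>

text \<open>Sequences are indexed from 0, so the coordinate \<open>coord z j\<close> is the usual \<open>z\<^sub>j\<^sub>+\<^sub>1\<close>.\<close>

typedef ell2 = "{z :: nat \<Rightarrow> complex. summable (\<lambda>j. (cmod (z j))\<^sup>2)}"
  morphisms coord Abs_ell2
  by (rule exI[of _ "\<lambda>_. 0"]) simp

setup_lifting type_definition_ell2

lemma summable_coord: "summable (\<lambda>j. (cmod (coord z j))\<^sup>2)"
  using coord[of z] by simp

lemma ell2_eqI: "(\<And>j. coord z j = coord w j) \<Longrightarrow> z = w"
  by (simp add: coord_inject[symmetric] ext)

lemma square_summable_add:
  fixes f g :: "nat \<Rightarrow> complex"
  assumes "summable (\<lambda>j. (cmod (f j))\<^sup>2)" "summable (\<lambda>j. (cmod (g j))\<^sup>2)"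
  shows "summable (\<lambda>j. (cmod (f j + g j))\<^sup>2)"
proof (rule summable_comparison_test'[where N = 0])
  show "summable (\<lambda>j. 2 * (cmod (f j))\<^sup>2 + 2 * (cmod (g j))\<^sup>2)"
    using assms by (intro summable_add summable_mult)
  fix j
  have "(cmod (f j + g j))\<^sup>2 \<le> (cmod (f j) + cmod (g j))\<^sup>2"
    by (simp add: norm_triangle_ineq power_mono)
  also have "\<dots> \<le> 2 * (cmod (f j))\<^sup>2 + 2 * (cmod (g j))\<^sup>2"
    using sum_squares_bound[of "cmod (f j)" "cmod (g j)"] by (simp add: power2_sum)
  finally show "norm ((cmod (f j + g j))\<^sup>2) \<le> 2 * (cmod (f j))\<^sup>2 + 2 * (cmod (g j))\<^sup>2"
    by simp
qed

lemma square_summable_mult: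
  fixes f :: "nat \<Rightarrow> complex"
  assumes "summable (\<lambda>j. (cmod (f j))\<^sup>2)"
  shows "summable (\<lambda>j. (cmod (c * f j))\<^sup>2)"
  using assms by (simp add: norm_mult power_mult_distrib summable_mult)

lift_definition scaleC :: "complex \<Rightarrow> ell2 \<Rightarrow> ell2"  (infixr "*\<^sub>C" 75)
  is "\<lambda>c z j. c * z j"
  by (rule square_summable_mult)

lift_definition unit_vec :: "nat \<Rightarrow> ell2"
  is "\<lambda>j k. if k = j then 1 else 0"
proof -
  fix j :: nat
  show "summable (\<lambda>k. (cmod (if k = j then 1 else 0))\<^sup>2)"
    by (rule summable_finite[of "{j}"]) auto
qed

instantiation ell2 :: real_vector
begin

lift_definition zero_ell2 :: ell2 is "\<lambda>_. 0" by simp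

lift_definition plus_ell2 :: "ell2 \<Rightarrow> ell2 \<Rightarrow> ell2" is "\<lambda>z w j. z j + w j"
  by (rule square_summable_add)

lift_definition uminus_ell2 :: "ell2 \<Rightarrow> ell2" is "\<lambda>z j. - z j" by simp

lift_definition minus_ell2 :: "ell2 \<Rightarrow> ell2 \<Rightarrow> ell2" is "\<lambda>z w j. z j - w j"
  using square_summable_add[where g = "\<lambda>j. - g j" for g] by simp

lift_definition scaleR_ell2 :: "real \<Rightarrow> ell2 \<Rightarrow> ell2" is "\<lambda>r z j. complex_of_real r * z j"
  by (rule square_summable_mult)

instance
  by standard (transfer, simp add: fun_eq_iff algebra_simps)+

end

lemmas coord_simps [simp] =
  zero_ell2.rep_eq plus_ell2.rep_eq uminus_ell2.rep_eq minus_ell2.rep_eq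
  scaleR_ell2.rep_eq scaleC.rep_eq unit_vec.rep_eq

lemma summable_inner_coord: "summable (\<lambda>j. coord z j \<bullet> coord w j)"
proof (rule summable_comparison_test'[where N = 0])
  show "summable (\<lambda>j. (cmod (coord z j))\<^sup>2 + (cmod (coord w j))\<^sup>2)"
    by (intro summable_add summable_coord)
  fix j
  have "\<bar>coord z j \<bullet> coord w j\<bar> \<le> cmod (coord z j) * cmod (coord w j)"
    by (rule Cauchy_Schwarz_ineq2)
  also have "\<dots> \<le> (cmod (coord z j))\<^sup>2 + (cmod (coord w j))\<^sup>2"
    using sum_squares_bound[of "cmod (coord z j)" "cmod (coord w j)"]
      mult_nonneg_nonneg[OF norm_ge_zero[of "coord z j"] norm_ge_zero[of "coord w j"]]
    by linarith
  finally show "norm (coord z j \<bullet> coord w j) \<le> (cmod (coord z j))\<^sup>2 + (cmod (coord w j))\<^sup>2"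
    by simp
qed

instantiation ell2 :: real_inner
begin

text \<open>On \<^typ>\<open>complex\<close>, \<open>a \<bullet> b\<close> is the real part of \<open>a * cnj b\<close>; this is therefore the real part of
  the Hermitian inner product of \<open>\<ell>\<^sup>2\<close> and induces the canonical norm.\<close>

definition inner_ell2 :: "ell2 \<Rightarrow> ell2 \<Rightarrow> real" where
  "inner_ell2 z w = (\<Sum>j. coord z j \<bullet> coord w j)"

definition norm_ell2 :: "ell2 \<Rightarrow> real" where
  "norm_ell2 z = sqrt (\<Sum>j. (cmod (coord z j))\<^sup>2)"

definition sgn_ell2 :: "ell2 \<Rightarrow> ell2" where
  "sgn_ell2 z = z /\<^sub>R norm z"

definition dist_ell2 :: "ell2 \<Rightarrow> ell2 \<Rightarrow> real" where
  "dist_ell2 z w = norm (z - w)"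

definition uniformity_ell2 :: "(ell2 \<times> ell2) filter" where
  "uniformity_ell2 = (INF e\<in>{0<..}. principal {(z, w). dist z w < e})"

definition open_ell2 :: "ell2 set \<Rightarrow> bool" where
  "open_ell2 U \<longleftrightarrow> (\<forall>z\<in>U. \<forall>\<^sub>F (z', w) in uniformity. z' = z \<longrightarrow> w \<in> U)"

instance
proof
  fix z w u :: ell2 and r :: real and U :: "ell2 set"
  show "dist z w = norm (z - w)" by (rule dist_ell2_def)
  show "sgn z = z /\<^sub>R norm z" by (rule sgn_ell2_def)
  show "uniformity = (INF e\<in>{0<..}. principal {(z, w :: ell2). dist z w < e})"
    by (rule uniformity_ell2_def)
  show "open U \<longleftrightarrow> (\<forall>z\<in>U. \<forall>\<^sub>F (z', w) in uniformity. z' = z \<longrightarrow> w \<in> U)"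
    by (rule open_ell2_def)
  show "z \<bullet> w = w \<bullet> z"
    by (simp add: inner_ell2_def inner_commute)
  show "(z + w) \<bullet> u = z \<bullet> u + w \<bullet> u"
    by (simp add: inner_ell2_def inner_add_left suminf_add summable_inner_coord)
  have "(complex_of_real r * coord z j) \<bullet> coord w j = r * (coord z j \<bullet> coord w j)" for j
    by (metis inner_scaleR_left scaleR_conv_of_real)
  then show "(r *\<^sub>R z) \<bullet> w = r * (z \<bullet> w)"
    by (simp add: inner_ell2_def suminf_mult summable_inner_coord)
  show "0 \<le> z \<bullet> z"
    unfolding inner_ell2_def by (rule suminf_nonneg[OF summable_inner_coord]) simp
  have "(\<Sum>j. coord z j \<bullet> coord z j) = 0 \<longleftrightarrow> (\<forall>j. coord z j \<bullet> coord z j = 0)"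
    by (rule suminf_eq_zero_iff[OF summable_inner_coord]) simp
  then show "z \<bullet> z = 0 \<longleftrightarrow> z = 0"
    by (auto simp: inner_ell2_def intro: ell2_eqI)
  show "norm z = sqrt (z \<bullet> z)"
    by (simp add: norm_ell2_def inner_ell2_def power2_norm_eq_inner)
qed

end

lemma scaleR_eq_scaleC: "r *\<^sub>R z = complex_of_real r *\<^sub>C z"
  by (rule ell2_eqI) simp

lemma norm_scaleC: "norm (c *\<^sub>C z) = cmod c * norm z"
  by (simp add: norm_ell2_def norm_mult power_mult_distrib suminf_mult summable_coord
      real_sqrt_mult)

global_interpretation ell2: vector_space scaleC
  by standard (rule ell2_eqI; simp add: algebra_simps)+


section \<open>Plurisubharmonicity and pseudo-convexity\<close>

text \<open>The parameter \<open>X\<close> is the ambient complex normed space, given as a complex linear subspace of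
  \<^typ>\<open>ell2\<close> with the induced norm; \<open>U\<close> is meant to be an open subset of \<open>X\<close>.\<close>

definition plurisubharmonic_on :: "ell2 set \<Rightarrow> ell2 set \<Rightarrow> (ell2 \<Rightarrow> real) \<Rightarrow> bool" where
  "plurisubharmonic_on X U f \<longleftrightarrow>
     continuous_on U f \<and>
     (\<forall>a\<in>U. \<forall>b\<in>X. {a + l *\<^sub>C b | l. cmod l \<le> 1} \<subseteq> U \<longrightarrow>
        f a \<le> 1 / (2 * pi) * integral {0..2 * pi} (\<lambda>\<theta>. f (a + exp (\<i> * complex_of_real \<theta>) *\<^sub>C b)))"

text \<open>\<open>U \<inter> closure S\<close> is the closure of \<open>S\<close> relative to \<open>U\<close>.\<close>

definition relatively_compact_in :: "ell2 set \<Rightarrow> ell2 set \<Rightarrow> bool" where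
  "relatively_compact_in U S \<longleftrightarrow> S \<subseteq> U \<and> compact (U \<inter> closure S)"

definition pseudoconvex_in :: "ell2 set \<Rightarrow> ell2 set \<Rightarrow> bool" where
  "pseudoconvex_in M U \<longleftrightarrow>
     openin (top_of_set M) U \<and>
     (U = {} \<or>
      (\<exists>\<eta>. plurisubharmonic_on M U \<eta> \<and> (\<forall>t. relatively_compact_in U {z \<in> U. \<eta> z < t})))"

definition finite_dim_csubspace :: "ell2 set \<Rightarrow> bool" where
  "finite_dim_csubspace M \<longleftrightarrow> ell2.subspace M \<and> (\<exists>B. finite B \<and> M = ell2.span B)"

definition pseudoconvex_domain :: "ell2 set \<Rightarrow> bool" where
  "pseudoconvex_domain V \<longleftrightarrow>
     V \<noteq> {} \<and> open V \<and> (\<forall>M. finite_dim_csubspace M \<longrightarrow> pseudoconvex_in M (V \<inter> M))"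


section \<open>Uniform inclusion and exhaustion functions\<close>

definition boundary_dist :: "ell2 set \<Rightarrow> ell2 set \<Rightarrow> ennreal" where
  "boundary_dist S V =
     (if V = UNIV then \<infinity>
      else INF p\<in>S \<times> frontier V. ennreal (norm (fst p - snd p)))"

definition uniformly_included :: "ell2 set \<Rightarrow> ell2 set \<Rightarrow> bool" where
  "uniformly_included S V \<longleftrightarrow>
     S = {} \<or> (S \<subseteq> V \<and> bounded S \<and> boundary_dist S V > 0)"

definition exhaustion_function :: "ell2 set \<Rightarrow> (ell2 \<Rightarrow> real) \<Rightarrow> bool" where
  "exhaustion_function V \<eta> \<longleftrightarrow> (\<forall>t. uniformly_included {z \<in> V. \<eta> z \<le> t} V)"


section \<open>Function spaces\<close>

text \<open>Functions on an open set \<open>V\<close> are represented by total functions. All notions below only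
  depend on the values on \<open>V\<close>, because derivatives at points of \<open>V\<close> are local.\<close>

datatype real_coord = XC nat | YC nat

fun direction :: "real_coord \<Rightarrow> ell2" where
  "direction (XC j) = unit_vec j"
| "direction (YC j) = \<i> *\<^sub>C unit_vec j"

definition has_partial :: "real_coord \<Rightarrow> (ell2 \<Rightarrow> complex) \<Rightarrow> ell2 \<Rightarrow> complex \<Rightarrow> bool" where
  "has_partial c f z D \<longleftrightarrow>
     ((\<lambda>t::real. (f (z + t *\<^sub>R direction c) - f z) / complex_of_real t) \<longlongrightarrow> D) (at 0)"

definition partial :: "real_coord \<Rightarrow> (ell2 \<Rightarrow> complex) \<Rightarrow> ell2 \<Rightarrow> complex" where
  "partial c f z = (THE D. has_partial c f z D)"

primrec Ck :: "nat \<Rightarrow> ell2 set \<Rightarrow> (ell2 \<Rightarrow> complex) set" where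
  "Ck 0 V = {f. continuous_on V f}"
| "Ck (Suc k) V =
     {f. continuous_on V f \<and>
         (\<forall>c. (\<forall>z\<in>V. \<exists>D. has_partial c f z D) \<and> partial c f \<in> Ck k V)}"

definition Cinf :: "ell2 set \<Rightarrow> (ell2 \<Rightarrow> complex) set" where
  "Cinf V = (\<Inter>k. Ck k V)"

definition d_z :: "nat \<Rightarrow> (ell2 \<Rightarrow> complex) \<Rightarrow> ell2 \<Rightarrow> complex" where
  "d_z j f z = 1 / 2 * (partial (XC j) f z - \<i> * partial (YC j) f z)"

definition d_zbar :: "nat \<Rightarrow> (ell2 \<Rightarrow> complex) \<Rightarrow> ell2 \<Rightarrow> complex" where
  "d_zbar j f z = 1 / 2 * (partial (XC j) f z + \<i> * partial (YC j) f z)"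

text \<open>For finitely supported \<open>\<alpha>\<close>, the product over \<open>j\<close> of the powers \<open>(D j) ^^ (\<alpha> j)\<close>, composed in increasing order of \<open>j\<close> (smallest
  index outermost). On \<open>Cinf V\<close> the operators \<open>d_z j\<close>, \<open>d_zbar j\<close> commute, so the order is
  immaterial there.\<close>

definition multi_deriv ::
  "(nat \<Rightarrow> (ell2 \<Rightarrow> complex) \<Rightarrow> ell2 \<Rightarrow> complex) \<Rightarrow> (nat \<Rightarrow> nat) \<Rightarrow> (ell2 \<Rightarrow> complex) \<Rightarrow> ell2 \<Rightarrow> complex"
  where
  "multi_deriv D \<alpha> f =
     foldr (\<lambda>j. D j ^^ \<alpha> j) (sorted_list_of_set {j. \<alpha> j \<noteq> 0}) f"

definition C1F :: "ell2 set \<Rightarrow> (ell2 \<Rightarrow> complex) set" where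
  "C1F V =
     {f \<in> Ck 1 V. \<forall>S. uniformly_included S V \<longrightarrow>
        (SUP z\<in>S. ennreal (cmod (f z)) +
           (\<Sum>j. ennreal ((cmod (d_z j f z))\<^sup>2 + (cmod (d_zbar j f z))\<^sup>2))) < \<infinity>}"

definition CinfFinf :: "ell2 set \<Rightarrow> (ell2 \<Rightarrow> complex) set" where
  "CinfFinf V =
     {f \<in> Cinf V. \<forall>\<alpha> \<beta>. finite {j. \<alpha> j \<noteq> 0} \<longrightarrow> finite {j. \<beta> j \<noteq> 0} \<longrightarrow>
        multi_deriv d_z \<alpha> (multi_deriv d_zbar \<beta> f) \<in> C1F V}"

end

(*
  Let delta be the distance to the boundary. Testing pseudo-convexity on the discs
  l |-> a + l b + t exp (- p l) c, with p a polynomial and t in [0,1], all of which lie in one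
  finite-dimensional subspace, shows that - ln delta is plurisubharmonic, so that
  u = max (norm, - ln delta) is a plurisubharmonic exhaustion function which is Lipschitz on
  uniformly included sets. Averaging a Lipschitz function over small intervals in every
  coordinate direction gives a function all of whose partial derivatives exist and are again
  Lipschitz, and a Lipschitz bound controls the whole gradient in l^2. The averaging radius cannot
  be the same everywhere, so the affine pieces of a convex piecewise linear function of u are
  smoothed separately and glued by a regularized maximum; convexity makes the smoothing of a
  piece irrelevant far from the level on which that piece dominates.
*)

theory Submission
  imports Defs "HOL-Complex_Analysis.Complex_Analysis"
begin

section \<open>Smooth kernels on the real line\<close>

text \<open>Two obstacles shape the proof. Pseudo-convexity gives a sub-mean inequality along affine
  discs only, but the discs above are curved: the given plurisubharmonic function is therefore
  smoothed in the direction of the curvature, and the maximum principle on the disc tolerates a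
  defect o(r^2). And the glued function is a regularized maximum of two smooth pieces only near each
  point, so small circles must be shown to control the unit circle. For this, and for - ln delta,
  real parts of polynomials, dense among the continuous functions on the circle, take the role of
  Poisson integrals: Re p lies slightly above - ln delta on the circle, so |exp (- p)| stays below
  delta there.

  The averaging radii are summable over the coordinates; with the Lipschitz bound this makes
  infinitely many averages converge uniformly and keeps the total displacement small.

  Constants: neighbouring affine pieces differ by 16 (t - (j + 1)), hence by at least 4 at distance
  1/4 or more from the kink. Smoothing costs 1/8 per piece, which leaves more than the margin 2
  beyond which the regularized positive part is exact.\<close>

primrec Cn :: "nat \<Rightarrow> (real \<Rightarrow> real) \<Rightarrow> bool" where
  "Cn 0 f \<longleftrightarrow> continuous_on UNIV f"
| "Cn (Suc n) f \<longleftrightarrow> (\<exists>g. (\<forall>x. (f has_real_derivative g x) (at x)) \<and> Cn n g)"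

lemma Cn_SucI: "(\<And>x. (f has_real_derivative g x) (at x)) \<Longrightarrow> Cn n g \<Longrightarrow> Cn (Suc n) f"
  by auto

lemma Cn_Suc_imp: "Cn (Suc n) f \<Longrightarrow> Cn n f"
proof (induction n arbitrary: f)
  case 0
  then show ?case by (auto intro: DERIV_continuous_on)
next
  case (Suc n)
  then show ?case by (metis Cn.simps(2))
qed

lemma Cn_continuous: "Cn n f \<Longrightarrow> continuous_on UNIV f"
  by (cases n) (auto intro: DERIV_continuous_on)

lemma Cn_const: "Cn n (\<lambda>_. c)"
  by (induction n arbitrary: c) (auto intro!: exI[of _ "\<lambda>_. 0"])

lemma Cn_add: "Cn n f \<Longrightarrow> Cn n g \<Longrightarrow> Cn n (\<lambda>x. f x + g x)"
proof (induction n arbitrary: f g)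
  case (Suc n)
  then obtain f' g' where *: "\<And>x. (f has_real_derivative f' x) (at x)" "Cn n f'"
    "\<And>x. (g has_real_derivative g' x) (at x)" "Cn n g'" by auto
  then have "Cn n (\<lambda>x. f' x + g' x)" using * Suc.IH by auto
  then show ?case by (rule Cn_SucI[rotated]) (intro DERIV_add *)
qed (auto intro: continuous_on_add)

lemma Cn_mult: "Cn n f \<Longrightarrow> Cn n g \<Longrightarrow> Cn n (\<lambda>x. f x * g x)"
proof (induction n arbitrary: f g)
  case (Suc n)
  then obtain f' g' where *: "\<And>x. (f has_real_derivative f' x) (at x)" "Cn n f'"
    "\<And>x. (g has_real_derivative g' x) (at x)" "Cn n g'" by auto
  have "Cn n f" "Cn n g" using Suc.prems Cn_Suc_imp by auto
  with Suc.IH * have "Cn n (\<lambda>x. f' x * g x + g' x * f x)" by (intro Cn_add) auto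
  then show ?case by (rule Cn_SucI[rotated]) (intro DERIV_mult *)
qed (auto intro: continuous_on_mult)

lemma Cn_affine: "Cn n f \<Longrightarrow> Cn n (\<lambda>x. f (a * x + b))"
proof (induction n arbitrary: f)
  case 0
  then show ?case by (auto intro!: continuous_on_compose2[of UNIV f] continuous_intros)
next
  case (Suc n)
  then obtain f' where *: "\<And>x. (f has_real_derivative f' x) (at x)" "Cn n f'" by auto
  have "Cn n (\<lambda>x. f' (a * x + b) * a)" using * Suc.IH by (intro Cn_mult Cn_const)
  then show ?case
    by (rule Cn_SucI[rotated]) (auto intro!: derivative_eq_intros DERIV_chain2[OF *(1)])
qed

section \<open>Functions flat at the origin\<close>

definition exp_recip :: "real poly \<Rightarrow> real \<Rightarrow> real" where
  "exp_recip P x = (if x > 0 then poly P (inverse x) * exp (- inverse x) else 0)"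

lemma exp_recip_tendsto: "((\<lambda>x. poly P (inverse x) * exp (- inverse x)) \<longlongrightarrow> 0) (at_right (0::real))"
proof -
  have "((\<lambda>y. poly P y * exp (- y)) \<longlongrightarrow> 0) at_top"
  proof -
    have "((\<lambda>y. \<Sum>i\<le>degree P. coeff P i * (y ^ i / exp y)) \<longlongrightarrow> (\<Sum>i\<le>degree P. coeff P i * 0)) at_top"
      by (intro tendsto_sum tendsto_mult tendsto_const tendsto_power_div_exp_0)
    then show ?thesis
      by (simp add: poly_altdef sum_distrib_right exp_minus divide_inverse mult.assoc)
  qed
  then show ?thesis
    by (rule filterlim_compose[OF _ filterlim_inverse_at_top_right])
qed

text \<open>For x > 0 the derivative of P(1/x) exp(-1/x) is (1/x)^2 (P - P')(1/x) exp(-1/x), so the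
  family indexed by polynomials is closed under differentiation. At 0 the difference quotient is the
  member for X * P, which tends to 0.\<close>

lemma exp_recip_deriv:
  "(exp_recip P has_real_derivative exp_recip ([:0, 0, 1:] * (P - pderiv P)) x) (at x)"
proof -
  consider "x > 0" | "x < 0" | "x = 0" by linarith
  then show ?thesis
  proof cases
    case 1
    have "((\<lambda>x. poly P (inverse x) * exp (- inverse x)) has_real_derivative
            exp_recip ([:0, 0, 1:] * (P - pderiv P)) x) (at x)"
      using 1 by (auto intro!: derivative_eq_intros DERIV_chain2[OF poly_DERIV]
          simp: exp_recip_def field_simps power2_eq_square)
    then show ?thesis
      by (rule has_field_derivative_transform_within_open[where S = "{0<..}"])
        (use 1 in \<open>auto simp: exp_recip_def\<close>)
  next
    case 2
    have "((\<lambda>x. 0) has_real_derivative 0) (at x)" by simp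
    then have "(exp_recip P has_real_derivative 0) (at x)"
      by (rule has_field_derivative_transform_within_open[where S = "{..<0}"])
        (use 2 in \<open>auto simp: exp_recip_def\<close>)
    then show ?thesis using 2 by (simp add: exp_recip_def)
  next
    case 3
    have "((\<lambda>h. exp_recip P h / h) \<longlongrightarrow> 0) (at 0)"
    proof (rule filterlim_split_at_real)
      show "((\<lambda>h. exp_recip P h / h) \<longlongrightarrow> 0) (at_left 0)"
        by (rule tendsto_eventually) (auto simp: exp_recip_def eventually_at_filter)
      show "((\<lambda>h. exp_recip P h / h) \<longlongrightarrow> 0) (at_right 0)"
        by (rule Lim_transform_eventually[OF exp_recip_tendsto[of "[:0, 1:] * P"]])
          (auto simp: exp_recip_def eventually_at_filter field_simps)
    qed
    then show ?thesis using 3 by (simp add: DERIV_def exp_recip_def)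
  qed
qed

lemma Cn_exp_recip: "Cn n (exp_recip P)"
proof (induction n arbitrary: P)
  case 0
  show ?case using exp_recip_deriv by (auto intro: DERIV_continuous_on)
next
  case (Suc n)
  then show ?case using exp_recip_deriv by (intro Cn_SucI) auto
qed

lemma exp_recip_1: "exp_recip 1 x \<ge> 0" "exp_recip 1 x > 0 \<longleftrightarrow> x > 0" "x \<le> 0 \<Longrightarrow> exp_recip 1 x = 0"
  by (auto simp: exp_recip_def)

section \<open>Mollifiers on the line\<close>

text \<open>Kernels are required to vanish only beyond \<open>[-a, a]\<close>; this open condition passes to
  derivatives.\<close>

definition smooth_kernel :: "real \<Rightarrow> (real \<Rightarrow> real) \<Rightarrow> bool" where
  "smooth_kernel a k \<longleftrightarrow> (\<forall>n. Cn n k) \<and> (\<forall>s. \<bar>s\<bar> > a \<longrightarrow> k s = 0)"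

definition mollifier :: "real \<Rightarrow> (real \<Rightarrow> real) \<Rightarrow> bool" where
  "mollifier a k \<longleftrightarrow> smooth_kernel a k \<and> (\<forall>s. k s \<ge> 0) \<and> integral {-a..a} k = 1"

lemma mollifier_exists:
  assumes "a > 0"
  obtains k where "mollifier a k"
proof -
  \<comment> \<open>The first factor vanishes for \<open>s <= -a\<close>, the second for
    \<open>s >= a\<close>. The coefficients 1 and -1 are spelled out to match
    \<open>Cn_affine\<close>.\<close>
  define h where "h s = exp_recip 1 (1 * s + a) * exp_recip 1 (- 1 * s + a)" for s
  have C: "Cn n h" for n
    unfolding h_def by (intro Cn_mult Cn_affine Cn_exp_recip)
  have z: "h s = 0" if "\<bar>s\<bar> > a" for s
    using that by (auto simp: h_def exp_recip_def)
  have nn: "h s \<ge> 0" for s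
    by (simp add: h_def exp_recip_1)
  have cont: "continuous_on {-a..a} h"
    using Cn_continuous[OF C] continuous_on_subset by blast
  have "integral {-a..a} h > 0"
  proof -
    have "integral {-a..a} h \<noteq> 0"
    proof
      assume "integral {-a..a} h = 0"
      then have "h 0 = 0"
        using integral_eq_0_iff[of "-a" a h] cont nn assms by auto
      then show False using assms by (auto simp: h_def exp_recip_def)
    qed
    moreover have "integral {-a..a} h \<ge> 0"
      using nn by (intro integral_nonneg integrable_continuous_real cont) auto
    ultimately show ?thesis by linarith
  qed
  note pos = this
  define k where "k s = h s * (1 / integral {-a..a} h)" for s
  have "\<forall>n. Cn n k" unfolding k_def by (intro allI Cn_mult C Cn_const)
  moreover have "integral {-a..a} k = 1"
    unfolding k_def integral_mult_left using pos by simp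
  ultimately have "mollifier a k"
    using z nn pos by (auto simp: mollifier_def smooth_kernel_def k_def)
  then show ?thesis by (rule that)
qed

lemma smooth_kernel_continuous: "smooth_kernel a k \<Longrightarrow> continuous_on S k"
  using Cn_continuous continuous_on_subset by (metis smooth_kernel_def subset_UNIV)

text \<open>\<open>Cn (Suc n) k\<close> supplies a derivative that could depend on \<open>n\<close>;
  uniqueness of derivatives makes all of them one function, which is then smooth to every
  order.\<close>

lemma smooth_kernel_deriv:
  assumes "smooth_kernel a k"
  obtains k' where "smooth_kernel a k'" "\<And>s. (k has_real_derivative k' s) (at s)"
proof -
  have "Cn (Suc 0) k" using assms by (auto simp: smooth_kernel_def)
  then obtain k' where d: "\<And>s. (k has_real_derivative k' s) (at s)" by auto
  have "Cn n k'" for n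
  proof -
    have "Cn (Suc n) k" using assms by (auto simp: smooth_kernel_def)
    then obtain g where "\<And>s. (k has_real_derivative g s) (at s)" "Cn n g" by auto
    moreover from this d have "g = k'" by (blast intro: DERIV_unique)
    ultimately show ?thesis by simp
  qed
  moreover have "k' s = 0" if "\<bar>s\<bar> > a" for s
  proof -
    have "open {s. \<bar>s\<bar> > a}" by (intro open_Collect_less continuous_intros)
    moreover have "((\<lambda>_. 0) has_real_derivative 0) (at s)" by simp
    ultimately have "(k has_real_derivative 0) (at s)"
      using has_field_derivative_transform_within_open[of "\<lambda>_. 0" 0 s "{s. \<bar>s\<bar> > a}" k] that assms
      by (auto simp: smooth_kernel_def)
    with d show ?thesis by (blast intro: DERIV_unique)
  qed
  ultimately show ?thesis using d that by (auto simp: smooth_kernel_def)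
qed

section \<open>The regularized positive part\<close>

lemma antiderivative_from:
  fixes k :: "real \<Rightarrow> real"
  assumes "continuous_on UNIV k" "\<And>s. s < c \<Longrightarrow> k s = 0"
  obtains K where "\<And>s. (K has_real_derivative k s) (at s)" "\<And>s. s < c \<Longrightarrow> K s = 0"
proof
  \<comment> \<open>Starting at \<open>c - 1\<close> puts every \<open>s >= c\<close> in the
    interior of an interval of integration; the added piece contributes nothing, as \<open>k\<close>
    vanishes there.\<close>
  define K where "K x = integral {c - 1..x} k" for x
  show z: "K s = 0" if "s < c" for s
  proof -
    have "integral {c - 1..s} k = integral {c - 1..s} (\<lambda>_. 0)"
      by (rule integral_cong) (use assms that in auto)
    then show ?thesis by (simp add: K_def)
  qed
  fix s
  show "(K has_real_derivative k s) (at s)"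
  proof (cases "s < c")
    case True
    have "((\<lambda>_. 0) has_real_derivative 0) (at s)" by simp
    then have "(K has_real_derivative 0) (at s)"
      by (rule has_field_derivative_transform_within_open[where S = "{..<c}"]) (use True z in auto)
    then show ?thesis using True assms by simp
  next
    case False
    have "(K has_real_derivative k s) (at s within {c - 1..s + 1})"
      unfolding K_def
      by (rule integral_has_real_derivative) (use False continuous_on_subset[OF assms(1)] in auto)
    then show ?thesis using False
      by (simp add: at_within_Icc_at)
  qed
qed

text \<open>A mollifier integrated twice is convex, 0 on the far left and of slope 1 on the far
  right; a shift makes it the positive part outside [-2, 2]. Then s + w (t - s) is a regularized
  maximum of s and t.\<close>

lemma smooth_positive_part:
  obtains w w' where "\<And>n. Cn n w" "\<And>x. (w has_real_derivative w' x) (at x)"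
    "\<And>x. 0 \<le> w' x" "\<And>x. w' x \<le> 1" "mono w'"
    "\<And>x. x \<le> -2 \<Longrightarrow> w x = 0" "\<And>x. x \<ge> 2 \<Longrightarrow> w x = x"
    "\<And>x. w x \<ge> 0" "\<And>x. w x \<ge> x"
proof -
  obtain k where k: "mollifier 1 k" using mollifier_exists[of 1] by auto
  then have kc: "continuous_on UNIV k" and kz: "\<And>s. \<bar>s\<bar> > 1 \<Longrightarrow> k s = 0" and kn: "\<And>s. k s \<ge> 0"
    and ki: "integral {-1..1} k = 1" and kC: "\<And>n. Cn n k"
    by (auto simp: mollifier_def smooth_kernel_def Cn_continuous)
  obtain H where H: "\<And>s. (H has_real_derivative k s) (at s)" "\<And>s. s < -1 \<Longrightarrow> H s = 0"
  proof (rule antiderivative_from[of k "-1"])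
    show "k s = 0" if "s < -1" for s using kz that by auto
  qed (use kc in auto)
  have mono: "mono H"
    by (rule monoI, rule DERIV_nonneg_imp_nondecreasing) (use H kn in blast)+
  have Hc: "continuous_on UNIV H" using H by (auto intro: DERIV_continuous_on)
  have H1: "H (-1) = 0"
  proof -
    have "closed {x. H x = 0}" using Hc by (intro closed_Collect_eq continuous_intros) auto
    moreover have "{..< -1} \<subseteq> {x. H x = 0}" using H by auto
    ultimately have "closure {..< -1} \<subseteq> {x. H x = 0}" by (rule closure_minimal[rotated])
    then show ?thesis by (auto simp: closure_lessThan)
  qed
  have "H 1 = 1"
  proof -
    have "(k has_integral H 1 - H (-1)) {-1..1}"
      using H by (intro fundamental_theorem_of_calculus)
        (auto simp: has_real_derivative_iff_has_vector_derivative[symmetric] intro: DERIV_subset)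
    then show ?thesis using ki H1 by (simp add: has_integral_iff)
  qed
  have "H x = 1" if "x \<ge> 1" for x
  proof -
    have "H 1 = H x \<or> (\<exists>z>1. H x - H 1 = (x - 1) * k z)"
      using MVT2[of 1 x H k] H that by (cases "x = 1") auto
    then show ?thesis using kz \<open>H 1 = 1\<close> by auto
  qed
  note H2 = this
  have H0: "H x \<ge> 0" "H x \<le> 1" for x
    using monoD[OF mono, of "min x (-2)" x] H(2)[of "min x (-2)"] monoD[OF mono, of x "max x 1"] H2[of "max x 1"]
    by auto
  obtain X where X: "\<And>s. (X has_real_derivative H s) (at s)" "\<And>s. s < -1 \<Longrightarrow> X s = 0"
  proof (rule antiderivative_from[of H "-1"])
  qed (use Hc H in auto)
  have XC: "Cn n X" for n
  proof -
    have "Cn (Suc (Suc n)) X" using X(1) H(1) kC by (metis Cn.simps(2))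
    then show ?thesis by (blast dest: Cn_Suc_imp)
  qed
  \<comment> \<open>Beyond 1 the second antiderivative is \<open>x - c\<close>. Shifting its
    argument by \<open>c\<close> removes the offset, and \<open>\<bar>c\<bar> \<le> 1\<close> keeps
    the transition zone, [-1, 1] before the shift, inside [-2, 2].\<close>
  define c where "c = 1 - X 1"
  have X1: "X x = x - c" if "x \<ge> 1" for x
  proof -
    have "1 = x \<or> (\<exists>z>1. X x - X 1 = (x - 1) * H z)"
      using MVT2[of 1 x X H] X that by (cases "x = 1") auto
    then show ?thesis using H2 by (auto simp: c_def)
  qed
  have "\<exists>z. X 1 - X (-2) = (1 - (-2)) * H z"
    using MVT2[of "-2" 1 X H] X by auto
  moreover have "\<exists>z>-1. z < 1 \<and> X 1 - X (-1) = (1 - (-1)) * H z"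
    using MVT2[of "-1" 1 X H] X by auto
  moreover have "X (-1) = 0"
  proof -
    have "continuous_on UNIV X" using X by (auto intro: DERIV_continuous_on)
    then have "closed {x. X x = 0}" by (intro closed_Collect_eq continuous_intros) auto
    moreover have "{..< -1} \<subseteq> {x. X x = 0}" using X by auto
    ultimately have "closure {..< -1} \<subseteq> {x. X x = 0}" by (rule closure_minimal[rotated])
    then show ?thesis by (auto simp: closure_lessThan)
  qed
  ultimately have "0 \<le> X 1" "X 1 \<le> 2" using H0 by auto
  then have c: "\<bar>c\<bar> \<le> 1" by (auto simp: c_def)
  define w where "w x = X (1 * x + c)" for x
  have d: "(w has_real_derivative H (x + c)) (at x)" for x
    unfolding w_def using DERIV_shift[of X "H (x + c)" x c] X(1) by simp
  have z: "w x = 0" if "x \<le> -2" for x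
    using that c X(2)[of "x + c"] \<open>X (-1) = 0\<close> by (cases "x + c = -1") (auto simp: w_def)
  have i: "w x = x" if "x \<ge> 2" for x
    using that c X1[of "x + c"] by (auto simp: w_def)
  have n: "w x \<ge> 0" for x
  proof (cases "x \<le> -2")
    case False
    then have le: "-2 \<le> x" by simp
    have "w (-2) \<le> w x"
    proof (rule DERIV_nonneg_imp_nondecreasing[OF le])
      show "\<exists>D. (w has_real_derivative D) (at y) \<and> 0 \<le> D" for y
        using d[of y] H0(1)[of "y + c"] by blast
    qed
    then show ?thesis using z[of "-2"] by linarith
  qed (use z in force)
  have l: "w x \<ge> x" for x
  proof (cases "x \<ge> 2")
    case False
    have "x - w x \<le> 2 - w 2"
    proof (rule DERIV_nonneg_imp_nondecreasing[of x 2 "\<lambda>x. x - w x"])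
      show "x \<le> 2" using False by simp
      have "((\<lambda>x. x - w x) has_real_derivative 1 - H (y + c)) (at y)" for y
        by (intro DERIV_diff DERIV_ident d)
      then show "\<exists>D. ((\<lambda>x. x - w x) has_real_derivative D) (at y) \<and> 0 \<le> D" for y
        using H0(2)[of "y + c"] by (meson diff_ge_0_iff_ge)
    qed
    then show ?thesis using i[of 2] by linarith
  qed (use i in force)
  have m: "mono (\<lambda>x. H (x + c))" using mono by (auto simp: mono_def)
  show ?thesis
    by (rule that[OF _ d _ _ m z i n l]) (use H0 in \<open>auto simp: w_def intro: Cn_affine[OF XC, of _ 1 c, simplified]\<close>)
qed

section \<open>Circle means and one-dimensional averaging\<close>

definition circle_mean :: "(real \<Rightarrow> real) \<Rightarrow> real" where
  "circle_mean f = 1 / (2 * pi) * integral {0..2 * pi} f"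

lemma circle_mean_mono:
  assumes "continuous_on {0..2 * pi} f" "continuous_on {0..2 * pi} g"
    and "\<And>\<theta>. \<theta> \<in> {0..2 * pi} \<Longrightarrow> f \<theta> \<le> g \<theta>"
  shows "circle_mean f \<le> circle_mean g"
  unfolding circle_mean_def
  by (intro mult_left_mono integral_le integrable_continuous_real assms) auto

lemma circle_mean_cong:
  "(\<And>\<theta>. \<theta> \<in> {0..2 * pi} \<Longrightarrow> f \<theta> = g \<theta>) \<Longrightarrow> circle_mean f = circle_mean g"
  unfolding circle_mean_def by (auto intro: integral_cong)

lemma circle_mean_const [simp]: "circle_mean (\<lambda>_. c) = c"
  by (simp add: circle_mean_def)

lemma circle_mean_add:
  assumes "continuous_on {0..2 * pi} f" "continuous_on {0..2 * pi} g"
  shows "circle_mean (\<lambda>\<theta>. f \<theta> + g \<theta>) = circle_mean f + circle_mean g"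
  using assms by (simp add: circle_mean_def integral_add integrable_continuous_real algebra_simps)

lemma circle_mean_diff:
  assumes "continuous_on {0..2 * pi} f" "continuous_on {0..2 * pi} g"
  shows "circle_mean (\<lambda>\<theta>. f \<theta> - g \<theta>) = circle_mean f - circle_mean g"
  using assms by (simp add: circle_mean_def integral_diff integrable_continuous_real algebra_simps)

lemma circle_mean_cmult: "circle_mean (\<lambda>\<theta>. c * f \<theta>) = c * circle_mean f"
  by (simp add: circle_mean_def)

section \<open>Averaging along one direction\<close>

definition avg :: "real \<Rightarrow> (real \<Rightarrow> real) \<Rightarrow> 'a \<Rightarrow> ('a \<Rightarrow> real) \<Rightarrow> 'a::real_normed_vector \<Rightarrow> real" where
  "avg a k d f x = integral {-a..a} (\<lambda>s. k s * f (x + s *\<^sub>R d))"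

definition dir_deriv :: "'a::real_normed_vector \<Rightarrow> ('a \<Rightarrow> real) \<Rightarrow> ('a \<Rightarrow> real) \<Rightarrow> bool" where
  "dir_deriv e f g \<longleftrightarrow> (\<forall>x. ((\<lambda>t. f (x + t *\<^sub>R e)) has_real_derivative g x) (at 0))"

lemma DERIV_along_line:
  fixes f :: "'a::real_vector \<Rightarrow> real"
  assumes "((\<lambda>h. f ((x + t *\<^sub>R e) + h *\<^sub>R e)) has_real_derivative D) (at 0)"
  shows "((\<lambda>s. f (x + s *\<^sub>R e)) has_real_derivative D) (at t)"
proof -
  have "(\<lambda>h. f (x + (h + t) *\<^sub>R e)) = (\<lambda>h. f ((x + t *\<^sub>R e) + h *\<^sub>R e))"
    by (intro ext arg_cong[of _ _ f]) (simp add: algebra_simps)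
  then have "((\<lambda>h. f (x + (h + t) *\<^sub>R e)) has_real_derivative D) (at 0)"
    using assms by simp
  then show ?thesis
    using DERIV_shift[of "\<lambda>s. f (x + s *\<^sub>R e)" D 0 t] by simp
qed

lemma dir_derivD:
  "dir_deriv e f g \<Longrightarrow> ((\<lambda>s. f (x + s *\<^sub>R e)) has_real_derivative g (x + t *\<^sub>R e)) (at t)"
  unfolding dir_deriv_def by (rule DERIV_along_line) blast

context
  fixes f :: "'a::real_normed_vector \<Rightarrow> real" and a :: real and k :: "real \<Rightarrow> real" and d :: 'a
  assumes f: "continuous_on UNIV f" and k: "continuous_on UNIV k"
begin

lemma avg_integrand_continuous: "continuous_on S (\<lambda>s. k s * f (x + s *\<^sub>R d))"
  by (intro continuous_intros continuous_on_compose2[OF f] continuous_on_compose2[OF k]) auto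

lemma avg_integrable: "(\<lambda>s. k s * f (x + s *\<^sub>R d)) integrable_on {b..c}"
  by (intro integrable_continuous_real avg_integrand_continuous)

lemma avg_continuous: "continuous_on S (avg a k d f)"
proof -
  have "continuous_on (S \<times> cbox (-a) a) (\<lambda>(x, s). k s * f (x + s *\<^sub>R d))"
    unfolding case_prod_beta
    by (intro continuous_intros continuous_on_compose2[OF f] continuous_on_compose2[OF k]) auto
  from integral_continuous_on_param[OF this] show ?thesis
    by (simp add: avg_def[abs_def])
qed

text \<open>Two functions and two base points are allowed at once to serve three estimates:
  \<open>f = g\<close> gives the Lipschitz bound, \<open>x = y\<close> the contraction, a constant
  \<open>g\<close> the closeness to a value.\<close>

lemma avg_diff_le:
  assumes g: "continuous_on UNIV g" and b: "\<And>s. \<bar>s\<bar> \<le> a \<Longrightarrow> \<bar>f (x + s *\<^sub>R d) - g (y + s *\<^sub>R d)\<bar> \<le> B"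
  shows "\<bar>avg a k d f x - integral {-a..a} (\<lambda>s. k s * g (y + s *\<^sub>R d))\<bar>
           \<le> integral {-a..a} (\<lambda>s. \<bar>k s\<bar>) * B"
proof -
  have gi: "(\<lambda>s. k s * g (y + s *\<^sub>R d)) integrable_on {-a..a}"
    by (intro integrable_continuous_real continuous_intros continuous_on_compose2[OF g]
        continuous_on_compose2[OF k]) auto
  have "avg a k d f x - integral {-a..a} (\<lambda>s. k s * g (y + s *\<^sub>R d))
      = integral {-a..a} (\<lambda>s. k s * f (x + s *\<^sub>R d) - k s * g (y + s *\<^sub>R d))"
    unfolding avg_def by (rule integral_diff[symmetric]) (rule avg_integrable gi)+
  also have "\<bar>\<dots>\<bar> \<le> integral {-a..a} (\<lambda>s. \<bar>k s\<bar> * B)"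
    unfolding real_norm_def[symmetric]
  proof (rule integral_norm_bound_integral)
    show "(\<lambda>s. k s * f (x + s *\<^sub>R d) - k s * g (y + s *\<^sub>R d)) integrable_on {-a..a}"
      by (intro integrable_diff avg_integrable gi)
    show "(\<lambda>s. norm (k s) * B) integrable_on {-a..a}"
      by (intro integrable_continuous_real continuous_intros continuous_on_compose2[OF k]) auto
    show "norm (k s * f (x + s *\<^sub>R d) - k s * g (y + s *\<^sub>R d)) \<le> norm (k s) * B"
      if "s \<in> {-a..a}" for s
      using b[of s] that by (auto simp: right_diff_distrib[symmetric] abs_mult mult_left_mono)
  qed
  finally show ?thesis by simp
qed

end

lemma avg_lipschitz:
  assumes f: "L-lipschitz_on UNIV f" and k: "continuous_on UNIV k"
  shows "(integral {-a..a} (\<lambda>s. \<bar>k s\<bar>) * L)-lipschitz_on UNIV (avg a k d f)"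
proof (rule lipschitz_onI)
  have fc: "continuous_on UNIV f" using f by (rule lipschitz_on_continuous_on)
  fix x y
  have "\<bar>avg a k d f x - avg a k d f y\<bar> \<le> integral {-a..a} (\<lambda>s. \<bar>k s\<bar>) * (L * dist x y)"
    unfolding avg_def[of a k d f y]
  proof (rule avg_diff_le[OF fc k fc])
    show "\<bar>f (x + s *\<^sub>R d) - f (y + s *\<^sub>R d)\<bar> \<le> L * dist x y" for s
      using lipschitz_onD[OF f, of "x + s *\<^sub>R d" "y + s *\<^sub>R d"] by (simp add: dist_norm)
  qed
  then show "dist (avg a k d f x) (avg a k d f y) \<le> integral {-a..a} (\<lambda>s. \<bar>k s\<bar>) * L * dist x y"
    by (simp add: dist_real_def mult.assoc)
next
  show "0 \<le> integral {-a..a} (\<lambda>s. \<bar>k s\<bar>) * L"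
    using lipschitz_on_nonneg[OF f] k
    by (intro mult_nonneg_nonneg integral_nonneg integrable_continuous_real continuous_intros
        continuous_on_compose2[OF k]) auto
qed

lemma mollifierD:
  assumes "mollifier a k"
  shows "smooth_kernel a k" "continuous_on UNIV k" "\<And>s. k s \<ge> 0" "integral {-a..a} k = 1"
    "integral {-a..a} (\<lambda>s. \<bar>k s\<bar>) = 1"
  using assms smooth_kernel_continuous[of a k UNIV] by (auto simp: mollifier_def)

lemma avg_mollifier_close:
  assumes f: "continuous_on UNIV f" and k: "mollifier a k"
    and b: "\<And>s. \<bar>s\<bar> \<le> a \<Longrightarrow> \<bar>f (x + s *\<^sub>R d) - c\<bar> \<le> B"
  shows "\<bar>avg a k d f x - c\<bar> \<le> B"
proof -
  have "\<bar>avg a k d f x - integral {-a..a} (\<lambda>s. k s * c)\<bar> \<le> integral {-a..a} (\<lambda>s. \<bar>k s\<bar>) * B"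
    using avg_diff_le[OF f mollifierD(2)[OF k], of "\<lambda>_. c"] b by auto
  then show ?thesis using mollifierD[OF k] by simp
qed

lemma avg_contraction:
  assumes f: "continuous_on UNIV f" and g: "continuous_on UNIV g" and k: "continuous_on UNIV k"
    and b: "\<And>x. \<bar>f x - g x\<bar> \<le> B"
  shows "\<bar>avg a k d f x - avg a k d g x\<bar> \<le> integral {-a..a} (\<lambda>s. \<bar>k s\<bar>) * B"
  unfolding avg_def[of a k d g] by (rule avg_diff_le[OF f k g]) (rule b)

text \<open>A translation makes the interval of integration move with \<open>t\<close>. Since the
  integrand vanishes off that interval, one fixed interval serves all \<open>t\<close> up to 1, as
  differentiation under the integral sign requires.\<close>

lemma integral_smooth_kernel_extend:
  fixes h :: "real \<Rightarrow> real"
  assumes z: "\<And>s. \<bar>s - t\<bar> > a \<Longrightarrow> h s = (0::real)" and h: "continuous_on UNIV h" and t: "\<bar>t\<bar> \<le> 1"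
  shows "integral {-a-1..a+1} h = integral {-a+t..a+t} h"
proof -
  have "(h has_integral integral {-a+t..a+t} h) {-a+t..a+t}"
    by (rule integrable_integral[OF integrable_continuous_real[OF continuous_on_subset[OF h subset_UNIV]]])
  then have "(h has_integral integral {-a+t..a+t} h) {-a-1..a+1}"
    by (rule has_integral_on_superset) (use z t in auto)
  then show ?thesis by (rule integral_unique)
qed

text \<open>A substitution moves the translation from \<open>f\<close> to the kernel, so that mere
  continuity of \<open>f\<close> suffices; the sign comes from differentiating
  \<open>k (s - t)\<close> in \<open>t\<close>.\<close>

lemma dir_deriv_avg_kernel:
  assumes f: "continuous_on UNIV f" and k: "smooth_kernel a k"
    and k': "smooth_kernel a k'" "\<And>s. (k has_real_derivative k' s) (at s)"
  shows "dir_deriv d (avg a k d f) (avg a (\<lambda>s. - k' s) d f)"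
  unfolding dir_deriv_def
proof
  fix x
  have kc: "continuous_on UNIV k" and kc': "continuous_on UNIV k'"
    using k k' smooth_kernel_continuous by auto
  define G where "G t = integral {-a-1..a+1} (\<lambda>s. k (s - t) * f (x + s *\<^sub>R d))" for t
  have eq: "avg a k d f (x + t *\<^sub>R d) = G t" if "\<bar>t\<bar> \<le> 1" for t
  proof -
    have "G t = integral {-a+t..a+t} (\<lambda>s. k (s - t) * f (x + s *\<^sub>R d))"
      unfolding G_def
      by (rule integral_smooth_kernel_extend[OF _ _ that])
        (use k in \<open>auto simp: smooth_kernel_def intro!: continuous_intros continuous_on_compose2[OF f]
          continuous_on_compose2[OF kc]\<close>)
    also have "\<dots> = integral {-a+t-t..a+t-t} (\<lambda>s. k (s + t - t) * f (x + (s + t) *\<^sub>R d))"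
      by (rule integral_shift_real_ivl[symmetric])
    finally show ?thesis by (simp add: avg_def algebra_simps)
  qed
  have "(G has_real_derivative integral (cbox (-a-1) (a+1)) (\<lambda>s. - k' (s - 0) * f (x + s *\<^sub>R d)))
          (at 0 within UNIV)"
    unfolding G_def cbox_interval[symmetric]
  proof (rule leibniz_rule_field_derivative)
    show "((\<lambda>t. k (s - t) * f (x + s *\<^sub>R d)) has_real_derivative - k' (s - t) * f (x + s *\<^sub>R d))
            (at t within UNIV)" for t s
      by (auto intro!: derivative_eq_intros DERIV_chain2[OF k'(2)])
    show "(\<lambda>s. k (s - t) * f (x + s *\<^sub>R d)) integrable_on cbox (-a-1) (a+1)" for t
      unfolding cbox_interval
      by (intro integrable_continuous_real continuous_intros continuous_on_compose2[OF f]
          continuous_on_compose2[OF kc]) auto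
    show "continuous_on (UNIV \<times> cbox (-a-1) (a+1)) (\<lambda>(t, s). - k' (s - t) * f (x + s *\<^sub>R d))"
      unfolding case_prod_beta
      by (intro continuous_intros continuous_on_compose2[OF f] continuous_on_compose2[OF kc']) auto
  qed auto
  moreover have "integral {-a-1..a+1} (\<lambda>s. - k' (s - 0) * f (x + s *\<^sub>R d))
      = integral {-a+0..a+0} (\<lambda>s. - k' (s - 0) * f (x + s *\<^sub>R d))"
    by (rule integral_smooth_kernel_extend)
      (use k' in \<open>auto simp: smooth_kernel_def intro!: continuous_intros continuous_on_compose2[OF f]
          continuous_on_compose2[OF kc']\<close>)
  ultimately have "(G has_real_derivative avg a (\<lambda>s. - k' s) d f x) (at 0)"
    by (simp add: avg_def)
  then show "((\<lambda>t. avg a k d f (x + t *\<^sub>R d)) has_real_derivative avg a (\<lambda>s. - k' s) d f x) (at 0)"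
    by (rule has_field_derivative_transform_within_open[where S = "{-1<..<1}"]) (use eq in auto)
qed

text \<open>Counterpart of the preceding lemma in which the derivative stays on the integrand: an
  outer average preserves a derivative already gained from an inner one.\<close>

lemma dir_deriv_avg:
  assumes f: "continuous_on UNIV f" and g: "continuous_on UNIV g" and k: "continuous_on UNIV k"
    and fg: "dir_deriv e f g"
  shows "dir_deriv e (avg a k d f) (avg a k d g)"
  unfolding dir_deriv_def
proof
  fix x
  have "((\<lambda>t. integral (cbox (-a) a) (\<lambda>s. k s * f ((x + s *\<^sub>R d) + t *\<^sub>R e))) has_real_derivative
           integral (cbox (-a) a) (\<lambda>s. k s * g ((x + s *\<^sub>R d) + 0 *\<^sub>R e))) (at 0 within UNIV)"
  proof (rule leibniz_rule_field_derivative)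
    show "((\<lambda>t. k s * f ((x + s *\<^sub>R d) + t *\<^sub>R e)) has_real_derivative
            k s * g ((x + s *\<^sub>R d) + t *\<^sub>R e)) (at t within UNIV)" for t s
      by (rule DERIV_cmult) (rule dir_derivD[OF fg])
    show "(\<lambda>s. k s * f ((x + s *\<^sub>R d) + t *\<^sub>R e)) integrable_on cbox (-a) a" for t
      unfolding cbox_interval
      by (intro integrable_continuous_real continuous_intros continuous_on_compose2[OF f]
          continuous_on_compose2[OF k]) auto
    show "continuous_on (UNIV \<times> cbox (-a) a) (\<lambda>(t, s). k s * g ((x + s *\<^sub>R d) + t *\<^sub>R e))"
      unfolding case_prod_beta
      by (intro continuous_intros continuous_on_compose2[OF g] continuous_on_compose2[OF k]) auto
  qed auto
  then show "((\<lambda>t. avg a k d f (x + t *\<^sub>R e)) has_real_derivative avg a k d g x) (at 0)"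
    by (simp add: avg_def add_ac)
qed

text \<open>Integrate the inequalities for the translates against the nonnegative kernel and
  exchange the integrals. The curve \<open>c\<close> is arbitrary so that the lemma can be iterated,
  each average passing a translated curve to the next.\<close>

lemma avg_submean:
  assumes f: "continuous_on UNIV f" and k: "continuous_on UNIV k" "\<And>s. k s \<ge> 0"
    and c: "continuous_on {0..2 * pi} c"
    and sub: "\<And>s. \<bar>s\<bar> \<le> a \<Longrightarrow> f (x + s *\<^sub>R d) \<le> circle_mean (\<lambda>\<theta>. f (c \<theta> + s *\<^sub>R d))"
  shows "avg a k d f x \<le> circle_mean (\<lambda>\<theta>. avg a k d f (c \<theta>))"
proof -
  have cont: "continuous_on (cbox (-a, 0) (a, 2 * pi)) (\<lambda>(s, \<theta>). k s * f (c \<theta> + s *\<^sub>R d))"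
    unfolding case_prod_beta
    by (intro continuous_intros continuous_on_compose2[OF f] continuous_on_compose2[OF c]
        continuous_on_compose2[OF k(1)]) auto
  have ci: "(\<lambda>s. integral (cbox 0 (2 * pi)) (\<lambda>\<theta>. k s * f (c \<theta> + s *\<^sub>R d))) integrable_on {-a..a}"
    unfolding cbox_interval[symmetric]
    by (rule integrable_continuous, rule integral_continuous_on_param)
      (use cont in \<open>simp add: cbox_Pair_eq\<close>)
  have "avg a k d f x \<le> integral {-a..a} (\<lambda>s. k s * circle_mean (\<lambda>\<theta>. f (c \<theta> + s *\<^sub>R d)))"
    unfolding avg_def
  proof (rule integral_le)
    show "(\<lambda>s. k s * circle_mean (\<lambda>\<theta>. f (c \<theta> + s *\<^sub>R d))) integrable_on {-a..a}"
      using integrable_on_mult_right[OF ci, of "1 / (2 * pi)"]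
      by (simp add: circle_mean_def mult_ac)
  qed (use sub k avg_integrable[OF f k(1)] in \<open>auto intro!: mult_left_mono\<close>)
  also have "\<dots> = 1 / (2 * pi) * integral (cbox (-a) a) (\<lambda>s. integral (cbox 0 (2 * pi))
      (\<lambda>\<theta>. k s * f (c \<theta> + s *\<^sub>R d)))"
    unfolding integral_mult_right[symmetric] by (simp add: circle_mean_def mult_ac)
  also have "\<dots> = circle_mean (\<lambda>\<theta>. avg a k d f (c \<theta>))"
    by (subst integral_swap_continuous[OF cont]) (simp add: circle_mean_def avg_def)
  finally show ?thesis .
qed

section \<open>Maximum principle on the disc\<close>

abbreviation ecis :: "real \<Rightarrow> complex" where
  "ecis \<theta> \<equiv> exp (\<i> * complex_of_real \<theta>)"

text \<open>Cauchy's integral formula. The factor \<open>c\<close> admits every real-linear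
  functional of the value of \<open>g\<close>, which is how gradients enter later.\<close>

lemma circle_mean_holomorphic:
  assumes "g holomorphic_on cball z r" "r > 0"
  shows "circle_mean (\<lambda>\<theta>. Re (c * g (z + of_real r * ecis \<theta>))) = Re (c * g z)"
proof -
  have "((\<lambda>u. g u / (u - z)) has_contour_integral (2 * of_real pi * \<i> * g z)) (part_circlepath z r 0 (2 * pi))"
    using Cauchy_integral_circlepath_simple[OF assms(1), of z] assms(2) by (simp add: circlepath_def)
  then have "((\<lambda>t. g (z + r * cis t) / (z + r * cis t - z) * r * \<i> * cis t) has_integral
      (2 * of_real pi * \<i> * g z)) {0..2 * pi}"
    by (subst (asm) has_contour_integral_part_circlepath_iff) auto
  then have "((\<lambda>t. \<i> * g (z + r * cis t)) has_integral (2 * of_real pi * \<i> * g z)) {0..2 * pi}"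
    by (rule has_integral_eq[rotated]) (use assms in auto)
  from has_integral_mult_right[OF this, of "- \<i> * c"]
  have "((\<lambda>t. c * g (z + r * ecis t)) has_integral (2 * of_real pi * (c * g z))) {0..2 * pi}"
    by (simp add: cis_conv_exp mult_ac)
  from has_integral_linear[OF this bounded_linear_Re]
  have "((\<lambda>t. Re (c * g (z + r * ecis t))) has_integral (2 * pi * Re (c * g z))) {0..2 * pi}"
    by (simp add: o_def)
  then show ?thesis
    by (simp add: circle_mean_def integral_unique)
qed

text \<open>On the unit circle \<open>cnj l\<close> is the inverse of \<open>l\<close>, so these
  real parts are exactly the real trigonometric polynomials and form an algebra; they separate
  points, so Stone-Weierstrass applies.\<close>

lemma Re_poly_dense:
  assumes "continuous_on (sphere 0 1) v" "\<epsilon> > 0"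
  obtains p :: "complex poly" where "\<And>l. cmod l = 1 \<Longrightarrow> \<bar>v l - Re (poly p l)\<bar> < \<epsilon>"
proof -
  define P where "P f \<longleftrightarrow> (\<exists>p. \<forall>l\<in>sphere 0 1. f l = Re (poly p l))" for f
  have P_const: "P (\<lambda>_. c)" for c
    unfolding P_def by (intro exI[of _ "[:complex_of_real c:]"]) simp
  have P_add: "P (\<lambda>l. f l + g l)" if "P f" "P g" for f g
  proof -
    from that obtain p q where "\<forall>l\<in>sphere 0 1. f l = Re (poly p l)" "\<forall>l\<in>sphere 0 1. g l = Re (poly q l)"
      by (auto simp: P_def)
    then show ?thesis unfolding P_def by (intro exI[of _ "p + q"]) simp
  qed
  have P_sum: "finite A \<Longrightarrow> (\<And>i. i \<in> A \<Longrightarrow> P (f i)) \<Longrightarrow> P (\<lambda>l. \<Sum>i\<in>A. f i l)" for A and f :: "nat \<Rightarrow> complex \<Rightarrow> real"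
    by (induction A rule: finite_induct) (auto intro: P_const P_add)
  have P_cong: "P g" if "P f" "\<And>l. cmod l = 1 \<Longrightarrow> f l = g l" for f g
    using that by (auto simp: P_def)
  \<comment> \<open>Uses Re x * Re y = Re ((x y + x cnj y) / 2); the assumption
    \<open>m \<le> k\<close> keeps the exponent of the mixed term nonnegative.\<close>
  have mono1: "P (\<lambda>l. Re (a * l ^ k) * Re (b * l ^ m))" if "m \<le> k" for a b k m
    unfolding P_def
  proof (intro exI ballI)
    fix l :: complex assume "l \<in> sphere 0 1"
    then have l: "l * cnj l = 1" by (simp add: complex_norm_square[symmetric])
    have "l ^ k * cnj (l ^ m) = l ^ (k - m) * (l * cnj l) ^ m"
      using that by (simp add: power_mult_distrib power_add[symmetric])
    then have "l ^ k * cnj (l ^ m) = l ^ (k - m)" using l by simp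
    then have "(a * l ^ k) * cnj (b * l ^ m) = a * cnj b * l ^ (k - m)"
      by (metis (no_types, lifting) complex_cnj_mult mult.assoc mult.left_commute)
    moreover have "(a * l ^ k) * (b * l ^ m) = a * b * l ^ (k + m)"
      by (simp add: power_add)
    moreover have "Re x * Re y = Re ((x * y + x * cnj y) / 2)" for x y
      by simp
    ultimately have "Re (a * l ^ k) * Re (b * l ^ m) = Re ((a * b * l ^ (k + m) + a * cnj b * l ^ (k - m)) / 2)"
      by presburger
    then show "Re (a * l ^ k) * Re (b * l ^ m) = Re (poly (monom (a * b / 2) (k + m) + monom (a * cnj b / 2) (k - m)) l)"
      by (simp add: poly_monom add_divide_distrib)
  qed
  have mono: "P (\<lambda>l. Re (a * l ^ k) * Re (b * l ^ m))" for a b k m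
    using mono1[of m k a b] mono1[of k m b a] by (cases "m \<le> k") (auto simp: mult.commute)
  have P_mult: "P (\<lambda>l. f l * g l)" if "P f" "P g" for f g
  proof -
    from that obtain p q where "\<forall>l\<in>sphere 0 1. f l = Re (poly p l)" "\<forall>l\<in>sphere 0 1. g l = Re (poly q l)"
      by (auto simp: P_def)
    then have "f l * g l = (\<Sum>i\<le>degree p. \<Sum>j\<le>degree q. Re (coeff p i * l ^ i) * Re (coeff q j * l ^ j))"
      if "cmod l = 1" for l
      using that by (simp add: poly_altdef sum_product)
    then show ?thesis
      by (intro P_cong[OF P_sum[OF _ P_sum[OF _ mono]]]) auto
  qed
  have P_sep: "\<exists>f. P f \<and> f x \<noteq> f y" if "x \<noteq> y" for x y
  proof (cases "Re x = Re y")
    case False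
    then show ?thesis by (intro exI[of _ Re]) (auto simp: P_def intro!: exI[of _ "[:0, 1:]"])
  next
    case True
    with that have "Im x \<noteq> Im y" by (auto simp: complex_eq_iff)
    then show ?thesis by (intro exI[of _ Im]) (auto simp: P_def intro!: exI[of _ "[:0, - \<i>:]"])
  qed
  have P_cont: "continuous_on (sphere 0 1) f" if "P f" for f
  proof -
    from that obtain p where p: "\<And>l. l \<in> sphere 0 1 \<Longrightarrow> f l = Re (poly p l)"
      by (auto simp: P_def)
    have "continuous_on (sphere 0 1) (\<lambda>l. Re (poly p l))" by (intro continuous_intros)
    then show ?thesis by (rule continuous_on_eq) (use p in auto)
  qed
  have "\<exists>g. P g \<and> (\<forall>x\<in>sphere 0 1. \<bar>v x - g x\<bar> < \<epsilon>)"
  proof (rule Stone_Weierstrass_HOL)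
    show "compact (sphere 0 1 :: complex set)" by simp
    show "\<exists>f. P f \<and> f x \<noteq> f y" if "x \<in> sphere 0 1 \<and> y \<in> sphere 0 1 \<and> x \<noteq> y" for x y
      using P_sep that by auto
  qed (use P_const P_add P_mult P_cont assms in auto)
  then obtain p where "\<forall>l\<in>sphere 0 1. \<bar>v l - Re (poly p l)\<bar> < \<epsilon>"
    by (auto simp: P_def)
  then show ?thesis by (intro that[of p]) auto
qed

lemma disc_max_principle:
  fixes \<phi> :: "complex \<Rightarrow> real"
  assumes cont: "continuous_on (cball 0 1) \<phi>"
    and sub: "\<And>z \<epsilon>. cmod z < 1 \<Longrightarrow> \<epsilon> > 0 \<Longrightarrow> \<exists>r0>0. \<forall>r. 0 < r \<and> r < r0 \<longrightarrow>
                \<phi> z - \<epsilon> * r\<^sup>2 \<le> circle_mean (\<lambda>\<theta>. \<phi> (z + of_real r * ecis \<theta>))"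
    and bdry: "\<And>z. cmod z = 1 \<Longrightarrow> \<phi> z \<le> m" and z: "cmod z \<le> 1"
  shows "\<phi> z \<le> m"
proof (rule ccontr)
  assume "\<not> \<phi> z \<le> m"
  then have gt: "\<phi> z > m" by simp
  \<comment> \<open>Half the gap: on the unit circle \<open>w\<close> is at most
    \<open>m + e\<close>, which is still below \<open>\<phi> z\<close>, hence below
    \<open>w z\<close>.\<close>
  define e where "e = (\<phi> z - m) / 2"
  define w where "w l = \<phi> l + e * (cmod l)\<^sup>2" for l
  have e: "e > 0" using gt by (simp add: e_def)
  have wc: "continuous_on (cball 0 1) w"
    unfolding w_def by (intro continuous_intros cont)
  then obtain y where y: "y \<in> cball 0 1" and ymax: "\<And>x. x \<in> cball 0 1 \<Longrightarrow> w x \<le> w y"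
    using continuous_attains_sup[of "cball 0 1" w] by auto
  have "cmod y \<noteq> 1"
  proof
    assume "cmod y = 1"
    then have "w y \<le> m + e" using bdry[of y] by (simp add: w_def)
    moreover have "w y \<ge> \<phi> z"
      using ymax[of z] z e by (auto simp: w_def intro: order_trans[rotated])
    ultimately show False using e by (simp add: e_def field_simps)
  qed
  with y have y1: "cmod y < 1" by simp
  obtain r0 where r0: "r0 > 0" "\<And>r. 0 < r \<Longrightarrow> r < r0 \<Longrightarrow>
      \<phi> y - e / 2 * r\<^sup>2 \<le> circle_mean (\<lambda>\<theta>. \<phi> (y + of_real r * ecis \<theta>))"
    using sub[OF y1, of "e / 2"] e by auto
  define r where "r = min (r0 / 2) (1 - cmod y)"
  have r: "r > 0" "r < r0" "r \<le> 1 - cmod y" using r0 y1 by (auto simp: r_def)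
  have inb: "y + of_real r * ecis \<theta> \<in> cball 0 1" for \<theta>
    using norm_triangle_ineq[of y "of_real r * ecis \<theta>"] r by (simp add: norm_mult)
  have pc: "continuous_on {0..2 * pi} (\<lambda>\<theta>. y + of_real r * ecis \<theta>)"
    by (intro continuous_intros)
  have sq: "e * (cmod (y + of_real r * ecis \<theta>))\<^sup>2
      = e * ((cmod y)\<^sup>2 + r\<^sup>2) + Re ((2 * of_real e * cnj y) * (\<lambda>u. u - y) (y + of_real r * ecis \<theta>))" for \<theta>
  proof -
    have "(cmod (y + of_real r * ecis \<theta>))\<^sup>2 = (cmod y)\<^sup>2 + r\<^sup>2 * (cmod (ecis \<theta>))\<^sup>2 + 2 * r * Re (cnj y * ecis \<theta>)"
      unfolding cmod_power2 by (simp add: power2_eq_square algebra_simps)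
    then show ?thesis by (simp add: algebra_simps)
  qed
  have "circle_mean (\<lambda>\<theta>. w (y + of_real r * ecis \<theta>))
      = circle_mean (\<lambda>\<theta>. \<phi> (y + of_real r * ecis \<theta>))
        + (circle_mean (\<lambda>\<theta>. e * ((cmod y)\<^sup>2 + r\<^sup>2))
           + circle_mean (\<lambda>\<theta>. Re ((2 * of_real e * cnj y) * (\<lambda>u. u - y) (y + of_real r * ecis \<theta>))))"
    unfolding w_def sq
    by (subst circle_mean_add, rule continuous_on_compose2[OF cont pc], use inb in blast,
        intro continuous_intros, subst circle_mean_add) (intro continuous_intros | simp)+
  also have "circle_mean (\<lambda>\<theta>. Re ((2 * of_real e * cnj y) * (\<lambda>u. u - y) (y + of_real r * ecis \<theta>))) = 0"
    by (subst circle_mean_holomorphic) (use r in \<open>auto intro!: holomorphic_intros\<close>)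
  finally have "circle_mean (\<lambda>\<theta>. w (y + of_real r * ecis \<theta>)) \<ge> w y + e / 2 * r\<^sup>2"
    using r0(2)[OF r(1,2)] by (simp add: w_def algebra_simps)
  moreover have "circle_mean (\<lambda>\<theta>. w (y + of_real r * ecis \<theta>)) \<le> circle_mean (\<lambda>\<theta>. w y)"
  proof (rule circle_mean_mono)
    show "continuous_on {0..2 * pi} (\<lambda>\<theta>. w (y + of_real r * ecis \<theta>))"
      by (rule continuous_on_compose2[OF wc pc]) (use inb in blast)
  qed (use ymax inb in auto)
  moreover have "e / 2 * r\<^sup>2 > 0" using e r by simp
  ultimately show False by simp
qed

text \<open>Subtract Re p for a polynomial p close to \<open>\<phi>\<close> on the circle. The local
  hypothesis survives, the maximum principle bounds the difference at 0, and the mean value property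
  evaluates Re p at 0.\<close>

lemma local_submean_imp_submean:
  fixes \<phi> :: "complex \<Rightarrow> real"
  assumes cont: "continuous_on (cball 0 1) \<phi>"
    and sub: "\<And>z. cmod z < 1 \<Longrightarrow> \<exists>r0>0. \<forall>r. 0 < r \<and> r < r0 \<longrightarrow>
                \<phi> z \<le> circle_mean (\<lambda>\<theta>. \<phi> (z + of_real r * ecis \<theta>))"
  shows "\<phi> 0 \<le> circle_mean (\<lambda>\<theta>. \<phi> (ecis \<theta>))"
proof (rule field_le_epsilon)
  fix e :: real assume "e > 0"
  then obtain p where p: "\<And>l. cmod l = 1 \<Longrightarrow> \<bar>\<phi> l - Re (poly p l)\<bar> < e / 2"
    using Re_poly_dense[of \<phi> "e / 2"] cont continuous_on_subset[of "cball 0 1" \<phi> "sphere 0 1"] by auto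
  have mv: "circle_mean (\<lambda>\<theta>. Re (poly p (z + of_real r * ecis \<theta>))) = Re (poly p z)" if "r > 0" for z r
    using circle_mean_holomorphic[of "poly p" z r 1] that by (simp add: holomorphic_intros poly_holomorphic_on)
  have "\<phi> 0 - Re (poly p 0) \<le> e / 2"
  proof (rule disc_max_principle[of "\<lambda>l. \<phi> l - Re (poly p l)"])
    show "continuous_on (cball 0 1) (\<lambda>l. \<phi> l - Re (poly p l))"
      by (intro continuous_intros cont)
    show "\<phi> z - Re (poly p z) \<le> e / 2" if "cmod z = 1" for z
      using p[OF that] by linarith
  next
    fix z :: complex and \<epsilon> :: real assume z: "cmod z < 1" and "\<epsilon> > 0"
    obtain r0 where r0: "r0 > 0" "\<And>r. 0 < r \<Longrightarrow> r < r0 \<Longrightarrow>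
        \<phi> z \<le> circle_mean (\<lambda>\<theta>. \<phi> (z + of_real r * ecis \<theta>))"
      using sub[OF z] by auto
    show "\<exists>r0>0. \<forall>r. 0 < r \<and> r < r0 \<longrightarrow> \<phi> z - Re (poly p z) - \<epsilon> * r\<^sup>2
        \<le> circle_mean (\<lambda>\<theta>. \<phi> (z + of_real r * ecis \<theta>) - Re (poly p (z + of_real r * ecis \<theta>)))"
    proof (intro exI[of _ "min r0 (1 - cmod z)"] conjI allI impI)
      fix r assume r: "0 < r \<and> r < min r0 (1 - cmod z)"
      have inb: "z + of_real r * ecis \<theta> \<in> cball 0 1" for \<theta>
        using norm_triangle_ineq[of z "of_real r * ecis \<theta>"] r by (simp add: norm_mult)
      have "circle_mean (\<lambda>\<theta>. \<phi> (z + of_real r * ecis \<theta>) - Re (poly p (z + of_real r * ecis \<theta>)))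
          = circle_mean (\<lambda>\<theta>. \<phi> (z + of_real r * ecis \<theta>)) - Re (poly p z)"
        by (subst circle_mean_diff)
          (use inb r mv in \<open>auto intro!: continuous_intros continuous_on_compose2[OF cont]\<close>)
      moreover have "\<epsilon> * r\<^sup>2 \<ge> 0" using \<open>\<epsilon> > 0\<close> by simp
      ultimately show "\<phi> z - Re (poly p z) - \<epsilon> * r\<^sup>2
        \<le> circle_mean (\<lambda>\<theta>. \<phi> (z + of_real r * ecis \<theta>) - Re (poly p (z + of_real r * ecis \<theta>)))"
        using r0(2)[of r] r by simp
    qed (use r0 z in auto)
  qed auto
  moreover have "Re (poly p 0) \<le> circle_mean (\<lambda>\<theta>. \<phi> (ecis \<theta>)) + e / 2"
  proof -
    have "circle_mean (\<lambda>\<theta>. Re (poly p (ecis \<theta>))) \<le> circle_mean (\<lambda>\<theta>. \<phi> (ecis \<theta>) + e / 2)"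
    proof (rule circle_mean_mono)
      show "Re (poly p (ecis \<theta>)) \<le> \<phi> (ecis \<theta>) + e / 2" for \<theta>
        using p[OF norm_exp_i_times[of \<theta>]] by linarith
    qed (auto intro!: continuous_intros continuous_on_compose2[OF cont])
    also have "\<dots> = circle_mean (\<lambda>\<theta>. \<phi> (ecis \<theta>)) + e / 2"
      by (subst circle_mean_add) (auto intro!: continuous_intros continuous_on_compose2[OF cont])
    finally show ?thesis using mv[of 1 0] by simp
  qed
  ultimately show "\<phi> 0 \<le> circle_mean (\<lambda>\<theta>. \<phi> (ecis \<theta>)) + e" by simp
qed

text \<open>The displacements are added one direction at a time, each by the mean value inequality.
  The base point \<open>x\<close> may vary near \<open>p\<close> while the derivatives stay at
  \<open>p\<close>: later the expansion is made about all points of a small circle with one fixed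
  gradient.\<close>

lemma C1_expansion:
  fixes f :: "'a::real_normed_vector \<Rightarrow> real" and d :: "'i \<Rightarrow> 'a"
  assumes "finite I" "open V" "p \<in> V" "\<epsilon> > 0"
    and "\<And>i x. i \<in> I \<Longrightarrow> x \<in> V \<Longrightarrow> ((\<lambda>t. f (x + t *\<^sub>R d i)) has_real_derivative P i x) (at 0)"
    and "\<And>i. i \<in> I \<Longrightarrow> continuous_on V (P i)"
  shows "\<exists>r>0. \<forall>x e. dist p x < r \<longrightarrow> (\<forall>i\<in>I. \<bar>e i\<bar> < r) \<longrightarrow>
           \<bar>f (x + (\<Sum>i\<in>I. e i *\<^sub>R d i)) - f x - (\<Sum>i\<in>I. e i * P i p)\<bar> \<le> \<epsilon> * (\<Sum>i\<in>I. \<bar>e i\<bar>)"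
  using assms
proof (induction I rule: finite_induct)
  case empty
  show ?case by (auto intro: exI[of _ 1])
next
  case (insert j I)
  from insert.IH insert.prems obtain r1 where r1: "r1 > 0"
    "\<And>x e. dist p x < r1 \<Longrightarrow> (\<forall>i\<in>I. \<bar>e i\<bar> < r1) \<Longrightarrow>
       \<bar>f (x + (\<Sum>i\<in>I. e i *\<^sub>R d i)) - f x - (\<Sum>i\<in>I. e i * P i p)\<bar> \<le> \<epsilon> * (\<Sum>i\<in>I. \<bar>e i\<bar>)"
    by auto
  have "isCont (P j) p"
    using insert.prems continuous_on_eq_continuous_at by blast
  then have "\<exists>r>0. \<forall>y. dist y p < r \<longrightarrow> dist (P j y) (P j p) < \<epsilon>"
    using \<open>\<epsilon> > 0\<close> unfolding continuous_at_eps_delta by blast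
  moreover have "\<exists>r>0. ball p r \<subseteq> V"
    using insert.prems open_contains_ball by blast
  ultimately obtain ra rb where "ra > 0" "rb > 0" "\<And>y. dist y p < ra \<Longrightarrow> dist (P j y) (P j p) < \<epsilon>"
    "ball p rb \<subseteq> V" by blast
  then obtain r2 where r2: "r2 > 0" "\<And>y. dist p y < r2 \<Longrightarrow> \<bar>P j y - P j p\<bar> \<le> \<epsilon>"
    "\<And>y. dist p y < r2 \<Longrightarrow> y \<in> V"
    by (intro that[of "min ra rb"]) (auto simp: dist_commute dist_real_def less_imp_le)
  \<comment> \<open>The summand 1 pays for \<open>dist p x < r\<close>, the others for the
    displacements, each with coefficient below \<open>r\<close>.\<close>
  define N where "N = 1 + (\<Sum>i\<in>I. norm (d i)) + norm (d j)"
  have N: "N \<ge> 1" by (simp add: N_def sum_nonneg)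
  define r where "r = min r1 (r2 / N)"
  have r: "r > 0" "r \<le> r1" "r * N \<le> r2" using r1 r2 N
    by (auto simp: r_def min_def field_simps)
  have "\<bar>f (x + (\<Sum>i\<in>insert j I. e i *\<^sub>R d i)) - f x - (\<Sum>i\<in>insert j I. e i * P i p)\<bar>
          \<le> \<epsilon> * (\<Sum>i\<in>insert j I. \<bar>e i\<bar>)"
    if x: "dist p x < r" and e: "\<forall>i\<in>insert j I. \<bar>e i\<bar> < r" for x e
  proof -
    define y where "y = x + (\<Sum>i\<in>I. e i *\<^sub>R d i)"
    have near: "dist p (y + s *\<^sub>R d j) < r2" if s: "\<bar>s\<bar> \<le> \<bar>e j\<bar>" for s
    proof -
      have "dist p (y + s *\<^sub>R d j) \<le> dist p x + dist x (y + s *\<^sub>R d j)"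
        by (rule dist_triangle)
      also have "dist x (y + s *\<^sub>R d j) \<le> (\<Sum>i\<in>I. norm (e i *\<^sub>R d i)) + norm (s *\<^sub>R d j)"
      proof -
        have "y + s *\<^sub>R d j - x = (\<Sum>i\<in>I. e i *\<^sub>R d i) + s *\<^sub>R d j"
          by (simp add: y_def)
        then have "dist x (y + s *\<^sub>R d j) = norm ((\<Sum>i\<in>I. e i *\<^sub>R d i) + s *\<^sub>R d j)"
          by (metis dist_commute dist_norm)
        then show ?thesis
          using norm_triangle_ineq[of "\<Sum>i\<in>I. e i *\<^sub>R d i" "s *\<^sub>R d j"]
            norm_sum[of "\<lambda>i. e i *\<^sub>R d i" I] by linarith
      qed
      also have "(\<Sum>i\<in>I. norm (e i *\<^sub>R d i)) \<le> (\<Sum>i\<in>I. r * norm (d i))"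
        unfolding norm_scaleR using e by (intro sum_mono mult_right_mono) auto
      also have "norm (s *\<^sub>R d j) \<le> r * norm (d j)"
        unfolding norm_scaleR using e s by (intro mult_right_mono) auto
      finally have "dist p (y + s *\<^sub>R d j) < r * N"
        using x by (simp add: N_def distrib_left sum_distrib_left)
      then show ?thesis using r by simp
    qed
    let ?h = "\<lambda>s. f (y + s *\<^sub>R d j) - P j p * s"
    have "norm (?h (e j) - ?h 0) \<le> \<epsilon> * norm (e j - 0)"
    proof (rule field_differentiable_bound[where S = "{-\<bar>e j\<bar>..\<bar>e j\<bar>}" and f' = "\<lambda>s. P j (y + s *\<^sub>R d j) - P j p"])
      fix s assume s: "s \<in> {-\<bar>e j\<bar>..\<bar>e j\<bar>}"
      then have s': "dist p (y + s *\<^sub>R d j) < r2" using near by auto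
      have "((\<lambda>s. f (y + s *\<^sub>R d j)) has_real_derivative P j (y + s *\<^sub>R d j)) (at s)"
        by (rule DERIV_along_line, rule insert.prems(4)) (use r2(3)[OF s'] in auto)
      then show "(?h has_real_derivative P j (y + s *\<^sub>R d j) - P j p) (at s within {-\<bar>e j\<bar>..\<bar>e j\<bar>})"
        by (rule has_field_derivative_at_within[OF DERIV_diff[OF _ DERIV_cmult_Id]])
      show "norm (P j (y + s *\<^sub>R d j) - P j p) \<le> \<epsilon>" using r2(2)[OF s'] by simp
    qed auto
    then have h1: "\<bar>f (y + e j *\<^sub>R d j) - f y - e j * P j p\<bar> \<le> \<epsilon> * \<bar>e j\<bar>"
      by (simp add: algebra_simps)
    have h2: "\<bar>f y - f x - (\<Sum>i\<in>I. e i * P i p)\<bar> \<le> \<epsilon> * (\<Sum>i\<in>I. \<bar>e i\<bar>)"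
      unfolding y_def using x e r by (intro r1(2)) auto
    have eq: "x + (\<Sum>i\<in>insert j I. e i *\<^sub>R d i) = y + e j *\<^sub>R d j"
      using insert.hyps by (simp add: y_def)
    show ?thesis
      unfolding eq unfolding sum.insert[OF insert.hyps] distrib_left using h1 h2 by linarith
  qed
  then show ?case using r(1) by blast
qed

section \<open>Maximum principle along curved discs\<close>

interpretation scaleC: bounded_bilinear scaleC
proof
  show "\<exists>K. \<forall>a b. norm (a *\<^sub>C b) \<le> norm a * norm b * K"
    by (rule exI[of _ 1]) (simp add: norm_scaleC)
qed (auto intro!: ell2_eqI simp: algebra_simps scaleR_conv_of_real)

lemma holomorphic_quadratic_remainder:
  assumes "g holomorphic_on UNIV"
  obtains C where "C \<ge> 0"
    "\<And>h. cmod h \<le> 1 \<Longrightarrow> cmod (g (z + h) - g z - h * deriv g z) \<le> C * (cmod h)\<^sup>2"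
proof -
  have hol: "(deriv ^^ n) g holomorphic_on UNIV" for n
    using assms by (intro holomorphic_higher_deriv) auto
  have "compact ((deriv ^^ 2) g ` cball z 1)"
    by (intro compact_continuous_image holomorphic_on_imp_continuous_on holomorphic_on_subset[OF hol]) auto
  then obtain B where B: "\<And>w. w \<in> cball z 1 \<Longrightarrow> cmod ((deriv ^^ 2) g w) \<le> B"
    using compact_imp_bounded bounded_iff by (metis imageI)
  have "cmod (g (z + h) - g z - h * deriv g z) \<le> max B 0 * (cmod h)\<^sup>2" if "cmod h \<le> 1" for h
  proof -
    have "cmod ((deriv ^^ 0) g (z + h) - (\<Sum>i\<le>1. (deriv ^^ i) g z * (z + h - z) ^ i / fact i))
        \<le> max B 0 * cmod (z + h - z) ^ Suc 1 / fact 1"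
    proof (rule complex_Taylor[where S = "cball z 1"])
      show "((deriv ^^ i) g has_field_derivative (deriv ^^ Suc i) g x) (at x within cball z 1)" for i x
        using holomorphic_derivI[OF hol[of i], of x] by (simp add: has_field_derivative_at_within)
      show "cmod ((deriv ^^ Suc 1) g x) \<le> max B 0" if "x \<in> cball z 1" for x
        using B[OF that] by (simp add: numeral_2_eq_2)
    qed (use that in \<open>auto simp: dist_norm\<close>)
    then show ?thesis by (simp add: power2_eq_square mult.commute algebra_simps)
  qed
  then show ?thesis by (intro that[of "max B 0"]) auto
qed

lemma plurisubharmonic_onD:
  assumes "plurisubharmonic_on X U f" "a \<in> U" "b \<in> X" "\<And>l. cmod l \<le> 1 \<Longrightarrow> a + l *\<^sub>C b \<in> U"
  shows "f a \<le> circle_mean (\<lambda>\<theta>. f (a + ecis \<theta> *\<^sub>C b))"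
  using assms by (auto simp: plurisubharmonic_on_def circle_mean_def)

text \<open>The means of a smooth function over a curved disc and over the tangent affine disc agree up to \<open>o(r\<^sup>2)\<close>, because the holomorphic remainder has mean zero; smoothing in the
  direction of the curvature suffices for this.\<close>

lemma plurisubharmonic_disc_maximum:
  assumes V: "open V" and M: "ell2.subspace M" "a \<in> M" "b \<in> M" "c \<in> M"
    and psh: "plurisubharmonic_on M (V \<inter> M) u"
    and g: "g holomorphic_on UNIV"
    and inV: "\<And>l. cmod l \<le> 1 \<Longrightarrow> a + l *\<^sub>C b + g l *\<^sub>C c \<in> V"
    and bd: "\<And>l. cmod l = 1 \<Longrightarrow> u (a + l *\<^sub>C b + g l *\<^sub>C c) \<le> m"
    and l: "cmod l \<le> 1"
  shows "u (a + l *\<^sub>C b + g l *\<^sub>C c) \<le> m"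
proof (rule ccontr)
  \<comment> \<open>Everything below takes place in two complex variables: \<open>s\<close> along
    the disc, \<open>t\<close> along the curvature direction \<open>c\<close>.\<close>
  define F where "F = (\<lambda>(s, t). a + s *\<^sub>C b + t *\<^sub>C c)"
  assume "\<not> u (a + l *\<^sub>C b + g l *\<^sub>C c) \<le> m"
  then have gt: "u (F (l, g l)) > m" by (simp add: F_def)
  \<comment> \<open>A third of the gap, because passing to the smoothed function costs
    \<open>e\<close> on the boundary and \<open>e\<close> again at \<open>l\<close>.\<close>
  define e where "e = (u (F (l, g l)) - m) / 3"
  have e: "e > 0" using gt by (simp add: e_def)
  have gc: "continuous_on S g" for S
    using g holomorphic_on_imp_continuous_on continuous_on_subset by blast
  have FM: "F x \<in> M" for x
    using M by (auto simp: F_def case_prod_beta intro!: ell2.subspace_add ell2.subspace_scale)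
  have Fc: "continuous_on S F" for S
    unfolding F_def case_prod_beta by (intro continuous_intros scaleC.continuous_on)
  have Fadd: "F (s, t + \<tau>) = F (s, t) + \<tau> *\<^sub>C c" for s t \<tau>
    by (simp add: F_def scaleC.add_left add_ac)
  have "compact (F ` (\<lambda>l. (l, g l)) ` cball 0 1)"
    by (intro compact_continuous_image Fc continuous_intros gc) auto
  moreover have "F ` (\<lambda>l. (l, g l)) ` cball 0 1 \<subseteq> V"
    using inV by (auto simp: F_def)
  ultimately obtain \<delta> where \<delta>: "\<delta> > 0" "(\<Union>x\<in>F ` (\<lambda>l. (l, g l)) ` cball 0 1. ball x \<delta>) \<subseteq> V"
    using compact_subset_open_imp_ball_epsilon_subset[OF _ V] by blast
  \<comment> \<open>Moving \<open>t\<close> by at most \<open>R\<close> moves the point by at most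
    \<open>\<delta> / 2\<close>; the summand 1 covers \<open>c = 0\<close>.\<close>
  define R where "R = \<delta> / (2 * (norm c + 1))"
  have R: "R > 0" using \<delta> by (simp add: R_def add_nonneg_pos)
  have FV: "F (s, t) \<in> V" if "cmod s \<le> 1" "cmod (t - g s) \<le> R" for s t
  proof -
    have "dist (F (s, g s)) (F (s, t)) = cmod (t - g s) * norm c"
      using Fadd[of s "g s" "t - g s"] by (simp add: dist_norm norm_scaleC)
    also have "\<dots> \<le> R * norm c" using that by (intro mult_right_mono) auto
    also have "\<dots> < \<delta>"
    proof -
      have "R * norm c \<le> R * (norm c + 1)" using R by simp
      also have "\<dots> = \<delta> / 2" proof -
        have "norm c + 1 \<noteq> 0" using norm_ge_zero[of c] by linarith
        then show ?thesis unfolding R_def by (simp add: divide_simps)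
      qed
      finally show ?thesis using \<delta> by simp
    qed
    finally have "F (s, t) \<in> ball (F (s, g s)) \<delta>" by simp
    then show ?thesis
      by (intro subsetD[OF \<delta>(2)] UN_I[of "F (s, g s)"]) (use that(1) in auto)
  qed
  \<comment> \<open>A closed tube about the graph of \<open>g\<close>. Tietze's theorem extends u o
    F beyond it so that averages are defined everywhere; the sub-mean inequality is applied inside
    the tube only, where the extension is the original function.\<close>
  define S where "S = {x. cmod (fst x) \<le> 1 \<and> cmod (snd x - g (fst x)) \<le> R}"
  have "closed S"
    unfolding S_def by (intro closed_Collect_conj closed_Collect_le continuous_intros
        continuous_on_compose2[OF gc[of UNIV]]) auto
  then have "closedin (top_of_set UNIV) S" by simp
  moreover have "continuous_on S (\<lambda>x. u (F x))"
  proof (rule continuous_on_compose2[OF _ Fc])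
    show "continuous_on (V \<inter> M) u" using psh by (simp add: plurisubharmonic_on_def)
    show "F ` S \<subseteq> V \<inter> M"
    proof
      fix y assume "y \<in> F ` S"
      then obtain s t where "y = F (s, t)" "(s, t) \<in> S" by auto
      then show "y \<in> V \<inter> M" using FV[of s t] FM by (simp add: S_def)
    qed
  qed
  ultimately obtain U where U: "continuous_on UNIV U" "\<And>x. x \<in> S \<Longrightarrow> U x = u (F x)"
    using Tietze_unbounded[of S "\<lambda>x. u (F x)" UNIV] by auto
  have "uniformly_continuous_on (cball 0 1 \<times> cball 0 1) (\<lambda>x. U (fst x, g (fst x) + snd x))"
    by (intro compact_uniformly_continuous continuous_on_compose2[OF U(1)] continuous_intros
        continuous_on_compose2[OF gc[of UNIV]]) (auto intro: compact_Times)
  then obtain r1 where r1: "r1 > 0" "\<And>x y. x \<in> cball 0 1 \<times> cball 0 1 \<Longrightarrow> y \<in> cball 0 1 \<times> cball 0 1 \<Longrightarrow>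
      dist y x < r1 \<Longrightarrow> dist (U (fst y, g (fst y) + snd y)) (U (fst x, g (fst x) + snd x)) < e"
    using e unfolding uniformly_continuous_on_def by metis
  \<comment> \<open>A complex shift with both parts at most \<open>\<rho>\<close> has modulus at
    most \<open>2 * \<rho>\<close>. This stays below \<open>r1\<close> for the error
    \<open>e\<close>, and within \<open>R / 2\<close>, leaving half of the tube for the curvature of
    \<open>g\<close>.\<close>
  define \<rho> where "\<rho> = Min {r1 / 4, 1 / 2, R / 4}"
  have \<rho>: "\<rho> > 0" "2 * \<rho> < r1" "2 * \<rho> \<le> 1" "2 * \<rho> \<le> R / 2"
    using r1 R by (auto simp: \<rho>_def min_def)
  have Uclose: "\<bar>U (s, g s + \<tau>) - U (s, g s)\<bar> \<le> e" if "cmod s \<le> 1" "cmod \<tau> \<le> 2 * \<rho>" for s \<tau>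
    using r1(2)[of "(s, 0)" "(s, \<tau>)"] that \<rho> by (simp add: dist_Pair_Pair dist_real_def)
  obtain k where k: "mollifier \<rho> k" using mollifier_exists \<rho> by blast
  note kD = mollifierD[OF k]
  obtain k' where k': "smooth_kernel \<rho> k'" "\<And>s. (k has_real_derivative k' s) (at s)"
    using smooth_kernel_deriv[OF kD(1)] by blast
  have k'c: "continuous_on UNIV (\<lambda>s. - k' s)"
    using smooth_kernel_continuous[OF k'(1)] by (intro continuous_intros)
  define d :: "bool \<Rightarrow> complex \<times> complex" where "d i = (0, if i then \<i> else 1)" for i
  define v0 where "v0 = avg \<rho> k (d True) U"
  define v where "v = avg \<rho> k (d False) v0"
  define P where "P i = (if i then avg \<rho> k (d False) (avg \<rho> (\<lambda>s. - k' s) (d True) U)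
      else avg \<rho> (\<lambda>s. - k' s) (d False) v0)" for i
  have v0c: "continuous_on UNIV v0" unfolding v0_def by (rule avg_continuous[OF U(1) kD(2)])
  have vc: "continuous_on UNIV v" unfolding v_def by (rule avg_continuous[OF v0c kD(2)])
  have w0c: "continuous_on UNIV (avg \<rho> (\<lambda>s. - k' s) (d True) U)"
    by (rule avg_continuous[OF U(1) k'c])
  have Pc: "continuous_on UNIV (P i)" for i
    unfolding P_def by (auto intro!: avg_continuous[OF w0c kD(2)] avg_continuous[OF v0c k'c])
  have vP: "dir_deriv (d i) v (P i)" for i
  proof (cases i)
    case True
    have "dir_deriv (d True) v0 (avg \<rho> (\<lambda>s. - k' s) (d True) U)"
      unfolding v0_def by (rule dir_deriv_avg_kernel[OF U(1) kD(1) k'])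
    then show ?thesis
      unfolding v_def P_def using True dir_deriv_avg[OF v0c w0c kD(2)] by simp
  next
    case False
    then show ?thesis
      unfolding v_def P_def using dir_deriv_avg_kernel[OF v0c kD(1) k'] by simp
  qed
  have shift: "(s, t) + x *\<^sub>R d False + y *\<^sub>R d True = (s, t + Complex x y)" for s t x y
    by (simp add: d_def complex_eq_iff)
  have cplx: "cmod (Complex x y) \<le> 2 * \<rho>" if "\<bar>x\<bar> \<le> \<rho>" "\<bar>y\<bar> \<le> \<rho>" for x y
    using cmod_le[of "Complex x y"] that by simp
  have vclose: "\<bar>v (s, g s) - u (F (s, g s))\<bar> \<le> e" if "cmod s \<le> 1" for s
  proof -
    have "\<bar>v (s, g s) - U (s, g s)\<bar> \<le> e"
      unfolding v_def
    proof (rule avg_mollifier_close[OF v0c k])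
      fix x assume x: "\<bar>x\<bar> \<le> \<rho>"
      show "\<bar>v0 ((s, g s) + x *\<^sub>R d False) - U (s, g s)\<bar> \<le> e"
        unfolding v0_def
      proof (rule avg_mollifier_close[OF U(1) k])
        fix y assume "\<bar>y\<bar> \<le> \<rho>"
        then show "\<bar>U ((s, g s) + x *\<^sub>R d False + y *\<^sub>R d True) - U (s, g s)\<bar> \<le> e"
          unfolding shift using x that by (intro Uclose cplx)
      qed
    qed
    moreover have "(s, g s) \<in> S" using that R by (simp add: S_def)
    ultimately show ?thesis using U(2) by simp
  qed
  have "v (l, g l) \<le> m + e"
  proof (rule disc_max_principle[of "\<lambda>s. v (s, g s)"])
    show "continuous_on (cball 0 1) (\<lambda>s. v (s, g s))"
      by (intro continuous_on_compose2[OF vc] continuous_intros gc) auto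
    show "v (s, g s) \<le> m + e" if "cmod s = 1" for s
      using vclose[of s] bd[OF that] that by (simp add: F_def)
  next
    fix z :: complex and \<epsilon> :: real
    assume z: "cmod z < 1" and \<epsilon>: "\<epsilon> > 0"
    obtain C where C: "C \<ge> 0" "\<And>h. cmod h \<le> 1 \<Longrightarrow> cmod (g (z + h) - g z - h * deriv g z) \<le> C * (cmod h)\<^sup>2"
      using holomorphic_quadratic_remainder[OF g] by blast
    \<comment> \<open>The real and imaginary parts of the quadratic remainder add up to at most 2 C
      r^2 in absolute value.\<close>
    define \<epsilon>' where "\<epsilon>' = \<epsilon> / (2 * C + 1)"
    have \<epsilon>': "\<epsilon>' > 0" "\<epsilon>' * (2 * C) \<le> \<epsilon>" using \<epsilon> C by (auto simp: \<epsilon>'_def field_simps)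
    obtain r2 where r2: "r2 > 0" "\<And>x e. dist (z, g z) x < r2 \<Longrightarrow> (\<forall>i\<in>UNIV. \<bar>e i\<bar> < r2) \<Longrightarrow>
        \<bar>v (x + (\<Sum>i\<in>UNIV. e i *\<^sub>R d i)) - v x - (\<Sum>i\<in>UNIV. e i * P i (z, g z))\<bar> \<le> \<epsilon>' * (\<Sum>i\<in>UNIV. \<bar>e i\<bar>)"
      using C1_expansion[of "UNIV::bool set" UNIV "(z, g z)" \<epsilon>' v d P] \<epsilon>' vP Pc
      unfolding dir_deriv_def by auto
    \<comment> \<open>In order: the remainder estimate applies, the circle stays in the unit disc,
      the shifted tangent disc stays in the tube, and the base point and the increment are small
      enough for the first-order expansion.\<close>
    define r0 where "r0 = Min {1, 1 - cmod z, R / (2 * (C + 1)), r2 / (1 + cmod (deriv g z)), r2 / (C + 1)}"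
    have pos: "1 + cmod (deriv g z) > 0" by (simp add: add_pos_nonneg)
    have r0: "r0 > 0" "r0 \<le> 1" "r0 \<le> 1 - cmod z" "r0 * (2 * (C + 1)) \<le> R"
      "r0 * (1 + cmod (deriv g z)) \<le> r2" "r0 * (C + 1) \<le> r2"
    proof -
      show "r0 > 0" using z R r2 C pos by (auto simp: r0_def)
      have "r0 \<le> R / (2 * (C + 1))" "r0 \<le> r2 / (1 + cmod (deriv g z))" "r0 \<le> r2 / (C + 1)"
        unfolding r0_def by (rule Min_le; simp)+
      then show "r0 * (2 * (C + 1)) \<le> R" "r0 * (1 + cmod (deriv g z)) \<le> r2" "r0 * (C + 1) \<le> r2"
        using C pos by (simp_all add: pos_le_divide_eq)
    qed (auto simp: r0_def)
    show "\<exists>r0>0. \<forall>r. 0 < r \<and> r < r0 \<longrightarrow> v (z, g z) - \<epsilon> * r\<^sup>2 \<le>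
        circle_mean (\<lambda>\<theta>. v (z + of_real r * ecis \<theta>, g (z + of_real r * ecis \<theta>)))"
    proof (intro exI[of _ r0] conjI allI impI r0(1))
      fix r assume r: "0 < r \<and> r < r0"
      \<comment> \<open>Difference between the graph and its tangent at \<open>z\<close>. It is
        holomorphic and vanishes at \<open>z\<close>, so every real-linear function of it has circle
        mean 0.\<close>
      define E where "E w = g w - g z - (w - z) * deriv g z" for w
      have Ebd: "cmod (E (z + h)) \<le> C * (cmod h)\<^sup>2" if "cmod h \<le> r" for h
        using C(2)[of h] that r r0 by (simp add: E_def)
      have rr: "C * (cmod h)\<^sup>2 \<le> C * r" if "cmod h \<le> r" for h
      proof -
        have "(cmod h)\<^sup>2 \<le> r * 1" unfolding power2_eq_square
          using that r r0 by (intro mult_mono) auto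
        then show ?thesis using C by (intro mult_left_mono) auto
      qed
      define c' where "c' \<theta> = (z + of_real r * ecis \<theta>, g z + of_real r * ecis \<theta> * deriv g z)" for \<theta>
      have c'c: "continuous_on A c'" for A
        unfolding c'_def by (intro continuous_intros)
      \<comment> \<open>The averages only translate the tangent disc in the \<open>t\<close>
        direction; each translate is affine and inside the tube, where \<open>u\<close> has the
        sub-mean inequality.\<close>
      have tangent: "v (z, g z) \<le> circle_mean (\<lambda>\<theta>. v (c' \<theta>))"
        unfolding v_def
      proof (rule avg_submean[OF v0c kD(2,3) c'c])
        fix x assume x: "\<bar>x\<bar> \<le> \<rho>"
        have cc: "continuous_on {0..2 * pi} (\<lambda>\<theta>. c' \<theta> + x *\<^sub>R d False)"
          by (intro continuous_intros c'c)
        show "v0 ((z, g z) + x *\<^sub>R d False) \<le> circle_mean (\<lambda>\<theta>. v0 (c' \<theta> + x *\<^sub>R d False))"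
          unfolding v0_def
        proof (rule avg_submean[OF U(1) kD(2,3) cc])
          fix y assume y: "\<bar>y\<bar> \<le> \<rho>"
          define \<tau> where "\<tau> = Complex x y"
          have \<tau>: "cmod \<tau> \<le> R / 2" using cplx[OF x y] \<rho> by (simp add: \<tau>_def)
          have inS: "(z + of_real r * \<mu>, g z + of_real r * \<mu> * deriv g z + \<tau>) \<in> S" if "cmod \<mu> \<le> 1" for \<mu>
          proof -
            let ?h = "of_real r * \<mu>"
            have h: "cmod ?h \<le> r" using that r by (simp add: norm_mult)
            have "g z + ?h * deriv g z + \<tau> - g (z + ?h) = \<tau> - E (z + ?h)" by (simp add: E_def)
            then have "cmod (g z + ?h * deriv g z + \<tau> - g (z + ?h)) \<le> cmod \<tau> + cmod (E (z + ?h))"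
              using norm_triangle_ineq4 by metis
            also have "\<dots> \<le> R / 2 + C * r" using Ebd[OF h] rr[OF h] \<tau> by linarith
            also have "C * r \<le> R / 2"
            proof -
              have "C * r \<le> (C + 1) * r0" using C r by (intro mult_mono) auto
              moreover have "2 * ((C + 1) * r0) \<le> R" using r0(4) by (simp only: mult_ac)
              ultimately show ?thesis by linarith
            qed
            finally show ?thesis
              using norm_triangle_ineq[of z ?h] h r r0 by (simp add: S_def)
          qed
          have Feq: "F (z + of_real r * \<mu>, g z + of_real r * \<mu> * deriv g z + \<tau>)
              = F (z, g z + \<tau>) + \<mu> *\<^sub>C (of_real r *\<^sub>C (b + deriv g z *\<^sub>C c))" for \<mu>
            unfolding F_def by (rule ell2_eqI) (simp add: algebra_simps)
          have "u (F (z, g z + \<tau>)) \<le> circle_mean (\<lambda>\<theta>. u (F (z, g z + \<tau>) + ecis \<theta> *\<^sub>C (of_real r *\<^sub>C (b + deriv g z *\<^sub>C c))))"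
          proof (rule plurisubharmonic_onD[OF psh])
            show "of_real r *\<^sub>C (b + deriv g z *\<^sub>C c) \<in> M"
              using M by (auto intro!: ell2.subspace_add ell2.subspace_scale)
            have "F (z + of_real r * \<mu>, g z + of_real r * \<mu> * deriv g z + \<tau>) \<in> V \<inter> M" if "cmod \<mu> \<le> 1" for \<mu>
              using FV inS[OF that] FM by (auto simp: S_def)
            then show 1: "F (z, g z + \<tau>) + \<mu> *\<^sub>C (of_real r *\<^sub>C (b + deriv g z *\<^sub>C c)) \<in> V \<inter> M" if "cmod \<mu> \<le> 1" for \<mu>
              using that by (simp only: Feq)
            show "F (z, g z + \<tau>) \<in> V \<inter> M" using 1[of 0] by simp
          qed
          also have "\<dots> = circle_mean (\<lambda>\<theta>. U (c' \<theta> + x *\<^sub>R d False + y *\<^sub>R d True))"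
            unfolding c'_def shift \<tau>_def[symmetric] Feq[symmetric]
            by (intro circle_mean_cong) (use inS U(2) in auto)
          also have "u (F (z, g z + \<tau>)) = U ((z, g z) + x *\<^sub>R d False + y *\<^sub>R d True)"
            unfolding shift \<tau>_def[symmetric] using U(2) inS[of 0] by simp
          finally show "U ((z, g z) + x *\<^sub>R d False + y *\<^sub>R d True)
              \<le> circle_mean (\<lambda>\<theta>. U (c' \<theta> + x *\<^sub>R d False + y *\<^sub>R d True))" .
        qed
      qed
      let ?p = "(z, g z)"
      have Ehol: "E holomorphic_on A" for A
        unfolding E_def by (intro holomorphic_intros holomorphic_on_subset[OF g]) auto
      \<comment> \<open>With A and B the derivatives in the real and imaginary \<open>t\<close>
        directions, Re ((A - i B) E) = A Re E + B Im E: the first-order term is the real part of a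
        holomorphic function.\<close>
      have lower: "v (c' \<theta>) + Re (Complex (P False ?p) (- P True ?p) * E (z + of_real r * ecis \<theta>)) - \<epsilon> * r\<^sup>2
          \<le> v (z + of_real r * ecis \<theta>, g (z + of_real r * ecis \<theta>))" for \<theta>
      proof -
        let ?h = "of_real r * ecis \<theta>"
        let ?E = "E (z + ?h)"
        have h: "cmod ?h = r" using r by (simp add: norm_mult)
        define ee where "ee i = (if i then Im ?E else Re ?E)" for i
        have Er: "cmod ?E \<le> C * r" "cmod ?E \<le> C * r\<^sup>2"
          using Ebd[of ?h] rr[of ?h] h by auto
        have "C * r < r2"
        proof -
          have "C * r \<le> C * r0" using C r by (intro mult_left_mono) auto
          also have "\<dots> < r0 * (C + 1)" using r0(1) by (simp add: algebra_simps)
          finally show ?thesis using r0 by simp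
        qed
        then have ee: "\<forall>i\<in>UNIV. \<bar>ee i\<bar> < r2"
          using abs_Re_le_cmod[of ?E] abs_Im_le_cmod[of ?E] Er by (auto simp: ee_def)
        have "dist ?p (c' \<theta>) \<le> cmod ?h + cmod (?h * deriv g z)"
          unfolding c'_def dist_norm diff_Pair
          by (rule order_trans[OF norm_Pair_le]) (simp add: norm_mult)
        also have "\<dots> = r * (1 + cmod (deriv g z))" using h by (simp add: norm_mult algebra_simps)
        also have "\<dots> < r0 * (1 + cmod (deriv g z))" using r pos by (intro mult_strict_right_mono) auto
        finally have "dist ?p (c' \<theta>) < r2" using r0 by simp
        from r2(2)[OF this ee]
        have "\<bar>v (c' \<theta> + (\<Sum>i\<in>UNIV. ee i *\<^sub>R d i)) - v (c' \<theta>) - (\<Sum>i\<in>UNIV. ee i * P i ?p)\<bar> \<le> \<epsilon>' * (\<Sum>i\<in>UNIV. \<bar>ee i\<bar>)" .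
        moreover have "c' \<theta> + (\<Sum>i\<in>UNIV. ee i *\<^sub>R d i) = (z + ?h, g (z + ?h))"
        proof -
          have "(\<Sum>i\<in>UNIV. ee i *\<^sub>R d i) = (0, ?E)"
            by (simp add: UNIV_bool ee_def d_def complex_eq_iff)
          then show ?thesis by (simp add: c'_def E_def)
        qed
        moreover have "(\<Sum>i\<in>UNIV. ee i * P i ?p) = Re (Complex (P False ?p) (- P True ?p) * ?E)"
          by (simp add: UNIV_bool ee_def mult.commute)
        moreover have "\<epsilon>' * (\<Sum>i\<in>UNIV. \<bar>ee i\<bar>) \<le> \<epsilon> * r\<^sup>2"
        proof -
          have "(\<Sum>i\<in>UNIV. \<bar>ee i\<bar>) \<le> 2 * C * r\<^sup>2"
            using abs_Re_le_cmod[of ?E] abs_Im_le_cmod[of ?E] Er by (simp add: UNIV_bool ee_def)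
          then have "\<epsilon>' * (\<Sum>i\<in>UNIV. \<bar>ee i\<bar>) \<le> \<epsilon>' * (2 * C * r\<^sup>2)"
            using \<epsilon>' by (intro mult_left_mono) auto
          also have "\<dots> \<le> \<epsilon> * r\<^sup>2"
            using mult_right_mono[OF \<epsilon>'(2), of "r\<^sup>2"] by (simp add: mult.assoc)
          finally show ?thesis .
        qed
        ultimately show ?thesis by auto
      qed
      have pc: "continuous_on A (\<lambda>\<theta>. z + of_real r * ecis \<theta>)" for A
        by (intro continuous_intros)
      have c1: "continuous_on A (\<lambda>\<theta>. v (c' \<theta>))" for A
        by (rule continuous_on_compose2[OF vc c'c]) auto
      have c2: "continuous_on A (\<lambda>\<theta>. Re (K * E (z + of_real r * ecis \<theta>)))" for A K
        by (intro continuous_intros continuous_on_compose2[OF holomorphic_on_imp_continuous_on[OF Ehol] pc]) auto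
      have "circle_mean (\<lambda>\<theta>. v (c' \<theta>)) + 0 - \<epsilon> * r\<^sup>2
          = circle_mean (\<lambda>\<theta>. v (c' \<theta>) + Re (Complex (P False ?p) (- P True ?p) * E (z + of_real r * ecis \<theta>)) - \<epsilon> * r\<^sup>2)"
      proof -
        have "circle_mean (\<lambda>\<theta>. Re (Complex (P False ?p) (- P True ?p) * E (z + of_real r * ecis \<theta>))) = 0"
          by (subst circle_mean_holomorphic[OF Ehol]) (use r in \<open>auto simp: E_def\<close>)
        then show ?thesis
          by (subst circle_mean_diff, (intro continuous_intros c1 c2)+, subst circle_mean_add,
            (intro c1 c2)+) (simp only: circle_mean_const)
      qed
      also have "\<dots> \<le> circle_mean (\<lambda>\<theta>. v (z + of_real r * ecis \<theta>, g (z + of_real r * ecis \<theta>)))"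
      proof (rule circle_mean_mono)
        show "continuous_on {0..2 * pi} (\<lambda>\<theta>. v (z + of_real r * ecis \<theta>, g (z + of_real r * ecis \<theta>)))"
          by (intro continuous_on_compose2[OF vc] continuous_on_compose2[OF gc[of UNIV]] continuous_intros) auto
        show "continuous_on {0..2 * pi} (\<lambda>\<theta>. v (c' \<theta>) +
            Re (Complex (P False ?p) (- P True ?p) * E (z + of_real r * ecis \<theta>)) - \<epsilon> * r\<^sup>2)"
          by (intro continuous_on_diff continuous_on_add c1 c2 continuous_on_const)
      qed (rule lower)
      finally show "v (z, g z) - \<epsilon> * r\<^sup>2 \<le>
        circle_mean (\<lambda>\<theta>. v (z + of_real r * ecis \<theta>, g (z + of_real r * ecis \<theta>)))"
        using tangent by linarith
    qed
  qed (use l in auto)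
  then have "v (l, g l) \<le> m + e" .
  with vclose[OF l] have "u (F (l, g l)) \<le> m + 2 * e" by linarith
  with gt show False by (simp add: e_def field_simps)
qed

section \<open>Plurisubharmonicity of the boundary distance\<close>

text \<open>Kontinuitaetssatz: let the disc grow with \<open>t\<close> from 0 to 1. All its
  boundaries lie in one compact set, so by the maximum principle every disc already inside
  \<open>V\<close> lies in one fixed compact part of \<open>V\<close>, at a uniform distance from
  the complement; finitely many equal steps therefore never leave \<open>V\<close>.\<close>

lemma pseudoconvex_continuity_principle:
  assumes V: "pseudoconvex_domain V"
    and h: "h holomorphic_on UNIV"
    and axis: "\<And>l. cmod l \<le> 1 \<Longrightarrow> a + l *\<^sub>C b \<in> V"
    and bdry: "\<And>l t. cmod l = 1 \<Longrightarrow> 0 \<le> t \<Longrightarrow> t \<le> 1 \<Longrightarrow> a + l *\<^sub>C b + (of_real t * h l) *\<^sub>C c \<in> V"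
    and l: "cmod l \<le> 1"
  shows "a + l *\<^sub>C b + h l *\<^sub>C c \<in> V"
proof -
  have oV: "open V" using V by (simp add: pseudoconvex_domain_def)
  define M where "M = ell2.span {a, b, c}"
  have M: "ell2.subspace M" "a \<in> M" "b \<in> M" "c \<in> M"
    by (auto simp: M_def ell2.subspace_span intro: ell2.span_base)
  have "finite_dim_csubspace M"
    unfolding finite_dim_csubspace_def using M(1) by (auto simp: M_def intro!: exI[of _ "{a, b, c}"])
  then have "pseudoconvex_in M (V \<inter> M)" using V by (simp add: pseudoconvex_domain_def)
  moreover have "a \<in> V \<inter> M" using axis[of 0] M by simp
  ultimately obtain u where psh: "plurisubharmonic_on M (V \<inter> M) u"
    and rc: "\<And>t. relatively_compact_in (V \<inter> M) {z \<in> V \<inter> M. u z < t}"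
    by (auto simp: pseudoconvex_in_def)
  have uc: "continuous_on (V \<inter> M) u" using psh by (simp add: plurisubharmonic_on_def)
  have hc: "continuous_on A h" for A
    using h holomorphic_on_imp_continuous_on continuous_on_subset by blast
  define F where "F t l = a + l *\<^sub>C b + (of_real t * h l) *\<^sub>C c" for t :: real and l
  have FM: "F t l \<in> M" for t l
    unfolding F_def using M by (auto intro!: ell2.subspace_add ell2.subspace_scale)
  define K where "K = (\<lambda>(t, l). F t l) ` ({0..1} \<times> sphere 0 1)"
  have "compact K"
    unfolding K_def F_def case_prod_beta
    by (intro compact_continuous_image continuous_intros scaleC.continuous_on
        continuous_on_compose2[OF hc[of UNIV]] compact_Times) auto
  moreover have KV: "K \<subseteq> V \<inter> M" using bdry FM by (auto simp: K_def F_def)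
  ultimately have "compact (u ` K)"
    by (intro compact_continuous_image continuous_on_subset[OF uc]) auto
  then obtain m where m: "\<And>x. x \<in> K \<Longrightarrow> u x \<le> m"
    using compact_imp_bounded bounded_iff by (metis abs_le_D1 imageI real_norm_def)
  \<comment> \<open>The level is raised by 1 because relative compactness is available for strict
    sublevel sets, while the maximum principle gives only \<open>u \<le> m\<close>.\<close>
  define C where "C = (V \<inter> M) \<inter> closure {z \<in> V \<inter> M. u z < m + 1}"
  have "compact C" using rc by (simp add: C_def relatively_compact_in_def)
  moreover have "C \<subseteq> V" by (auto simp: C_def)
  ultimately obtain e where e: "e > 0" "(\<Union>x\<in>C. ball x e) \<subseteq> V"
    using compact_subset_open_imp_ball_epsilon_subset[OF _ oV] by blast
  have "compact (h ` cball 0 1)" by (intro compact_continuous_image hc) auto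
  then obtain B where B: "\<And>l. cmod l \<le> 1 \<Longrightarrow> cmod (h l) \<le> B"
    using compact_imp_bounded bounded_iff by (metis imageI mem_cball_0)
  \<comment> \<open>A step 1/N in \<open>t\<close> moves a point by at most B * norm c / N, hence by
    less than \<open>e\<close>.\<close>
  obtain N :: nat where N: "B * norm c / e < real N" using reals_Archimedean2 by blast
  have Bc: "B * norm c \<ge> 0" using B[of 0] order_trans[OF norm_ge_zero] by (intro mult_nonneg_nonneg) auto
  then have N0: "N > 0" using N e by (cases "N = 0") (auto simp: field_simps)
  have "\<forall>l. cmod l \<le> 1 \<longrightarrow> F (real n / real N) l \<in> V" if "n \<le> N" for n
    using that
  proof (induction n)
    case 0
    then show ?case using axis by (simp add: F_def)
  next
    case (Suc n)
    let ?t = "real n / real N"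
    have t: "0 \<le> ?t" "?t \<le> 1" using Suc.prems by auto
    have IH: "F ?t l \<in> V" if "cmod l \<le> 1" for l using Suc that by auto
    have inC: "F ?t l \<in> C" if l: "cmod l \<le> 1" for l
    proof -
      have "u (a + l *\<^sub>C b + (of_real ?t * h l) *\<^sub>C c) \<le> m"
      proof (rule plurisubharmonic_disc_maximum[OF oV M psh _ _ _ l, of "\<lambda>l. of_real ?t * h l"])
        show "(\<lambda>l. of_real ?t * h l) holomorphic_on UNIV" by (intro holomorphic_intros h)
        show "a + l *\<^sub>C b + (of_real ?t * h l) *\<^sub>C c \<in> V" if "cmod l \<le> 1" for l
          using IH[OF that] by (simp add: F_def)
        show "u (a + l *\<^sub>C b + (of_real ?t * h l) *\<^sub>C c) \<le> m" if "cmod l = 1" for l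
        proof -
          have "F ?t l \<in> K"
            unfolding K_def by (rule image_eqI[of _ _ "(?t, l)"]) (use that t in auto)
          then show ?thesis using m by (simp add: F_def)
        qed
      qed
      then have "u (F ?t l) \<le> m" by (simp only: F_def)
      then have "F ?t l \<in> {z \<in> V \<inter> M. u z < m + 1}" using IH[OF l] FM[of ?t l] by simp
      then show ?thesis
        unfolding C_def by (intro IntI subsetD[OF closure_subset]) auto
    qed
    show ?case
    proof (intro allI impI)
      fix l assume l: "cmod l \<le> 1"
      have "F (real (Suc n) / real N) l - F ?t l = ((1 / of_nat N) * h l) *\<^sub>C c"
        unfolding F_def by (rule ell2_eqI) (simp add: algebra_simps add_divide_distrib)
      then have "dist (F ?t l) (F (real (Suc n) / real N) l) = cmod (h l) / real N * norm c"
        using dist_norm[of "F (real (Suc n) / real N) l" "F ?t l"]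
        by (subst dist_commute) (simp only: norm_scaleC norm_mult norm_divide norm_one norm_of_nat, simp)
      also have "\<dots> \<le> B / real N * norm c"
        using B[OF l] by (intro mult_right_mono divide_right_mono) auto
      also have "\<dots> < e" using N N0 e by (simp add: field_simps)
      finally have "F (real (Suc n) / real N) l \<in> ball (F ?t l) e" by simp
      then show "F (real (Suc n) / real N) l \<in> V" using e(2) inC[OF l] by blast
    qed
  qed
  from this[of N] show ?thesis using l N0 by (simp add: F_def)
qed

lemma infdist_compl_gt_imp_mem: "dist x y < infdist x (- V) \<Longrightarrow> y \<in> V"
  using infdist_le[of y "- V" x] by force

text \<open>Choose a polynomial q with w < Re q < w + e on the circle and put h = exp (- q), so that
  |h| is below the boundary distance there. For every c with norm below 1 the continuity principle
  puts \<open>a + h 0 *\<^sub>C c\<close> in \<open>V\<close>. Thus the distance at \<open>a\<close>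
  is at least |h 0| = exp (- Re q(0)), and Re q(0) is the circle mean of Re q.\<close>

lemma neg_ln_boundary_distance_submean:
  assumes V: "pseudoconvex_domain V" and ne: "V \<noteq> UNIV"
    and disc: "\<And>l. cmod l \<le> 1 \<Longrightarrow> a + l *\<^sub>C b \<in> V"
  shows "- ln (infdist a (- V)) \<le> circle_mean (\<lambda>\<theta>. - ln (infdist (a + ecis \<theta> *\<^sub>C b) (- V)))"
proof (rule field_le_epsilon)
  define w where "w l = - ln (infdist (a + l *\<^sub>C b) (- V))" for l
  have cl: "closed (- V)" "- V \<noteq> {}"
    using V ne by (auto simp: pseudoconvex_domain_def)
  have pos: "infdist x (- V) > 0" if "x \<in> V" for x
    using in_closed_iff_infdist_zero[OF cl, of x] infdist_nonneg[of x "- V"] that by auto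
  have wc: "continuous_on (cball 0 1) w"
    unfolding w_def using pos disc
    by (intro continuous_intros scaleC.continuous_on) (auto simp: less_imp_neq[symmetric] dest!: pos disc)
  fix e :: real assume "e > 0"
  \<comment> \<open>Approximating the raised function \<open>w + e / 2\<close> within
    \<open>e / 2\<close> yields the strict one-sided bounds w < Re q < w + e.\<close>
  have "continuous_on (sphere 0 1) (\<lambda>l. w l + e / 2)"
    by (intro continuous_intros continuous_on_subset[OF wc]) auto
  then obtain q where q: "\<And>l. cmod l = 1 \<Longrightarrow> \<bar>w l + e / 2 - Re (poly q l)\<bar> < e / 2"
    using Re_poly_dense[of "\<lambda>l. w l + e / 2" "e / 2"] \<open>e > 0\<close> by auto
  define h where "h l = exp (- poly q l)" for l
  have inV: "a + h 0 *\<^sub>C c \<in> V" if c: "norm c < 1" for c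
  proof -
    have "a + 0 *\<^sub>C b + h 0 *\<^sub>C c \<in> V"
    proof (rule pseudoconvex_continuity_principle[OF V])
      show "h holomorphic_on UNIV" unfolding h_def by (intro holomorphic_intros poly_holomorphic_on)
      show "a + l *\<^sub>C b + (of_real t * h l) *\<^sub>C c \<in> V" if l: "cmod l = 1" and t: "0 \<le> t" "t \<le> 1" for l t
      proof (rule infdist_compl_gt_imp_mem)
        have "a + l *\<^sub>C b \<in> V" using disc l by simp
        then have p: "infdist (a + l *\<^sub>C b) (- V) > 0" by (rule pos)
        have "w l < Re (poly q l)" using q[OF l] by linarith
        then have "exp (- Re (poly q l)) < exp (- w l)" by simp
        also have "\<dots> = infdist (a + l *\<^sub>C b) (- V)" using p by (simp add: w_def)
        finally have "cmod (h l) < infdist (a + l *\<^sub>C b) (- V)" by (simp add: h_def)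
        moreover have "t * cmod (h l) * norm c \<le> 1 * cmod (h l) * 1"
          using t c by (intro mult_mono) auto
        ultimately show "dist (a + l *\<^sub>C b) (a + l *\<^sub>C b + (of_real t * h l) *\<^sub>C c) < infdist (a + l *\<^sub>C b) (- V)"
          using t by (simp add: dist_norm norm_scaleC norm_mult)
      qed
    qed (use disc in auto)
    then show ?thesis by simp
  qed
  have "exp (- Re (poly q 0)) \<le> infdist a (- V)"
    unfolding infdist_notempty[OF cl(2)]
  proof (rule cINF_greatest[OF cl(2)])
    fix y assume y: "y \<in> - V"
    show "exp (- Re (poly q 0)) \<le> dist a y"
    proof (rule ccontr)
      assume "\<not> ?thesis"
      \<comment> \<open>A point off \<open>V\<close> nearer than |h 0| would be of the form
        \<open>a + h 0 *\<^sub>C c\<close> with c of norm below 1.\<close>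
      then have "norm (y - a) < cmod (h 0)" by (simp add: h_def dist_norm norm_minus_commute)
      moreover have h0: "h 0 \<noteq> 0" by (simp add: h_def)
      moreover have "norm (inverse (h 0) *\<^sub>C (y - a)) = norm (y - a) / cmod (h 0)"
        by (simp only: norm_scaleC norm_inverse divide_inverse mult.commute)
      ultimately have "norm (inverse (h 0) *\<^sub>C (y - a)) < 1"
        by (simp only:) (simp add: divide_less_eq)
      from inV[OF this] have "a + h 0 *\<^sub>C inverse (h 0) *\<^sub>C (y - a) \<in> V" .
      moreover have "a + h 0 *\<^sub>C inverse (h 0) *\<^sub>C (y - a) = y"
        unfolding ell2.scale_scale using h0 by simp
      ultimately have "y \<in> V" by simp
      then show False using y by simp
    qed
  qed
  then have "ln (exp (- Re (poly q 0))) \<le> ln (infdist a (- V))"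
    using pos[of a] disc[of 0] by (subst ln_le_cancel_iff) auto
  then have "- ln (infdist a (- V)) \<le> Re (poly q 0)" by simp
  also have "\<dots> = circle_mean (\<lambda>\<theta>. Re (poly q (ecis \<theta>)))"
    using circle_mean_holomorphic[of "poly q" 0 1 1] by (simp add: poly_holomorphic_on)
  also have "\<dots> \<le> circle_mean (\<lambda>\<theta>. w (ecis \<theta>) + e)"
  proof (rule circle_mean_mono)
    show "Re (poly q (ecis \<theta>)) \<le> w (ecis \<theta>) + e" for \<theta>
      using q[OF norm_exp_i_times[of \<theta>]] by linarith
  qed (auto intro!: continuous_intros continuous_on_compose2[OF wc])
  also have "\<dots> = circle_mean (\<lambda>\<theta>. w (ecis \<theta>)) + e"
    by (subst circle_mean_add) (auto intro!: continuous_intros continuous_on_compose2[OF wc])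
  finally show "- ln (infdist a (- V)) \<le> circle_mean (\<lambda>\<theta>. - ln (infdist (a + ecis \<theta> *\<^sub>C b) (- V))) + e"
    by (simp add: w_def)
qed

section \<open>Averaging in infinitely many directions\<close>

text \<open>The tail \<open>tail_avg m\<close> is \<open>A\<^sub>m A\<^sub>m\<^sub>+\<^sub>1 \<cdots> F\<close>; it is only
  Lipschitz in the directions \<open>d m, d (m + 1), \<dots>\<close>, but \<open>tail_avg m = A\<^sub>m (tail_avg (m + 1))\<close>, so that
  finitely many averages can be split off and differentiated.\<close>

locale coordinate_averaging =
  fixes d :: "nat \<Rightarrow> 'a::real_normed_vector" and a :: "nat \<Rightarrow> real" and k :: "nat \<Rightarrow> real \<Rightarrow> real"
    and F :: "'a \<Rightarrow> real" and L :: real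
  assumes d: "\<And>m. norm (d m) \<le> 1" and a: "summable a" "\<And>m. a m > 0"
    and k: "\<And>m. mollifier (a m) (k m)" and F: "L-lipschitz_on UNIV F"
begin

text \<open>The kernels \<open>\<kappa>\<close> are separate from the mollifiers \<open>k\<close> of
  the locale, since differentiation replaces some of them by derivatives. The start index
  \<open>m\<close> is the outermost average.\<close>

primrec chain :: "(nat \<Rightarrow> real \<Rightarrow> real) \<Rightarrow> nat \<Rightarrow> nat \<Rightarrow> ('a \<Rightarrow> real) \<Rightarrow> 'a \<Rightarrow> real" where
  "chain \<kappa> m 0 f = f"
| "chain \<kappa> m (Suc n) f = avg (a m) (\<kappa> m) (d m) (chain \<kappa> (Suc m) n f)"

definition tail_avg :: "nat \<Rightarrow> 'a \<Rightarrow> real" where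
  "tail_avg m x = lim (\<lambda>n. chain k m n F x)"

lemma F_continuous: "continuous_on A F"
  using lipschitz_on_continuous_on[OF F] continuous_on_subset by blast

lemma L_nonneg: "L \<ge> 0"
  using F by (rule lipschitz_on_nonneg)

text \<open>The recursion peels off the outermost average, whereas convergence compares chains that
  differ by the innermost one.\<close>

lemma chain_snoc: "chain \<kappa> m (Suc n) f = chain \<kappa> m n (avg (a (m + n)) (\<kappa> (m + n)) (d (m + n)) f)"
  by (induction n arbitrary: m) simp_all

lemma chain_cong: "(\<And>i. m \<le> i \<Longrightarrow> i < m + n \<Longrightarrow> \<kappa> i = \<kappa>' i) \<Longrightarrow> chain \<kappa> m n f = chain \<kappa>' m n f"
  by (induction n arbitrary: m) simp_all

lemma chain_continuous:
  assumes "continuous_on UNIV f" "\<And>m. continuous_on UNIV (\<kappa> m)"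
  shows "continuous_on A (chain \<kappa> m n f)"
proof -
  have "continuous_on UNIV (chain \<kappa> m n f)"
    by (induction n arbitrary: m) (auto intro: avg_continuous assms)
  then show ?thesis using continuous_on_subset by blast
qed

lemma chain_lipschitz:
  assumes "\<And>m. continuous_on UNIV (\<kappa> m)" "C-lipschitz_on UNIV f"
  shows "\<exists>C'. C'-lipschitz_on UNIV (chain \<kappa> m n f)"
proof (induction n arbitrary: m)
  case (Suc n)
  then show ?case using avg_lipschitz[OF _ assms(1)] by (metis chain.simps(2))
qed (use assms in auto)

lemma chain_mollifier_lipschitz:
  assumes "C-lipschitz_on UNIV f"
  shows "C-lipschitz_on UNIV (chain k m n f)"
proof (induction n arbitrary: m)
  case (Suc n)
  then show ?case
    using avg_lipschitz[of C "chain k (Suc m) n f" "k m" "a m" "d m"] mollifierD[OF k[of m]] by simp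
qed (use assms in simp)

lemma chain_mollifier_contraction:
  assumes "continuous_on UNIV f" "continuous_on UNIV g" "\<And>x. \<bar>f x - g x\<bar> \<le> B"
  shows "\<bar>chain k m n f x - chain k m n g x\<bar> \<le> B"
proof (induction n arbitrary: m x)
  case (Suc n)
  have "\<bar>chain k m (Suc n) f x - chain k m (Suc n) g x\<bar> \<le> integral {-a m..a m} (\<lambda>s. \<bar>k m s\<bar>) * B"
    unfolding chain.simps
    by (intro avg_contraction chain_continuous assms(1,2) mollifierD(2)[OF k] Suc.IH)
  then show ?case using mollifierD(5)[OF k] by simp
qed (use assms in simp)

lemma avg_near:
  assumes "C-lipschitz_on UNIV f"
  shows "\<bar>avg (a m) (k m) (d m) f x - f x\<bar> \<le> C * a m"
proof (rule avg_mollifier_close[OF lipschitz_on_continuous_on[OF assms] k])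
  fix s assume s: "\<bar>s\<bar> \<le> a m"
  have "\<bar>f (x + s *\<^sub>R d m) - f x\<bar> \<le> C * norm (s *\<^sub>R d m)"
    using lipschitz_onD[OF assms, of "x + s *\<^sub>R d m" x] by (simp add: dist_norm)
  also have "\<dots> \<le> C * (a m * 1)"
    unfolding norm_scaleR using s d lipschitz_on_nonneg[OF assms]
    by (intro mult_left_mono mult_mono) auto
  finally show "\<bar>f (x + s *\<^sub>R d m) - f x\<bar> \<le> C * a m" by simp
qed

text \<open>The additional innermost average moves \<open>F\<close> by at most
  \<open>L * a (m + n)\<close>, and the outer averages are contractions in the supremum norm.
  Summability of \<open>a\<close> then gives uniform convergence.\<close>

lemma chain_Suc_near: "\<bar>chain k m (Suc n) F x - chain k m n F x\<bar> \<le> L * a (m + n)"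
  unfolding chain_snoc
  by (intro chain_mollifier_contraction avg_near F avg_continuous F_continuous mollifierD(2)[OF k])

lemma chain_Cauchy: "\<bar>chain k m (n + j) F x - chain k m n F x\<bar> \<le> L * (\<Sum>i. a (i + (m + n)))"
proof -
  have "\<bar>chain k m (n + j) F x - chain k m n F x\<bar> \<le> L * (\<Sum>i<j. a (i + (m + n)))"
  proof (induction j)
    case (Suc j)
    then show ?case
      using chain_Suc_near[of m "n + j" x] by (simp add: algebra_simps)
  qed simp
  also have "\<dots> \<le> L * (\<Sum>i. a (i + (m + n)))"
    using a by (intro mult_left_mono sum_le_suminf L_nonneg)
      (auto simp: less_imp_le summable_iff_shift)
  finally show ?thesis .
qed

lemma chain_tendsto: "(\<lambda>n. chain k m n F x) \<longlonglongrightarrow> tail_avg m x"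
proof -
  have "summable (\<lambda>n. chain k m (Suc n) F x - chain k m n F x)"
  proof (rule summable_comparison_test')
    show "summable (\<lambda>n. L * a (n + m))" using a by (intro summable_mult) (simp add: summable_iff_shift)
    show "norm (chain k m (Suc n) F x - chain k m n F x) \<le> L * a (n + m)" for n
      using chain_Suc_near[of m n x] by (simp add: add.commute)
  qed
  then have "(\<lambda>n. \<Sum>i<n. chain k m (Suc i) F x - chain k m i F x)
      \<longlonglongrightarrow> (\<Sum>n. chain k m (Suc n) F x - chain k m n F x)"
    by (rule summable_LIMSEQ)
  then have "(\<lambda>n. chain k m n F x - chain k m 0 F x) \<longlonglongrightarrow> (\<Sum>n. chain k m (Suc n) F x - chain k m n F x)"
    by (subst (asm) sum_lessThan_telescope)
  from tendsto_add[OF this tendsto_const[of "chain k m 0 F x"]] have "convergent (\<lambda>n. chain k m n F x)"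
    by (auto simp: convergent_def)
  then show ?thesis by (simp add: tail_avg_def convergent_LIMSEQ_iff)
qed

lemma tail_avg_near: "\<bar>tail_avg m x - chain k m n F x\<bar> \<le> L * (\<Sum>i. a (i + (m + n)))"
proof (rule LIMSEQ_le_const2)
  show "(\<lambda>j. \<bar>chain k m (j + n) F x - chain k m n F x\<bar>) \<longlonglongrightarrow> \<bar>tail_avg m x - chain k m n F x\<bar>"
    by (intro tendsto_intros LIMSEQ_ignore_initial_segment chain_tendsto)
  show "\<exists>N. \<forall>j\<ge>N. \<bar>chain k m (j + n) F x - chain k m n F x\<bar> \<le> L * (\<Sum>i. a (i + (m + n)))"
    using chain_Cauchy[of m n _ x] by (auto simp: add.commute)
qed

lemma tail_avg_lipschitz: "L-lipschitz_on UNIV (tail_avg m)"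
proof (rule lipschitz_onI[OF _ L_nonneg])
  fix x y
  show "dist (tail_avg m x) (tail_avg m y) \<le> L * dist x y"
  proof (rule LIMSEQ_le_const2)
    show "(\<lambda>n. dist (chain k m n F x) (chain k m n F y)) \<longlonglongrightarrow> dist (tail_avg m x) (tail_avg m y)"
      by (intro tendsto_intros chain_tendsto)
  qed (use lipschitz_onD[OF chain_mollifier_lipschitz[OF F]] in auto)
qed

lemma tail_avg_continuous: "continuous_on A (tail_avg m)"
  using lipschitz_on_continuous_on[OF tail_avg_lipschitz] continuous_on_subset by blast

lemma tails_tendsto_0: "(\<lambda>n. L * (\<Sum>i. a (i + (m + n)))) \<longlonglongrightarrow> 0"
proof -
  have "(\<lambda>n. suminf a - (\<Sum>i<n. a i)) \<longlonglongrightarrow> suminf a - suminf a"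
    by (intro tendsto_intros summable_LIMSEQ a)
  then have "(\<lambda>n. \<Sum>i. a (i + n)) \<longlonglongrightarrow> 0"
    by (simp add: suminf_minus_initial_segment[OF a(1)])
  from tendsto_mult_right_zero[OF LIMSEQ_ignore_initial_segment[OF this, of m], of L]
  show ?thesis by (simp only: add.commute)
qed

text \<open>Convergence is uniform, with error controlled by the tails of \<open>a\<close>, so the
  limit passes through the outermost average.\<close>

lemma tail_avg_unfold: "tail_avg m = avg (a m) (k m) (d m) (tail_avg (Suc m))"
proof
  fix x
  have "(\<lambda>n. chain k m (Suc n) F x) \<longlonglongrightarrow> avg (a m) (k m) (d m) (tail_avg (Suc m)) x"
  proof (rule LIM_zero_cancel, rule Lim_null_comparison[OF _ tails_tendsto_0])
    have "\<bar>chain k m (Suc n) F x - avg (a m) (k m) (d m) (tail_avg (Suc m)) x\<bar>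
        \<le> integral {-a m..a m} (\<lambda>s. \<bar>k m s\<bar>) * (L * (\<Sum>i. a (i + (Suc m + n))))" for n
      unfolding chain.simps
    proof (rule avg_contraction)
      show "continuous_on UNIV (chain k (Suc m) n F)"
        by (intro chain_continuous F_continuous mollifierD(2)[OF k])
      show "\<bar>chain k (Suc m) n F x - tail_avg (Suc m) x\<bar> \<le> L * (\<Sum>i. a (i + (Suc m + n)))" for x
        using tail_avg_near[of "Suc m" x n] by (simp add: abs_minus_commute)
    qed (use tail_avg_continuous mollifierD(2)[OF k] in auto)
    then show "\<forall>\<^sub>F n in sequentially. norm (chain k m (Suc n) F x - avg (a m) (k m) (d m) (tail_avg (Suc m)) x)
        \<le> L * (\<Sum>i. a (i + (Suc m + n)))"
      using mollifierD(5)[OF k] by simp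
  qed
  then have "(\<lambda>n. chain k m n F x) \<longlonglongrightarrow> avg (a m) (k m) (d m) (tail_avg (Suc m)) x"
    by (rule LIMSEQ_imp_Suc)
  with chain_tendsto show "tail_avg m x = avg (a m) (k m) (d m) (tail_avg (Suc m)) x"
    by (rule LIMSEQ_unique)
qed

text \<open>Each average shifts the centre and the curve by the same vector, of norm at most
  \<open>a m\<close>, so only translates by at most the sum of the radii are involved.\<close>

lemma chain_submean:
  assumes "continuous_on {0..2 * pi} c"
    and "\<And>y. norm y \<le> (\<Sum>i<n. a (m + i)) \<Longrightarrow> F (x + y) \<le> circle_mean (\<lambda>\<theta>. F (c \<theta> + y))"
  shows "chain k m n F x \<le> circle_mean (\<lambda>\<theta>. chain k m n F (c \<theta>))"
  using assms
proof (induction n arbitrary: m x c)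
  case 0
  then show ?case using "0.prems"(2)[of 0] by simp
next
  case (Suc n)
  show ?case unfolding chain.simps
  proof (rule avg_submean[OF _ mollifierD(2,3)[OF k] Suc.prems(1)])
    show "continuous_on UNIV (chain k (Suc m) n F)"
      by (intro chain_continuous F_continuous mollifierD(2)[OF k])
    fix s assume s: "\<bar>s\<bar> \<le> a m"
    show "chain k (Suc m) n F (x + s *\<^sub>R d m) \<le> circle_mean (\<lambda>\<theta>. chain k (Suc m) n F (c \<theta> + s *\<^sub>R d m))"
    proof (rule Suc.IH)
      show "continuous_on {0..2 * pi} (\<lambda>\<theta>. c \<theta> + s *\<^sub>R d m)"
        by (intro continuous_intros Suc.prems)
      fix y :: 'a assume y: "norm y \<le> (\<Sum>i<n. a (Suc m + i))"
      have "norm (s *\<^sub>R d m) \<le> a m * 1" unfolding norm_scaleR using s d by (intro mult_mono) auto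
      then have "norm (s *\<^sub>R d m + y) \<le> (\<Sum>i<Suc n. a (m + i))"
        unfolding sum.lessThan_Suc_shift using y norm_triangle_ineq[of "s *\<^sub>R d m" y] by simp
      from Suc.prems(2)[OF this]
      show "F (x + s *\<^sub>R d m + y) \<le> circle_mean (\<lambda>\<theta>. F (c \<theta> + s *\<^sub>R d m + y))"
        by (simp add: add.assoc)
    qed
  qed
qed

lemma tail_avg_submean:
  assumes c: "continuous_on {0..2 * pi} c"
    and sub: "\<And>y. norm y \<le> suminf a \<Longrightarrow> F (x + y) \<le> circle_mean (\<lambda>\<theta>. F (c \<theta> + y))"
  shows "tail_avg 0 x \<le> circle_mean (\<lambda>\<theta>. tail_avg 0 (c \<theta>))"
proof (rule LIMSEQ_le[OF chain_tendsto])
  show "(\<lambda>n. circle_mean (\<lambda>\<theta>. tail_avg 0 (c \<theta>)) + L * (\<Sum>i. a (i + (0 + n))))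
      \<longlonglongrightarrow> circle_mean (\<lambda>\<theta>. tail_avg 0 (c \<theta>))"
    using tendsto_add[OF tendsto_const tails_tendsto_0[of 0]] by (simp only: add_0_right)
  have "chain k 0 n F x \<le> circle_mean (\<lambda>\<theta>. tail_avg 0 (c \<theta>)) + L * (\<Sum>i. a (i + (0 + n)))" for n
  proof -
    have tc: "continuous_on {0..2 * pi} (\<lambda>\<theta>. tail_avg 0 (c \<theta>))"
      by (rule continuous_on_compose2[OF tail_avg_continuous[of UNIV] c]) auto
    have "chain k 0 n F x \<le> circle_mean (\<lambda>\<theta>. chain k 0 n F (c \<theta>))"
    proof (rule chain_submean[OF c sub])
      fix y :: 'a assume "norm y \<le> (\<Sum>i<n. a (0 + i))"
      also have "\<dots> \<le> suminf a"
        using sum_le_suminf[OF a(1), of "{..<n}"] a(2) by (simp add: less_imp_le)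
      finally show "norm y \<le> suminf a" .
    qed
    also have "\<dots> \<le> circle_mean (\<lambda>\<theta>. tail_avg 0 (c \<theta>) + L * (\<Sum>i. a (i + (0 + n))))"
    proof (rule circle_mean_mono)
      show "continuous_on {0..2 * pi} (\<lambda>\<theta>. chain k 0 n F (c \<theta>))"
        by (rule continuous_on_compose2[OF chain_continuous[of _ _ UNIV] c])
          (use F_continuous mollifierD(2)[OF k] in auto)
      show "chain k 0 n F (c \<theta>) \<le> tail_avg 0 (c \<theta>) + L * (\<Sum>i. a (i + (0 + n)))" for \<theta>
        using tail_avg_near[of 0 "c \<theta>" n] by linarith
    qed (intro continuous_intros tc)
    finally show ?thesis by (simp add: circle_mean_add[OF tc])
  qed
  then show "\<exists>N. \<forall>n\<ge>N. chain k 0 n F x \<le> circle_mean (\<lambda>\<theta>. tail_avg 0 (c \<theta>)) + L * (\<Sum>i. a (i + (0 + n)))"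
    by blast
qed

text \<open>A class closed under all the directional derivatives: arbitrary smooth kernels in
  finitely many places, untouched mollifiers in the tail. \<open>M\<close> varies because a
  derivative in a later direction needs a longer head.\<close>

definition smoothed :: "('a \<Rightarrow> real) set" where
  "smoothed = {chain \<kappa> 0 M (tail_avg M) | \<kappa> M. \<forall>m. smooth_kernel (a m) (\<kappa> m)}"

lemma tail_avg_in_smoothed: "tail_avg 0 \<in> smoothed"
  unfolding smoothed_def using mollifierD(1)[OF k] by (auto intro!: exI[of _ k] exI[of _ 0])

lemma smoothed_lipschitz: "f \<in> smoothed \<Longrightarrow> \<exists>C. C-lipschitz_on UNIV f"
  unfolding smoothed_def
  by (auto intro!: chain_lipschitz[OF _ tail_avg_lipschitz] smooth_kernel_continuous)

lemma chain_dir_deriv: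
  assumes "continuous_on UNIV f" "\<And>m. smooth_kernel (a m) (\<kappa> m)" "m \<le> i" "i < m + n"
    and k': "smooth_kernel (a i) k'" "\<And>s. (\<kappa> i has_real_derivative k' s) (at s)"
  shows "dir_deriv (d i) (chain \<kappa> m n f) (chain (\<kappa>(i := \<lambda>s. - k' s)) m n f)"
  using assms(3,4)
proof (induction n arbitrary: m)
  case (Suc n)
  let ?\<kappa> = "\<kappa>(i := \<lambda>s. - k' s)"
  have kc: "continuous_on UNIV (\<kappa> m)" for m using assms(2) smooth_kernel_continuous by blast
  have kc': "continuous_on UNIV (?\<kappa> m)" for m
    using kc smooth_kernel_continuous[OF k'(1)] by (auto intro!: continuous_intros)
  show ?case
  proof (cases "i = m")
    case True
    have "chain ?\<kappa> (Suc m) n f = chain \<kappa> (Suc m) n f"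
      by (rule chain_cong) (use True in auto)
    then have "chain ?\<kappa> m (Suc n) f = avg (a m) (\<lambda>s. - k' s) (d m) (chain \<kappa> (Suc m) n f)"
      using True by (simp only: chain.simps fun_upd_same)
    moreover have "dir_deriv (d m) (avg (a m) (\<kappa> m) (d m) (chain \<kappa> (Suc m) n f))
        (avg (a m) (\<lambda>s. - k' s) (d m) (chain \<kappa> (Suc m) n f))"
      by (rule dir_deriv_avg_kernel[OF chain_continuous[OF assms(1) kc] assms(2)]) (use k' True in auto)
    ultimately show ?thesis using True by (simp only: chain.simps(2))
  next
    case False
    then have "dir_deriv (d i) (chain \<kappa> (Suc m) n f) (chain ?\<kappa> (Suc m) n f)"
      using Suc.prems by (intro Suc.IH) auto
    from dir_deriv_avg[OF chain_continuous[OF assms(1) kc] chain_continuous[OF assms(1) kc'] kc this]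
    have "dir_deriv (d i) (avg (a m) (\<kappa> m) (d m) (chain \<kappa> (Suc m) n f))
        (avg (a m) (?\<kappa> m) (d m) (chain ?\<kappa> (Suc m) n f))"
      using False by simp
    then show ?thesis by (simp only: chain.simps(2))
  qed
qed simp

lemma smoothed_dir_deriv:
  assumes "f \<in> smoothed"
  shows "\<exists>g\<in>smoothed. dir_deriv (d i) f g"
proof -
  obtain \<kappa> M where f: "f = chain \<kappa> 0 M (tail_avg M)" and \<kappa>: "\<And>m. smooth_kernel (a m) (\<kappa> m)"
    using assms by (auto simp: smoothed_def)
  \<comment> \<open>Averages are split off the tail, with their mollifiers as kernels, until the
    \<open>i\<close>-th one belongs to the head and its kernel can be differentiated.\<close>
  have "\<exists>\<kappa>. f = chain \<kappa> 0 (M + j) (tail_avg (M + j)) \<and> (\<forall>m. smooth_kernel (a m) (\<kappa> m))" for j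
  proof (induction j)
    case 0
    then show ?case using f \<kappa> by auto
  next
    case (Suc j)
    then obtain \<kappa> where *: "f = chain \<kappa> 0 (M + j) (tail_avg (M + j))" "\<And>m. smooth_kernel (a m) (\<kappa> m)"
      by auto
    let ?\<kappa> = "\<kappa>(M + j := k (M + j))"
    have "f = chain ?\<kappa> 0 (M + j) (tail_avg (M + j))"
      unfolding *(1) by (rule chain_cong) auto
    also have "\<dots> = chain ?\<kappa> 0 (Suc (M + j)) (tail_avg (Suc (M + j)))"
      unfolding chain_snoc tail_avg_unfold[of "M + j"] by simp
    finally show ?case using * mollifierD(1)[OF k] by (auto intro!: exI[of _ ?\<kappa>])
  qed
  from this[of "Suc i"] obtain \<kappa> where *: "f = chain \<kappa> 0 (M + Suc i) (tail_avg (M + Suc i))"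
    "\<And>m. smooth_kernel (a m) (\<kappa> m)" by auto
  obtain k' where k': "smooth_kernel (a i) k'" "\<And>s. (\<kappa> i has_real_derivative k' s) (at s)"
    using smooth_kernel_deriv[OF *(2)] by blast
  have "Cn n (\<lambda>s. - k' s)" for n
    using Cn_mult[OF Cn_const[of n "-1"], of k'] k'(1) by (simp add: smooth_kernel_def)
  then have "smooth_kernel (a i) (\<lambda>s. - k' s)"
    using k'(1) by (auto simp: smooth_kernel_def)
  then have "chain (\<kappa>(i := \<lambda>s. - k' s)) 0 (M + Suc i) (tail_avg (M + Suc i)) \<in> smoothed"
    unfolding smoothed_def using *(2) by (auto intro!: exI[of _ "\<kappa>(i := \<lambda>s. - k' s)"] exI[of _ "M + Suc i"])
  moreover have "dir_deriv (d i) f (chain (\<kappa>(i := \<lambda>s. - k' s)) 0 (M + Suc i) (tail_avg (M + Suc i)))"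
    unfolding *(1) by (rule chain_dir_deriv[OF tail_avg_continuous *(2) _ _ k']) auto
  ultimately show ?thesis by blast
qed

end

section \<open>Functions with uniformly Lipschitz partial derivatives\<close>

text \<open>A ball about a point of \<open>V\<close> that leaves \<open>V\<close> meets the frontier
  because it is connected; so a positive distance to the frontier amounts to a uniform radius of
  balls inside \<open>V\<close>. This form also absorbs the cases of empty \<open>S\<close> and of
  the whole space.\<close>

lemma uniformly_included_iff:
  assumes V: "open V"
  shows "uniformly_included S V \<longleftrightarrow> bounded S \<and> (\<exists>r>0. \<forall>z\<in>S. ball z r \<subseteq> V)"
proof (cases "S = {} \<or> V = UNIV")
  case True
  then show ?thesis by (auto simp: uniformly_included_def boundary_dist_def intro: exI[of _ 1])
next
  case False
  have fr: "p \<notin> V" if "p \<in> frontier V" for p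
    using that V by (simp add: frontier_def interior_open)
  show ?thesis
  proof
    assume "uniformly_included S V"
    with False have S: "S \<subseteq> V" "bounded S" "boundary_dist S V > 0" by (auto simp: uniformly_included_def)
    then obtain c where c: "0 < c" "c < boundary_dist S V" using dense by blast
    then have "c \<noteq> top" by auto
    then obtain r where r: "c = ennreal r" "r > 0" using c by (cases c) auto
    have "ball z r \<subseteq> V" if z: "z \<in> S" for z
    proof (rule ccontr)
      assume "\<not> ball z r \<subseteq> V"
      then have "ball z r - V \<noteq> {}" by blast
      moreover have "z \<in> ball z r \<inter> V" using z S r by auto
      then have "ball z r \<inter> V \<noteq> {}" by blast
      ultimately obtain p where p: "p \<in> ball z r" "p \<in> frontier V"
        using connected_Int_frontier[OF connected_ball] by blast
      have "boundary_dist S V \<le> ennreal (norm (z - p))"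
        using False z p by (auto simp: boundary_dist_def intro!: INF_lower2[of "(z, p)"])
      also have "\<dots> \<le> c" using p unfolding r(1) by (intro ennreal_leI) (simp add: dist_norm)
      finally show False using c by simp
    qed
    with S r show "bounded S \<and> (\<exists>r>0. \<forall>z\<in>S. ball z r \<subseteq> V)" by blast
  next
    assume "bounded S \<and> (\<exists>r>0. \<forall>z\<in>S. ball z r \<subseteq> V)"
    then obtain r where r: "bounded S" "r > 0" "\<And>z. z \<in> S \<Longrightarrow> ball z r \<subseteq> V" by blast
    have "ennreal r \<le> boundary_dist S V"
      using False unfolding boundary_dist_def
    proof (simp, intro INF_greatest)
      fix x assume "x \<in> S \<times> frontier V"
      then have "fst x \<in> S" "snd x \<notin> V" using fr by auto
      with r have "\<not> norm (fst x - snd x) < r" by (force simp: dist_norm)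
      then show "ennreal r \<le> ennreal (norm (fst x - snd x))" by (intro ennreal_leI) simp
    qed
    then have "boundary_dist S V > 0" using r(2) by (auto intro: less_le_trans[rotated])
    moreover have "S \<subseteq> V" using r by force
    ultimately show "uniformly_included S V" using r by (auto simp: uniformly_included_def)
  qed
qed

text \<open>The comparison point \<open>w\<close> runs through a full ball about \<open>z\<close>,
  not only through \<open>S\<close>, since bounding the gradient at \<open>z\<close> requires steps
  in all directions. \<open>K\<close> and \<open>r\<close> depend on \<open>S\<close> alone.\<close>

definition ulip :: "ell2 set \<Rightarrow> (ell2 \<Rightarrow> 'b::real_normed_vector) \<Rightarrow> bool" where
  "ulip V f \<longleftrightarrow> (\<forall>S. uniformly_included S V \<longrightarrow> (\<exists>K r. r > 0 \<and>
     (\<forall>z\<in>S. norm (f z) \<le> K \<and> (\<forall>w. dist w z < r \<longrightarrow> norm (f w - f z) \<le> K * dist w z))))"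

lemma ulipE:
  assumes "ulip V f" "open V" "uniformly_included S V"
  obtains K r where "r > 0" "r \<le> 1" "K \<ge> 0" "\<And>z. z \<in> S \<Longrightarrow> ball z r \<subseteq> V"
    "\<And>z. z \<in> S \<Longrightarrow> norm (f z) \<le> K"
    "\<And>z w. z \<in> S \<Longrightarrow> dist w z < r \<Longrightarrow> norm (f w - f z) \<le> K * dist w z"
    "\<And>z w. z \<in> S \<Longrightarrow> dist w z < r \<Longrightarrow> norm (f w) \<le> K"
proof -
  obtain K r where K: "r > 0" "\<And>z. z \<in> S \<Longrightarrow> norm (f z) \<le> K"
    "\<And>z w. z \<in> S \<Longrightarrow> dist w z < r \<Longrightarrow> norm (f w - f z) \<le> K * dist w z"
    using assms(1,3) unfolding ulip_def by blast
  obtain r' where r': "r' > 0" "\<And>z. z \<in> S \<Longrightarrow> ball z r' \<subseteq> V"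
    using assms by (auto simp: uniformly_included_iff)
  define r'' where "r'' = min 1 (min r r')"
  have mono: "norm (f w - f z) \<le> (2 * max K 0) * dist w z" if "z \<in> S" "dist w z < r''" for z w
  proof -
    have "norm (f w - f z) \<le> K * dist w z" using K(3) that by (simp add: r''_def)
    also have "\<dots> \<le> (2 * max K 0) * dist w z" by (intro mult_right_mono) auto
    finally show ?thesis .
  qed
  show ?thesis
  proof (rule that[of r'' "2 * max K 0"])
    fix z w assume zw: "z \<in> S" "dist w z < r''"
    have "norm (f w - f z) \<le> K * dist w z" using K(3) zw by (simp add: r''_def)
    also have "\<dots> \<le> max K 0 * 1" using zw by (intro mult_mono) (auto simp: r''_def)
    finally show "norm (f w) \<le> 2 * max K 0"
      using norm_triangle_ineq2[of "f w" "f z"] K(2)[OF zw(1)] by linarith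
  qed (use K(1,2) r' mono in \<open>force simp: r''_def\<close>)+
qed

lemma ulipI:
  assumes "\<And>S. uniformly_included S V \<Longrightarrow> \<exists>K r. r > 0 \<and>
     (\<forall>z\<in>S. norm (f z) \<le> K \<and> (\<forall>w. dist w z < r \<longrightarrow> norm (f w - f z) \<le> K * dist w z))"
  shows "ulip V f"
  using assms by (simp add: ulip_def)

lemma ulip_cong:
  assumes "ulip V f" "open V" "\<And>z. z \<in> V \<Longrightarrow> f z = g z"
  shows "ulip V g"
proof (rule ulipI)
  fix S assume S: "uniformly_included S V"
  obtain K r where K: "r > 0" "\<And>z. z \<in> S \<Longrightarrow> ball z r \<subseteq> V" "\<And>z. z \<in> S \<Longrightarrow> norm (f z) \<le> K"
    "\<And>z w. z \<in> S \<Longrightarrow> dist w z < r \<Longrightarrow> norm (f w - f z) \<le> K * dist w z"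
    by (rule ulipE[OF assms(1,2) S]) blast
  have eq: "g w = f w" if "z \<in> S" "dist w z < r" for z w
    using subsetD[OF K(2)[OF that(1)], of w] that(2) assms(3)[of w] by (simp add: dist_commute)
  have "norm (g z) \<le> K" "\<forall>w. dist w z < r \<longrightarrow> norm (g w - g z) \<le> K * dist w z" if "z \<in> S" for z
    using K(3)[OF that] K(4)[OF that] eq[OF that] K(1) eq[OF that, of z] by simp_all
  then show "\<exists>K r. r > 0 \<and> (\<forall>z\<in>S. norm (g z) \<le> K \<and> (\<forall>w. dist w z < r \<longrightarrow> norm (g w - g z) \<le> K * dist w z))"
    using K(1) by blast
qed

lemma ulip_lipschitz:
  assumes "open V" "C-lipschitz_on UNIV f"
  shows "ulip V f"
proof (rule ulipI)
  fix S assume "uniformly_included S V"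
  then have "bounded S" using assms by (simp add: uniformly_included_iff)
  then obtain B where B: "\<And>z. z \<in> S \<Longrightarrow> norm z \<le> B" by (auto simp: bounded_iff)
  have C: "norm (f w - f z) \<le> C * dist w z" "C \<ge> 0" for w z
    using lipschitz_onD[OF assms(2), of w z] lipschitz_on_nonneg[OF assms(2)] by (auto simp: dist_norm)
  have "norm (f z) \<le> norm (f 0) + C * B" if "z \<in> S" for z
  proof -
    have "norm (f z - f 0) \<le> C * B"
      using C(1)[of z 0] mult_left_mono[OF B[OF that] C(2)] by (simp add: dist_norm)
    then show ?thesis using norm_triangle_ineq2[of "f z" "f 0"] by linarith
  qed
  moreover have lip: "norm (f w - f z) \<le> max (norm (f 0) + C * B) C * dist w z" for w z
    using C(1)[of w z] mult_right_mono[of C "max (norm (f 0) + C * B) C" "dist w z"] by simp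
  ultimately show "\<exists>K r. r > 0 \<and> (\<forall>z\<in>S. norm (f z) \<le> K \<and> (\<forall>w. dist w z < r \<longrightarrow> norm (f w - f z) \<le> K * dist w z))"
    by (meson order.trans max.cobounded1 zero_less_one)
qed

lemma ulip_const: "open V \<Longrightarrow> ulip V (\<lambda>_. c)"
  by (rule ulip_lipschitz[of _ 0]) (auto intro: lipschitz_onI)

lemma ulip_add:
  assumes "ulip V f" "ulip V g" "open V"
  shows "ulip V (\<lambda>z. f z + g z)"
proof (rule ulipI)
  fix S assume S: "uniformly_included S V"
  obtain K r where K: "r > 0" "\<And>z. z \<in> S \<Longrightarrow> norm (f z) \<le> K"
    "\<And>z w. z \<in> S \<Longrightarrow> dist w z < r \<Longrightarrow> norm (f w - f z) \<le> K * dist w z"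
    by (rule ulipE[OF assms(1,3) S]) blast
  obtain K' r' where K': "r' > 0" "\<And>z. z \<in> S \<Longrightarrow> norm (g z) \<le> K'"
    "\<And>z w. z \<in> S \<Longrightarrow> dist w z < r' \<Longrightarrow> norm (g w - g z) \<le> K' * dist w z"
    by (rule ulipE[OF assms(2,3) S]) blast
  show "\<exists>K r. r > 0 \<and> (\<forall>z\<in>S. norm (f z + g z) \<le> K \<and> (\<forall>w. dist w z < r \<longrightarrow> norm (f w + g w - (f z + g z)) \<le> K * dist w z))"
  proof (rule exI[of _ "K + K'"], rule exI[of _ "min r r'"], intro conjI ballI allI impI)
    fix z assume z: "z \<in> S"
    show "norm (f z + g z) \<le> K + K'" using norm_triangle_mono K(2) K'(2) z by blast
    fix w assume "dist w z < min r r'"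
    then show "norm (f w + g w - (f z + g z)) \<le> (K + K') * dist w z"
      using norm_triangle_mono[OF K(3) K'(3), OF z _ z] by (simp add: add_diff_add distrib_right)
  qed (use K K' in auto)
qed

lemma ulip_mult:
  fixes f g :: "ell2 \<Rightarrow> 'b::real_normed_algebra"
  assumes "ulip V f" "ulip V g" "open V"
  shows "ulip V (\<lambda>z. f z * g z)"
proof (rule ulipI)
  fix S assume S: "uniformly_included S V"
  obtain K r where K: "r > 0" "K \<ge> 0" "\<And>z. z \<in> S \<Longrightarrow> norm (f z) \<le> K"
    "\<And>z w. z \<in> S \<Longrightarrow> dist w z < r \<Longrightarrow> norm (f w - f z) \<le> K * dist w z"
    "\<And>z w. z \<in> S \<Longrightarrow> dist w z < r \<Longrightarrow> norm (f w) \<le> K"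
    by (rule ulipE[OF assms(1,3) S]) blast
  obtain K' r' where K': "r' > 0" "K' \<ge> 0" "\<And>z. z \<in> S \<Longrightarrow> norm (g z) \<le> K'"
    "\<And>z w. z \<in> S \<Longrightarrow> dist w z < r' \<Longrightarrow> norm (g w - g z) \<le> K' * dist w z"
    by (rule ulipE[OF assms(2,3) S]) blast
  show "\<exists>K r. r > 0 \<and> (\<forall>z\<in>S. norm (f z * g z) \<le> K \<and> (\<forall>w. dist w z < r \<longrightarrow> norm (f w * g w - f z * g z) \<le> K * dist w z))"
  proof (rule exI[of _ "2 * K * K'"], rule exI[of _ "min r r'"], intro conjI ballI allI impI)
    fix z assume z: "z \<in> S"
    have "norm (f z * g z) \<le> K * K'"
      by (rule order_trans[OF norm_mult_ineq mult_mono]) (use K K' z in auto)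
    then show "norm (f z * g z) \<le> 2 * K * K'" using K K' mult_nonneg_nonneg[of K K'] by linarith
    fix w assume w: "dist w z < min r r'"
    have "f w * g w - f z * g z = f w * (g w - g z) + (f w - f z) * g z" by (simp add: algebra_simps)
    also have "norm \<dots> \<le> norm (f w) * norm (g w - g z) + norm (f w - f z) * norm (g z)"
      by (rule norm_triangle_mono) (rule norm_mult_ineq)+
    also have "\<dots> \<le> K * (K' * dist w z) + (K * dist w z) * K'"
      using K K' z w by (intro add_mono mult_mono) auto
    finally show "norm (f w * g w - f z * g z) \<le> 2 * K * K' * dist w z" by (simp add: algebra_simps)
  qed (use K K' in auto)
qed

lemma ulip_of_real:
  assumes "ulip V g"
  shows "ulip V (\<lambda>z. of_real (g z) :: 'b::real_normed_div_algebra)"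
  using assms by (simp add: ulip_def of_real_diff[symmetric] del: of_real_diff)

lemma ulip_compose:
  fixes g :: "ell2 \<Rightarrow> real"
  assumes g: "ulip V g" "open V" and w: "\<And>x. (w has_real_derivative w' x) (at x)" "continuous_on UNIV w'"
  shows "ulip V (\<lambda>z. w (g z))"
proof (rule ulipI)
  fix S assume S: "uniformly_included S V"
  obtain K r where K: "r > 0" "K \<ge> 0" "\<And>z. z \<in> S \<Longrightarrow> norm (g z) \<le> K"
    "\<And>z w. z \<in> S \<Longrightarrow> dist w z < r \<Longrightarrow> norm (g w - g z) \<le> K * dist w z"
    "\<And>z w. z \<in> S \<Longrightarrow> dist w z < r \<Longrightarrow> norm (g w) \<le> K"
    by (rule ulipE[OF g S]) blast
  have "continuous_on UNIV w" using w by (auto intro: DERIV_continuous_on)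
  then have "compact (w ` {-K..K})" "compact (w' ` {-K..K})"
    using w by (auto intro!: compact_continuous_image intro: continuous_on_subset)
  then obtain B0 B1 where "\<And>x. x \<in> {-K..K} \<Longrightarrow> norm (w x) \<le> B0" "\<And>x. x \<in> {-K..K} \<Longrightarrow> norm (w' x) \<le> B1"
    using compact_imp_bounded bounded_iff by (metis (no_types, lifting) imageI)
  then obtain B where B: "\<And>x. x \<in> {-K..K} \<Longrightarrow> norm (w x) \<le> B" "\<And>x. x \<in> {-K..K} \<Longrightarrow> norm (w' x) \<le> B" "B \<ge> 0"
    by (intro that[of "max 0 (max B0 B1)"]) (auto simp: le_max_iff_disj)
  have lip: "norm (w x - w y) \<le> B * norm (x - y)" if "x \<in> {-K..K}" "y \<in> {-K..K}" for x y
    by (rule field_differentiable_bound[of "{-K..K}" w w'])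
      (use that B w in \<open>auto intro: has_field_derivative_at_within\<close>)
  show "\<exists>K r. r > 0 \<and> (\<forall>z\<in>S. norm (w (g z)) \<le> K \<and> (\<forall>u. dist u z < r \<longrightarrow> norm (w (g u) - w (g z)) \<le> K * dist u z))"
  proof (rule exI[of _ "B + B * K"], rule exI[of _ r], intro conjI ballI allI impI)
    fix z assume z: "z \<in> S"
    have gz: "g z \<in> {-K..K}" using K(3)[OF z] by (simp add: abs_le_iff)
    show "norm (w (g z)) \<le> B + B * K" using B(1)[OF gz] B(3) K(2) mult_nonneg_nonneg[of B K] by linarith
    fix u assume u: "dist u z < r"
    have "norm (w (g u) - w (g z)) \<le> B * norm (g u - g z)"
      by (rule lip) (use gz K(5)[OF z u] in \<open>auto simp: abs_le_iff\<close>)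
    also have "\<dots> \<le> B * (K * dist u z)" using K(4)[OF z u] B(3) by (intro mult_left_mono) auto
    also have "\<dots> \<le> (B + B * K) * dist u z" using B(3) by (simp add: algebra_simps)
    finally show "norm (w (g u) - w (g z)) \<le> (B + B * K) * dist u z" .
  qed (rule K)
qed

lemma ulip_local:
  assumes "open V"
    and "\<And>S. uniformly_included S V \<Longrightarrow> \<exists>W g. ulip V g \<and> (\<exists>r>0. \<forall>z\<in>S. ball z r \<subseteq> W) \<and> (\<forall>z\<in>W. f z = g z)"
  shows "ulip V f"
proof (rule ulipI)
  fix S assume S: "uniformly_included S V"
  obtain W g r' where W: "ulip V g" "r' > 0" "\<And>z. z \<in> S \<Longrightarrow> ball z r' \<subseteq> W" "\<And>z. z \<in> W \<Longrightarrow> f z = g z"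
    using assms(2)[OF S] by blast
  obtain K r where K: "r > 0" "\<And>z. z \<in> S \<Longrightarrow> norm (g z) \<le> K"
    "\<And>z w. z \<in> S \<Longrightarrow> dist w z < r \<Longrightarrow> norm (g w - g z) \<le> K * dist w z"
    by (rule ulipE[OF W(1) assms(1) S]) blast
  have eq: "f w = g w" if "z \<in> S" "dist w z < r'" for z w
    using subsetD[OF W(3)[OF that(1)], of w] that(2) W(4)[of w] by (simp add: dist_commute)
  have "norm (f z) \<le> K" "\<forall>w. dist w z < min r r' \<longrightarrow> norm (f w - f z) \<le> K * dist w z" if "z \<in> S" for z
    using K(2)[OF that] K(3)[OF that] eq[OF that] eq[OF that, of z] W(2) by simp_all
  then show "\<exists>K r. r > 0 \<and> (\<forall>z\<in>S. norm (f z) \<le> K \<and> (\<forall>w. dist w z < r \<longrightarrow> norm (f w - f z) \<le> K * dist w z))"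
    using K(1) W(2) by (metis min_less_iff_conj)
qed

lemma ulip_continuous:
  assumes "ulip V f" "open V"
  shows "continuous_on V f"
proof -
  have "isCont f z" if z: "z \<in> V" for z
  proof -
    have "uniformly_included {z} V"
      using assms(2) z open_contains_ball by (auto simp: uniformly_included_iff)
    then obtain K r where K: "r > 0" "K \<ge> 0" "\<And>w. dist w z < r \<Longrightarrow> norm (f w - f z) \<le> K * dist w z"
      by (rule ulipE[OF assms]) blast
    have "((\<lambda>w. f w - f z) \<longlongrightarrow> 0) (at z)"
    proof (rule Lim_null_comparison)
      show "\<forall>\<^sub>F w in at z. norm (f w - f z) \<le> K * dist w z"
        using K by (auto simp: eventually_at)
      have "((\<lambda>w. K * dist w z) \<longlongrightarrow> K * dist z z) (at z)" by (intro tendsto_intros)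
      then show "((\<lambda>w. K * dist w z) \<longlongrightarrow> 0) (at z)" by simp
    qed
    then show ?thesis
      unfolding isCont_def by (rule LIM_zero_cancel)
  qed
  then show ?thesis by (simp add: continuous_at_imp_continuous_on)
qed

text \<open>C^n with all derivatives in \<open>ulip\<close>. Derivatives enter as witnesses
  constrained on \<open>V\<close> only, which keeps the closure rules for sums, products and
  compositions short.\<close>

primrec usmooth :: "nat \<Rightarrow> ell2 set \<Rightarrow> (ell2 \<Rightarrow> 'b::real_normed_field) \<Rightarrow> bool" where
  "usmooth 0 V f \<longleftrightarrow> ulip V f"
| "usmooth (Suc n) V f \<longleftrightarrow> ulip V f \<and> (\<forall>c. \<exists>g. usmooth n V g \<and>
     (\<forall>z\<in>V. ((\<lambda>t. f (z + t *\<^sub>R direction c)) has_vector_derivative g z) (at 0)))"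

lemma usmooth_ulip: "usmooth n V f \<Longrightarrow> ulip V f"
  by (cases n) auto

lemma usmooth_Suc_imp: "usmooth (Suc n) V f \<Longrightarrow> usmooth n V f"
proof (induction n arbitrary: f)
  case (Suc n)
  then show ?case by (metis usmooth.simps(2))
qed simp

lemma has_vector_derivative_direction_cong:
  fixes z e :: "'a::real_normed_vector"
  assumes "((\<lambda>t. f (z + t *\<^sub>R e)) has_vector_derivative D) (at 0)"
    "open V" "z \<in> V" "\<And>w. w \<in> V \<Longrightarrow> f w = g w"
  shows "((\<lambda>t. g (z + t *\<^sub>R e)) has_vector_derivative D) (at (0::real))"
proof (rule has_vector_derivative_transform_within_open[OF assms(1)])
  have "open ((\<lambda>t::real. z + t *\<^sub>R e) -` V)"
    using assms(2) by (intro open_vimage continuous_intros)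
  then show "open {t::real. z + t *\<^sub>R e \<in> V}" by (simp add: vimage_def)
qed (use assms in auto)

lemma usmooth_cong:
  assumes "usmooth n V f" "open V" "\<And>z. z \<in> V \<Longrightarrow> f z = g z"
  shows "usmooth n V g"
proof (cases n)
  case 0
  then show ?thesis using assms ulip_cong by auto
next
  case (Suc m)
  have "ulip V g" using assms usmooth_ulip ulip_cong by blast
  moreover have "\<exists>h. usmooth m V h \<and> (\<forall>z\<in>V. ((\<lambda>t. g (z + t *\<^sub>R direction c)) has_vector_derivative h z) (at 0))" for c
  proof -
    obtain h where h: "usmooth m V h"
      "\<And>z. z \<in> V \<Longrightarrow> ((\<lambda>t. f (z + t *\<^sub>R direction c)) has_vector_derivative h z) (at 0)"
      using assms(1) unfolding Suc usmooth.simps by blast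
    have "((\<lambda>t. g (z + t *\<^sub>R direction c)) has_vector_derivative h z) (at 0)" if "z \<in> V" for z
      by (rule has_vector_derivative_direction_cong[OF h(2)[OF that] assms(2) that assms(3)])
    then show ?thesis using h(1) by blast
  qed
  ultimately show ?thesis by (simp add: Suc)
qed

lemma usmooth_const: "open V \<Longrightarrow> usmooth n V (\<lambda>_. c)"
proof (induction n arbitrary: c)
  case (Suc n)
  then show ?case by (auto intro!: ulip_const exI[of _ "\<lambda>_. 0"])
qed (simp add: ulip_const)

lemma usmooth_add:
  assumes "usmooth n V f" "usmooth n V g" "open V"
  shows "usmooth n V (\<lambda>z. f z + g z)"
  using assms(1,2)
proof (induction n arbitrary: f g)
  case (Suc n)
  have "\<exists>h. usmooth n V h \<and> (\<forall>z\<in>V. ((\<lambda>t. f (z + t *\<^sub>R direction c) + g (z + t *\<^sub>R direction c)) has_vector_derivative h z) (at 0))" for c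
  proof -
    obtain f' g' where *: "usmooth n V f'" "usmooth n V g'"
      "\<And>z. z \<in> V \<Longrightarrow> ((\<lambda>t. f (z + t *\<^sub>R direction c)) has_vector_derivative f' z) (at 0)"
      "\<And>z. z \<in> V \<Longrightarrow> ((\<lambda>t. g (z + t *\<^sub>R direction c)) has_vector_derivative g' z) (at 0)"
      using Suc.prems by auto metis
    then show ?thesis
      by (intro exI[of _ "\<lambda>z. f' z + g' z"] conjI Suc.IH ballI has_vector_derivative_add) auto
  qed
  then show ?case using Suc.prems ulip_add[OF _ _ assms(3)] by auto
qed (simp add: ulip_add assms)

lemma usmooth_mult:
  assumes "usmooth n V f" "usmooth n V g" "open V"
  shows "usmooth n V (\<lambda>z. f z * g z)"
  using assms(1,2)
proof (induction n arbitrary: f g)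
  case (Suc n)
  have "\<exists>h. usmooth n V h \<and> (\<forall>z\<in>V. ((\<lambda>t. f (z + t *\<^sub>R direction c) * g (z + t *\<^sub>R direction c)) has_vector_derivative h z) (at 0))" for c
  proof -
    obtain f' g' where *: "usmooth n V f'" "usmooth n V g'"
      "\<And>z. z \<in> V \<Longrightarrow> ((\<lambda>t. f (z + t *\<^sub>R direction c)) has_vector_derivative f' z) (at 0)"
      "\<And>z. z \<in> V \<Longrightarrow> ((\<lambda>t. g (z + t *\<^sub>R direction c)) has_vector_derivative g' z) (at 0)"
      using Suc.prems by auto metis
    have fg: "usmooth n V f" "usmooth n V g" using Suc.prems usmooth_Suc_imp by auto
    have "usmooth n V (\<lambda>z. f z * g' z + f' z * g z)"
      by (intro usmooth_add Suc.IH * fg assms(3))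
    moreover have "((\<lambda>t. f (z + t *\<^sub>R direction c) * g (z + t *\<^sub>R direction c)) has_vector_derivative f z * g' z + f' z * g z) (at 0)"
      if "z \<in> V" for z
      using has_vector_derivative_mult[OF *(3)[OF that] *(4)[OF that]] by simp
    ultimately show ?thesis by blast
  qed
  then show ?case using Suc.prems ulip_mult[OF _ _ assms(3)] by auto
qed (simp add: ulip_mult assms)

text \<open>One derivative of \<open>w\<close> more than the order: already at order 0 the Lipschitz
  bound of the composition rests on a bound of \<open>w'\<close> on compact intervals.\<close>

lemma usmooth_compose:
  fixes g :: "ell2 \<Rightarrow> real"
  assumes "usmooth n V g" "open V" "Cn (Suc n) w"
  shows "usmooth n V (\<lambda>z. w (g z))"
  using assms(1,3)
proof (induction n arbitrary: w)
  case 0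
  then show ?case using ulip_compose[OF _ assms(2)] Cn_continuous by fastforce
next
  case (Suc n)
  obtain w' where w': "\<And>x. (w has_real_derivative w' x) (at x)" "Cn (Suc n) w'"
    using Suc.prems(2) by (metis Cn.simps(2))
  have u: "ulip V (\<lambda>z. w (g z))"
    using ulip_compose[OF usmooth_ulip[OF Suc.prems(1)] assms(2) w'(1) Cn_continuous[OF w'(2)]] .
  have "\<exists>h. usmooth n V h \<and> (\<forall>z\<in>V. ((\<lambda>t. w (g (z + t *\<^sub>R direction c))) has_vector_derivative h z) (at 0))" for c
  proof -
    obtain g' where g': "usmooth n V g'"
      "\<And>z. z \<in> V \<Longrightarrow> ((\<lambda>t. g (z + t *\<^sub>R direction c)) has_vector_derivative g' z) (at 0)"
      using Suc.prems(1) unfolding usmooth.simps by blast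
    have "usmooth n V (\<lambda>z. w' (g z) * g' z)"
      by (rule usmooth_mult[OF Suc.IH[OF usmooth_Suc_imp[OF Suc.prems(1)] w'(2)] g'(1) assms(2)])
    moreover have "((\<lambda>t. w (g (z + t *\<^sub>R direction c))) has_vector_derivative w' (g z) * g' z) (at 0)" if "z \<in> V" for z
      using g'(2)[OF that] w'(1)[of "g z"]
        DERIV_chain2[of w "w' (g z)" "\<lambda>t. g (z + t *\<^sub>R direction c)" 0 "g' z" UNIV]
      unfolding has_real_derivative_iff_has_vector_derivative[symmetric] by simp
    ultimately show ?thesis by blast
  qed
  with u show ?case by simp
qed

lemma usmooth_of_real:
  assumes "usmooth n V g"
  shows "usmooth n V (\<lambda>z. complex_of_real (g z))"
  using assms
proof (induction n arbitrary: g)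
  case (Suc n)
  have "\<exists>h. usmooth n V h \<and> (\<forall>z\<in>V. ((\<lambda>t. complex_of_real (g (z + t *\<^sub>R direction c))) has_vector_derivative h z) (at 0))" for c
  proof -
    obtain g' where g': "usmooth n V g'"
      "\<And>z. z \<in> V \<Longrightarrow> ((\<lambda>t. g (z + t *\<^sub>R direction c)) has_vector_derivative g' z) (at 0)"
      using Suc.prems unfolding usmooth.simps by blast
    have "((\<lambda>t. complex_of_real (g (z + t *\<^sub>R direction c))) has_vector_derivative complex_of_real (g' z)) (at 0)"
      if "z \<in> V" for z
      using bounded_linear.has_vector_derivative[OF bounded_linear_of_real g'(2)[OF that]] .
    then show ?thesis using Suc.IH[OF g'(1)] by blast
  qed
  then show ?case using Suc.prems ulip_of_real by auto
qed (simp add: ulip_of_real)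

text \<open>Made for a function given by finite sums whose length depends on the level, hence on
  \<open>S\<close>.\<close>

lemma usmooth_local:
  assumes V: "open V"
    and "\<And>S. uniformly_included S V \<Longrightarrow>
      \<exists>W g. usmooth n V g \<and> open W \<and> W \<subseteq> V \<and> (\<exists>r>0. \<forall>z\<in>S. ball z r \<subseteq> W) \<and> (\<forall>z\<in>W. f z = g z)"
  shows "usmooth n V f"
  using assms(2)
proof (induction n arbitrary: f)
  case 0
  then show ?case by (auto intro!: ulip_local[OF V]) metis
next
  case (Suc n)
  have ul: "ulip V f"
  proof (rule ulip_local[OF V])
    fix S assume "uniformly_included S V"
    from Suc.prems[OF this] show "\<exists>W g. ulip V g \<and> (\<exists>r>0. \<forall>z\<in>S. ball z r \<subseteq> W) \<and> (\<forall>z\<in>W. f z = g z)"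
      using usmooth_ulip by metis
  qed
  have "\<exists>h. usmooth n V h \<and> (\<forall>z\<in>V. ((\<lambda>t. f (z + t *\<^sub>R direction c)) has_vector_derivative h z) (at 0))" for c
  proof -
    \<comment> \<open>The local witnesses depend on \<open>S\<close>; the derivative itself does
      not, so it is taken as the global candidate.\<close>
    define h where "h z = vector_derivative (\<lambda>t. f (z + t *\<^sub>R direction c)) (at 0)" for z
    have loc: "\<exists>W g. usmooth n V g \<and> open W \<and> W \<subseteq> V \<and> (\<exists>r>0. \<forall>z\<in>S. ball z r \<subseteq> W) \<and>
        (\<forall>z\<in>W. ((\<lambda>t. f (z + t *\<^sub>R direction c)) has_vector_derivative g z) (at 0))"
      if "uniformly_included S V" for S
    proof -
      obtain W g where W: "usmooth (Suc n) V g" "open W" "W \<subseteq> V" "\<exists>r>0. \<forall>z\<in>S. ball z r \<subseteq> W" "\<forall>z\<in>W. f z = g z"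
        using Suc.prems \<open>uniformly_included S V\<close> by metis
      obtain g' where g': "usmooth n V g'"
        "\<And>z. z \<in> V \<Longrightarrow> ((\<lambda>t. g (z + t *\<^sub>R direction c)) has_vector_derivative g' z) (at 0)"
        using W(1) unfolding usmooth.simps by blast
      have "((\<lambda>t. f (z + t *\<^sub>R direction c)) has_vector_derivative g' z) (at 0)" if "z \<in> W" for z
        by (rule has_vector_derivative_direction_cong[OF g'(2) W(2)]) (use W that in auto)
      then show ?thesis using W g'(1) by blast
    qed
    have "usmooth n V h"
    proof (rule Suc.IH)
      fix S assume "uniformly_included S V"
      from loc[OF this] obtain W g where "usmooth n V g" "open W" "W \<subseteq> V" "\<exists>r>0. \<forall>z\<in>S. ball z r \<subseteq> W"
        "\<And>z. z \<in> W \<Longrightarrow> ((\<lambda>t. f (z + t *\<^sub>R direction c)) has_vector_derivative g z) (at 0)"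
        by blast
      moreover from this(5) have "\<forall>z\<in>W. h z = g z" unfolding h_def by (auto intro: vector_derivative_at)
      ultimately show "\<exists>W g. usmooth n V g \<and> open W \<and> W \<subseteq> V \<and> (\<exists>r>0. \<forall>z\<in>S. ball z r \<subseteq> W) \<and> (\<forall>z\<in>W. h z = g z)"
        by blast
    qed
    moreover have "((\<lambda>t. f (z + t *\<^sub>R direction c)) has_vector_derivative h z) (at 0)" if "z \<in> V" for z
    proof -
      have "uniformly_included {z} V"
        using V that open_contains_ball by (auto simp: uniformly_included_iff)
      from loc[OF this] obtain g where "((\<lambda>t. f (z + t *\<^sub>R direction c)) has_vector_derivative g z) (at 0)"
        by (metis centre_in_ball insertI1 subsetD)
      then show ?thesis unfolding h_def using vector_derivative_at by metis
    qed
    ultimately show ?thesis by blast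
  qed
  with ul show ?case by simp
qed

section \<open>Passage to partial derivatives and the spaces C^k\<close>

lemma has_partial_iff:
  "has_partial c f z D \<longleftrightarrow> ((\<lambda>t. f (z + t *\<^sub>R direction c)) has_vector_derivative D) (at 0)"
  unfolding has_partial_def has_vector_derivative_complex_iff DERIV_def tendsto_complex_iff
  by simp

lemma partial_eq: "has_partial c f z D \<Longrightarrow> partial c f z = D"
  unfolding partial_def
  by (rule the_equality) (auto simp: has_partial_def intro: LIM_unique)

lemma usmooth_partial:
  assumes "usmooth (Suc n) V f" "open V"
  shows "usmooth n V (partial c f)" "\<And>z. z \<in> V \<Longrightarrow> has_partial c f z (partial c f z)"
proof -
  obtain g where g: "usmooth n V g" "\<And>z. z \<in> V \<Longrightarrow> has_partial c f z (g z)"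
    using assms(1) unfolding usmooth.simps has_partial_iff by blast
  have eq: "g z = partial c f z" if "z \<in> V" for z
    using partial_eq[OF g(2)[OF that]] by simp
  show "usmooth n V (partial c f)" by (rule usmooth_cong[OF g(1) assms(2) eq])
  show "has_partial c f z (partial c f z)" if "z \<in> V" for z
    using g(2)[OF that] eq[OF that] by simp
qed

lemma usmooth_Ck: "usmooth n V f \<Longrightarrow> open V \<Longrightarrow> f \<in> Ck n V"
proof (induction n arbitrary: f)
  case (Suc n)
  have "continuous_on V f"
    using ulip_continuous[OF usmooth_ulip[OF Suc.prems(1)] Suc.prems(2)] .
  moreover have "\<exists>D. has_partial c f z D" if "z \<in> V" for c z
    using usmooth_partial(2)[OF Suc.prems that] by blast
  moreover have "partial c f \<in> Ck n V" for c
    by (rule Suc.IH[OF usmooth_partial(1)[OF Suc.prems] Suc.prems(2)])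
  ultimately show ?case by simp
qed (simp add: ulip_continuous)

lemma usmooth_cmult: "usmooth n V f \<Longrightarrow> open V \<Longrightarrow> usmooth n V (\<lambda>z. c * f z)"
  by (intro usmooth_mult usmooth_const)

lemma usmooth_d_z:
  assumes "usmooth (Suc n) V f" "open V"
  shows "usmooth n V (d_z j f)" "usmooth n V (d_zbar j f)"
proof -
  have "usmooth n V (\<lambda>z. 1 / 2 * (partial (XC j) f z + (- \<i>) * partial (YC j) f z))"
    by (intro usmooth_cmult usmooth_add usmooth_partial assms)
  then show "usmooth n V (d_z j f)" by (simp add: d_z_def[abs_def])
  show "usmooth n V (d_zbar j f)"
    unfolding d_zbar_def[abs_def] by (intro usmooth_cmult usmooth_add usmooth_partial assms)
qed

lemma usmooth_multi_deriv:
  assumes D: "\<And>j f. (\<And>n. usmooth n V f) \<Longrightarrow> (\<And>n. usmooth n V (D j f))" and f: "\<And>n. usmooth n V f"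
  shows "usmooth n V (multi_deriv D \<alpha> f)"
proof -
  have pow: "usmooth n V ((D j ^^ m) f)" if "\<And>n. usmooth n V f" for n j m f
    using that by (induction m arbitrary: n) (auto intro: D)
  have "usmooth n V (foldr (\<lambda>j. D j ^^ \<alpha> j) js f)" for n js
  proof (induction js arbitrary: n)
    case (Cons j js)
    then show ?case by (simp add: pow)
  qed (use f in simp)
  then show ?thesis by (simp add: multi_deriv_def)
qed

section \<open>The gradient in l^2 is bounded by the Lipschitz constant\<close>

lemma inner_direction: "direction c \<bullet> direction c' = (if c = c' then 1 else 0)"
proof -
  obtain j where j: "c = XC j \<or> c = YC j" by (cases c) auto
  have "direction c \<bullet> direction c' = (\<Sum>k\<in>{j}. coord (direction c) k \<bullet> coord (direction c') k)"
    unfolding inner_ell2_def by (rule suminf_finite) (use j in auto)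
  then show ?thesis using j by (cases c') auto
qed

lemma norm_direction [simp]: "norm (direction c) = 1"
  by (simp add: norm_eq_sqrt_inner inner_direction)

lemma norm_sum_direction:
  assumes "finite I"
  shows "(norm (\<Sum>c\<in>I. v c *\<^sub>R direction c))\<^sup>2 = (\<Sum>c\<in>I. (v c)\<^sup>2)"
proof -
  have "(norm (\<Sum>c\<in>I. v c *\<^sub>R direction c))\<^sup>2 = (\<Sum>c\<in>I. \<Sum>c'\<in>I. v c * (v c' * (direction c \<bullet> direction c')))"
    by (simp add: power2_norm_eq_inner inner_sum_left inner_sum_right sum_distrib_left mult_ac inner_commute)
  also have "\<dots> = (\<Sum>c\<in>I. \<Sum>c'\<in>I. if c' = c then v c * v c' else 0)"
    by (intro sum.cong refl) (auto simp: inner_direction)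
  also have "\<dots> = (\<Sum>c\<in>I. (v c)\<^sup>2)"
    using assms by (simp add: power2_eq_square)
  finally show ?thesis .
qed

text \<open>Take a step h along the part of the gradient supported in \<open>I\<close>, of norm N.
  To first order the function grows by h N^2, but by the Lipschitz bound at most by K h N; hence N
  is at most K, whatever the finite set \<open>I\<close>.\<close>

lemma gradient_bound_real:
  fixes f :: "ell2 \<Rightarrow> real"
  assumes I: "finite I" and V: "open V" "z \<in> V"
    and P: "\<And>c x. c \<in> I \<Longrightarrow> x \<in> V \<Longrightarrow> ((\<lambda>t. f (x + t *\<^sub>R direction c)) has_real_derivative P c x) (at 0)"
      "\<And>c. c \<in> I \<Longrightarrow> continuous_on V (P c)"
    and K: "r > 0" "K \<ge> 0" "\<And>w. dist w z < r \<Longrightarrow> \<bar>f w - f z\<bar> \<le> K * dist w z"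
  shows "(\<Sum>c\<in>I. (P c z)\<^sup>2) \<le> K\<^sup>2"
proof -
  define N where "N = sqrt (\<Sum>c\<in>I. (P c z)\<^sup>2)"
  define A where "A = (\<Sum>c\<in>I. \<bar>P c z\<bar>)"
  have N: "N \<ge> 0" "N\<^sup>2 = (\<Sum>c\<in>I. (P c z)\<^sup>2)" by (simp_all add: N_def sum_nonneg)
  have A: "A \<ge> 0" "\<And>c. c \<in> I \<Longrightarrow> \<bar>P c z\<bar> \<le> A" 
    using I member_le_sum[of _ I "\<lambda>c. \<bar>P c z\<bar>"] by (simp_all add: A_def sum_nonneg)
  have "N\<^sup>2 \<le> K * N"
  proof (rule field_le_epsilon)
    fix e :: real assume e: "e > 0"
    define \<epsilon> where "\<epsilon> = e / (A + 1)"
    have \<epsilon>: "\<epsilon> > 0" "\<epsilon> * A \<le> e" using e A by (auto simp: \<epsilon>_def field_simps)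
    obtain \<rho> where \<rho>: "\<rho> > 0" "\<And>x v. dist z x < \<rho> \<Longrightarrow> (\<forall>c\<in>I. \<bar>v c\<bar> < \<rho>) \<Longrightarrow>
        \<bar>f (x + (\<Sum>c\<in>I. v c *\<^sub>R direction c)) - f x - (\<Sum>c\<in>I. v c * P c z)\<bar> \<le> \<epsilon> * (\<Sum>c\<in>I. \<bar>v c\<bar>)"
      using C1_expansion[OF I V \<epsilon>(1), of f direction P] P by auto
    \<comment> \<open>The first bound keeps every coefficient of the step within the range of the
      expansion, the second keeps the step inside the ball of radius \<open>r\<close>; halving makes
      both strict.\<close>
    define h0 where "h0 = min (\<rho> / (A + 1)) (r / (N + 1))"
    define h where "h = h0 / 2"
    have "h0 > 0" using \<rho>(1) K(1) A(1) N(1) by (simp add: h0_def)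
    moreover have "h0 * (A + 1) \<le> \<rho>"
      using A(1) by (subst pos_le_divide_eq[symmetric]) (auto simp: h0_def)
    moreover have "h0 * (N + 1) \<le> r"
      using N(1) by (subst pos_le_divide_eq[symmetric]) (auto simp: h0_def)
    ultimately have h: "h > 0" "h * (A + 1) < \<rho>" "h * (N + 1) < r"
      using \<rho>(1) K(1) unfolding h_def times_divide_eq_left by linarith+
    let ?s = "\<Sum>c\<in>I. (h * P c z) *\<^sub>R direction c"
    have "\<bar>h * P c z\<bar> < \<rho>" if "c \<in> I" for c
    proof -
      have "\<bar>h * P c z\<bar> \<le> h * (A + 1)" unfolding abs_mult using h A(2)[OF that] by (intro mult_mono) auto
      then show ?thesis using h by simp
    qed
    then have 1: "\<bar>f (z + ?s) - f z - (\<Sum>c\<in>I. (h * P c z) * P c z)\<bar> \<le> \<epsilon> * (\<Sum>c\<in>I. \<bar>h * P c z\<bar>)"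
      using \<rho> by auto
    have "(norm ?s)\<^sup>2 = (h * N)\<^sup>2"
      unfolding norm_sum_direction[OF I] power_mult_distrib N(2) by (simp add: sum_distrib_left)
    then have ns: "norm ?s = h * N" using h N by (simp add: power2_eq_iff_nonneg)
    then have "norm ?s < r" using h by (simp add: algebra_simps)
    then have 2: "\<bar>f (z + ?s) - f z\<bar> \<le> K * (h * N)" using K(3)[of "z + ?s"] ns by (simp add: dist_norm)
    have "(\<Sum>c\<in>I. (h * P c z) * P c z) = h * N\<^sup>2"
      unfolding N(2) by (simp add: sum_distrib_left power2_eq_square mult.assoc)
    moreover have "(\<Sum>c\<in>I. \<bar>h * P c z\<bar>) = h * A"
      using h by (simp add: A_def abs_mult sum_distrib_left)
    ultimately have "h * N\<^sup>2 \<le> h * (K * N + \<epsilon> * A)" using 1 2 by (simp add: algebra_simps abs_le_iff)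
    then have "N\<^sup>2 \<le> K * N + \<epsilon> * A" using h by simp
    then show "N\<^sup>2 \<le> K * N + e" using \<epsilon> by linarith
  qed
  then have "N \<le> K" using N(1) K(2) by (cases "N = 0") (auto simp: power2_eq_square)
  then show ?thesis using N by (metis power_mono)
qed

text \<open>Real and imaginary parts are bounded separately, whence the factor 2.\<close>

lemma gradient_bound:
  fixes f :: "ell2 \<Rightarrow> complex"
  assumes I: "finite I" and V: "open V" "z \<in> V" and f: "usmooth (Suc 0) V f"
    and K: "r > 0" "K \<ge> 0" "\<And>w. dist w z < r \<Longrightarrow> cmod (f w - f z) \<le> K * dist w z"
  shows "(\<Sum>c\<in>I. (cmod (partial c f z))\<^sup>2) \<le> 2 * K\<^sup>2"
proof -
  have P: "((\<lambda>t. f (x + t *\<^sub>R direction c)) has_vector_derivative partial c f x) (at 0)" if "x \<in> V" for c x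
    using usmooth_partial(2)[OF f V(1) that] by (simp add: has_partial_iff)
  have Pc: "continuous_on V (partial c f)" for c
    using usmooth_partial(1)[OF f V(1)] ulip_continuous[OF _ V(1)] by auto
  have "(\<Sum>c\<in>I. (Re (partial c f z))\<^sup>2) \<le> K\<^sup>2"
  proof (rule gradient_bound_real[OF I V, where f = "\<lambda>z. Re (f z)"])
    show "((\<lambda>t. Re (f (x + t *\<^sub>R direction c))) has_real_derivative Re (partial c f x)) (at 0)" if "x \<in> V" for x c
      using P[OF that, of c] by (simp add: has_vector_derivative_complex_iff)
    show "\<bar>Re (f w) - Re (f z)\<bar> \<le> K * dist w z" if "dist w z < r" for w
      using K(3)[OF that] abs_Re_le_cmod[of "f w - f z"] by simp
  qed (use K Pc in \<open>auto intro: continuous_intros\<close>)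
  moreover have "(\<Sum>c\<in>I. (Im (partial c f z))\<^sup>2) \<le> K\<^sup>2"
  proof (rule gradient_bound_real[OF I V, where f = "\<lambda>z. Im (f z)"])
    show "((\<lambda>t. Im (f (x + t *\<^sub>R direction c))) has_real_derivative Im (partial c f x)) (at 0)" if "x \<in> V" for x c
      using P[OF that, of c] by (simp add: has_vector_derivative_complex_iff)
    show "\<bar>Im (f w) - Im (f z)\<bar> \<le> K * dist w z" if "dist w z < r" for w
      using K(3)[OF that] abs_Im_le_cmod[of "f w - f z"] by simp
  qed (use K Pc in \<open>auto intro: continuous_intros\<close>)
  ultimately show ?thesis by (simp add: cmod_power2 sum.distrib)
qed

lemma usmooth_C1F:
  assumes V: "open V" and f: "usmooth (Suc 0) V f"
  shows "f \<in> C1F V"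
proof -
  have "(SUP z\<in>S. ennreal (cmod (f z)) + (\<Sum>j. ennreal ((cmod (d_z j f z))\<^sup>2 + (cmod (d_zbar j f z))\<^sup>2))) < \<infinity>"
    if S: "uniformly_included S V" for S
  proof -
    obtain K r where K: "r > 0" "K \<ge> 0" "\<And>z. z \<in> S \<Longrightarrow> ball z r \<subseteq> V" "\<And>z. z \<in> S \<Longrightarrow> norm (f z) \<le> K"
      "\<And>z w. z \<in> S \<Longrightarrow> dist w z < r \<Longrightarrow> norm (f w - f z) \<le> K * dist w z"
      by (rule ulipE[OF usmooth_ulip[OF f] V S]) blast
    have "ennreal (cmod (f z)) + (\<Sum>j. ennreal ((cmod (d_z j f z))\<^sup>2 + (cmod (d_zbar j f z))\<^sup>2)) \<le> ennreal K + ennreal (K\<^sup>2)"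
      if z: "z \<in> S" for z
    proof (rule add_mono)
      show "ennreal (cmod (f z)) \<le> ennreal K" using K(4)[OF z] by (rule ennreal_leI)
      have zV: "z \<in> V" using K(1) K(3)[OF z] by auto
      \<comment> \<open>Parallelogram identity; its factor 1/2 cancels the 2 of
        \<open>gradient_bound\<close>.\<close>
      have eq: "(cmod (d_z j f z))\<^sup>2 + (cmod (d_zbar j f z))\<^sup>2
          = 1 / 2 * ((cmod (partial (XC j) f z))\<^sup>2 + (cmod (partial (YC j) f z))\<^sup>2)" for j
        unfolding d_z_def d_zbar_def norm_mult power_mult_distrib cmod_power2
        by (simp add: power2_eq_square field_simps)
      have "(\<Sum>j<n. (cmod (d_z j f z))\<^sup>2 + (cmod (d_zbar j f z))\<^sup>2) \<le> K\<^sup>2" for n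
      proof -
        have "(\<Sum>c\<in>XC ` {..<n} \<union> YC ` {..<n}. (cmod (partial c f z))\<^sup>2) \<le> 2 * K\<^sup>2"
          by (rule gradient_bound[OF _ V zV f K(1,2) K(5)[OF z]]) auto
        also have "(\<Sum>c\<in>XC ` {..<n} \<union> YC ` {..<n}. (cmod (partial c f z))\<^sup>2)
            = (\<Sum>j<n. (cmod (partial (XC j) f z))\<^sup>2) + (\<Sum>j<n. (cmod (partial (YC j) f z))\<^sup>2)"
          by (subst sum.union_disjoint) (auto simp: sum.reindex inj_on_def)
        finally show ?thesis unfolding eq sum_distrib_left[symmetric] sum.distrib by simp
      qed
      then have "(\<Sum>j<n. ennreal ((cmod (d_z j f z))\<^sup>2 + (cmod (d_zbar j f z))\<^sup>2)) \<le> ennreal (K\<^sup>2)" for n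
        by (subst sum_ennreal) (auto intro: ennreal_leI)
      then show "(\<Sum>j. ennreal ((cmod (d_z j f z))\<^sup>2 + (cmod (d_zbar j f z))\<^sup>2)) \<le> ennreal (K\<^sup>2)"
        by (rule suminf_le_const[OF summableI])
    qed
    then have "(SUP z\<in>S. ennreal (cmod (f z)) + (\<Sum>j. ennreal ((cmod (d_z j f z))\<^sup>2 + (cmod (d_zbar j f z))\<^sup>2)))
        \<le> ennreal K + ennreal (K\<^sup>2)"
      by (rule SUP_least)
    also have "\<dots> < \<infinity>" by simp
    finally show ?thesis .
  qed
  moreover have "f \<in> Ck 1 V" using usmooth_Ck[OF f V] by simp
  ultimately show ?thesis by (simp add: C1F_def)
qed

lemma usmooth_CinfFinf:
  assumes V: "open V" and f: "\<And>n. usmooth n V f"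
  shows "f \<in> CinfFinf V"
proof -
  have "multi_deriv d_z \<alpha> (multi_deriv d_zbar \<beta> f) \<in> C1F V" for \<alpha> \<beta>
    by (intro usmooth_C1F[OF V] usmooth_multi_deriv usmooth_d_z V f) auto
  moreover have "f \<in> Cinf V" using usmooth_Ck[OF f V] by (simp add: Cinf_def)
  ultimately show ?thesis by (simp add: CinfFinf_def)
qed

section \<open>Gluing\<close>

text \<open>Average in all coordinate directions with radii whose sum is small. The last property
  concerns a single disc: the smoothing inherits its sub-mean inequality as soon as \<open>F\<close>
  has it on all translates by at most \<open>e\<close>.\<close>

lemma smooth_approximation:
  fixes F :: "ell2 \<Rightarrow> real"
  assumes F: "L-lipschitz_on UNIV F" and e: "e > 0"
  obtains G where "\<And>z. \<bar>G z - F z\<bar> \<le> e" "\<And>V n. open V \<Longrightarrow> usmooth n V G"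
    "\<And>p b. (\<And>x. norm x \<le> e \<Longrightarrow> F (p + x) \<le> circle_mean (\<lambda>\<theta>. F (p + x + ecis \<theta> *\<^sub>C b))) \<Longrightarrow>
       G p \<le> circle_mean (\<lambda>\<theta>. G (p + ecis \<theta> *\<^sub>C b))"
proof -
  have L: "L \<ge> 0" using F by (rule lipschitz_on_nonneg)
  \<comment> \<open>Total averaging radius: \<open>L * e'\<close> bounds the change of
    \<open>F\<close>, and \<open>e' \<le> e\<close> the translations in the sub-mean
    property.\<close>
  define e' where "e' = e / (L + 1)"
  have e': "e' > 0" "L * e' \<le> e" "e' \<le> e"
    using e L by (auto simp: e'_def field_simps)
  define a where "a m = e' * (1 / 2) ^ Suc m" for m
  \<comment> \<open>Even indices enumerate the real directions, odd ones the imaginary directions,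
    so every direction occurs.\<close>
  define d where "d m = direction (if even m then XC (m div 2) else YC (m div 2))" for m
  have sums: "a sums e'"
    using sums_mult[OF power_half_series, of e'] by (simp add: a_def[abs_def])
  have "\<forall>m. \<exists>k. mollifier (a m) k" using mollifier_exists e' by (metis a_def mult_pos_pos zero_less_power half_gt_zero_iff zero_less_one)
  then obtain k where k: "\<And>m. mollifier (a m) (k m)" by metis
  interpret coordinate_averaging d a k F L
    by standard (use sums e' k F in \<open>auto simp: sums_iff d_def a_def\<close>)
  have ul: "ulip V f" if "f \<in> smoothed" "open V" for V f
    using smoothed_lipschitz[OF that(1)] ulip_lipschitz[OF that(2)] by blast
  have sm: "usmooth n V f" if "f \<in> smoothed" "open V" for n V f
    using that(1)
  proof (induction n arbitrary: f)
    case 0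
    then show ?case using ul that(2) by simp
  next
    case (Suc n)
    have "\<exists>g. usmooth n V g \<and> (\<forall>z\<in>V. ((\<lambda>t. f (z + t *\<^sub>R direction c)) has_vector_derivative g z) (at 0))" for c
    proof -
      obtain i where i: "direction c = d i"
      proof (cases c)
        case (XC j)
        then show ?thesis by (intro that[of "2 * j"]) (simp add: d_def)
      next
        case (YC j)
        then show ?thesis by (intro that[of "2 * j + 1"]) (simp add: d_def)
      qed
      obtain g where "g \<in> smoothed" "dir_deriv (d i) f g"
        using smoothed_dir_deriv[OF Suc.prems] by blast
      then show ?thesis
        using Suc.IH[of g] unfolding i dir_deriv_def has_real_derivative_iff_has_vector_derivative by blast
    qed
    then show ?case using ul[OF Suc.prems that(2)] by simp
  qed
  show ?thesis
  proof (rule that[of "tail_avg 0"])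
    show "\<bar>tail_avg 0 z - F z\<bar> \<le> e" for z
      using tail_avg_near[of 0 z 0] e' sums by (simp add: sums_iff)
    show "usmooth n V (tail_avg 0)" if "open V" for V n
      using sm tail_avg_in_smoothed that by blast
    fix p b assume sub: "\<And>x. norm x \<le> e \<Longrightarrow> F (p + x) \<le> circle_mean (\<lambda>\<theta>. F (p + x + ecis \<theta> *\<^sub>C b))"
    show "tail_avg 0 p \<le> circle_mean (\<lambda>\<theta>. tail_avg 0 (p + ecis \<theta> *\<^sub>C b))"
    proof (rule tail_avg_submean)
      show "continuous_on {0..2 * pi} (\<lambda>\<theta>. p + ecis \<theta> *\<^sub>C b)"
        by (intro continuous_intros scaleC.continuous_on)
      show "F (p + y) \<le> circle_mean (\<lambda>\<theta>. F (p + ecis \<theta> *\<^sub>C b + y))" if "norm y \<le> suminf a" for y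
        using sub[of y] that e' sums by (simp add: sums_iff add_ac)
    qed
  qed
qed

text \<open>By Cauchy-Schwarz \<open>norm p\<close> times the norm on the circle is at least the
  inner product with \<open>p\<close>, which is \<open>p \<bullet> p\<close> plus the real part of a
  linear function of the circle variable, of mean 0.\<close>

lemma norm_submean: "norm p \<le> circle_mean (\<lambda>\<theta>. norm (p + ecis \<theta> *\<^sub>C b))"
proof (cases "p = 0")
  case False
  have dec: "(c *\<^sub>C b) \<bullet> p = Re (Complex (b \<bullet> p) (- ((\<i> *\<^sub>C b) \<bullet> p)) * c)" for c
  proof -
    have "c *\<^sub>C b = Re c *\<^sub>R b + Im c *\<^sub>R (\<i> *\<^sub>C b)"
      by (rule ell2_eqI) (simp add: complex_eq_iff)
    then show ?thesis by (simp add: inner_add_left mult.commute)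
  qed
  have "norm p * norm p = circle_mean (\<lambda>\<theta>. p \<bullet> p + Re (Complex (b \<bullet> p) (- ((\<i> *\<^sub>C b) \<bullet> p)) * (0 + of_real 1 * ecis \<theta>)))"
    by (subst circle_mean_add, intro continuous_intros, intro continuous_intros, subst circle_mean_holomorphic)
      (auto simp: holomorphic_intros power2_norm_eq_inner[symmetric] power2_eq_square)
  also have "\<dots> \<le> circle_mean (\<lambda>\<theta>. norm p * norm (p + ecis \<theta> *\<^sub>C b))"
  proof (rule circle_mean_mono)
    show "p \<bullet> p + Re (Complex (b \<bullet> p) (- ((\<i> *\<^sub>C b) \<bullet> p)) * (0 + of_real 1 * ecis \<theta>))
        \<le> norm p * norm (p + ecis \<theta> *\<^sub>C b)" for \<theta>
      using norm_cauchy_schwarz[of "p + ecis \<theta> *\<^sub>C b" p] dec[of "ecis \<theta>"]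
      by (simp add: inner_add_left mult.commute)
  qed (intro continuous_intros scaleC.continuous_on)+
  finally show ?thesis using False by (simp add: circle_mean_cmult)
qed (simp add: norm_scaleC)

text \<open>Cutting the distance off at exp(-(j + 3)) makes the level Lipschitz on the whole space,
  as the averaging needs, and changes nothing in \<open>V\<close> at levels up to j + 3, well above
  the kink j + 1 where the next piece takes over.\<close>

definition truncated_level :: "(ell2 \<Rightarrow> real) \<Rightarrow> nat \<Rightarrow> ell2 \<Rightarrow> real" where
  "truncated_level D j z = max (norm z) (- ln (max (D z) (exp (- (real j + 3)))))"

text \<open>The affine functions \<open>16 (j + 1) t - 8 j (j + 1)\<close> are the pieces of a convex piecewise linear
  function with kinks at the positive integers; the slopes grow so fast that the piece active on
  \<open>[j, j + 1]\<close> dominates all others by a definite margin away from the kinks.\<close>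

definition level_line :: "(ell2 \<Rightarrow> real) \<Rightarrow> nat \<Rightarrow> ell2 \<Rightarrow> real" where
  "level_line D j z = 16 * (real j + 1) * truncated_level D j z - 8 * real j * (real j + 1)"

text \<open>The logarithm is Lipschitz with constant 1/s on [s, \<infinity>), and the truncated
  distance stays at or above s.\<close>

lemma level_line_lipschitz:
  assumes D: "\<And>x y. D x \<le> D y + dist x y"
  shows "\<exists>L. L-lipschitz_on UNIV (level_line D j)"
proof -
  define s where "s = exp (- (real j + 3))"
  have s: "s > 0" by (simp add: s_def)
  have ln_le: "ln x - ln y \<le> \<bar>x - y\<bar> / s" if "x \<ge> s" "y \<ge> s" for x y
  proof -
    have "ln x - ln y = ln (x / y)" using that s by (simp add: ln_div)
    also have "\<dots> \<le> x / y - 1" using that s by (intro ln_le_minus_one) auto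
    also have "\<dots> = (x - y) / y" using that s by (simp add: field_simps)
    also have "\<dots> \<le> \<bar>x - y\<bar> / s" using that s by (intro frac_le) auto
    finally show ?thesis .
  qed
  have dm: "\<bar>max (D x) s - max (D y) s\<bar> \<le> dist x y" for x y
    using D[of x y] D[of y x] by (auto simp: dist_commute max_def abs_if)
  have t: "- ln (max (D x) s) \<le> - ln (max (D y) s) + dist x y / s" for x y
  proof -
    have "ln (max (D y) s) - ln (max (D x) s) \<le> \<bar>max (D y) s - max (D x) s\<bar> / s"
      by (rule ln_le) auto
    also have "\<dots> \<le> dist x y / s" using dm[of y x] s by (intro divide_right_mono) (auto simp: dist_commute)
    finally show ?thesis by simp
  qed
  have n: "norm x \<le> norm y + dist x y" for x y :: ell2
    using norm_triangle_ineq2[of x y] by (simp add: dist_norm)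
  have tl: "truncated_level D j x \<le> truncated_level D j y + (1 + 1 / s) * dist x y" for x y
  proof -
    have "(1 + 1 / s) * dist x y = dist x y + dist x y / s" by (simp add: algebra_simps)
    moreover have "dist x y / s \<ge> 0" using s by simp
    ultimately show ?thesis
      using t[of x y] n[of x y] zero_le_dist[of x y] unfolding truncated_level_def s_def[symmetric] by linarith
  qed
  define c where "c = 16 * (real j + 1)"
  have c: "c \<ge> 0" by (simp add: c_def)
  have "(c * (1 + 1 / s))-lipschitz_on UNIV (level_line D j)"
  proof (rule lipschitz_onI)
    fix x y
    have "\<bar>truncated_level D j x - truncated_level D j y\<bar> \<le> (1 + 1 / s) * dist x y"
      using tl[of x y] tl[of y x] by (simp add: dist_commute abs_le_iff)
    from mult_left_mono[OF this c]
    show "dist (level_line D j x) (level_line D j y) \<le> c * (1 + 1 / s) * dist x y"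
      unfolding level_line_def c_def[symmetric] dist_real_def
      using c by (simp add: right_diff_distrib[symmetric] abs_mult mult.assoc)
  qed (use c s in simp)
  then show ?thesis by blast
qed

text \<open>\<open>D\<close> is the distance to the complement, or 1 on the whole space, which is
  why \<open>D_ball\<close> has the minimum with 1. The radius in \<open>G_submean\<close> is so
  small that translates of a disc at levels up to j + 2 avoid the truncation.\<close>

locale glued_exhaustion =
  fixes V :: "ell2 set" and D :: "ell2 \<Rightarrow> real" and G :: "nat \<Rightarrow> ell2 \<Rightarrow> real" and w w' :: "real \<Rightarrow> real"
  assumes V: "open V"
    and D_lip: "\<And>x y. D x \<le> D y + dist x y"
    and D_pos: "\<And>z. D z > 0 \<longleftrightarrow> z \<in> V"
    and D_ball: "\<And>z r. r > 0 \<Longrightarrow> ball z r \<subseteq> V \<Longrightarrow> min 1 r \<le> D z"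
    and D_submean: "\<And>p b. (\<And>l. cmod l \<le> 1 \<Longrightarrow> p + l *\<^sub>C b \<in> V) \<Longrightarrow>
      - ln (D p) \<le> circle_mean (\<lambda>\<theta>. - ln (D (p + ecis \<theta> *\<^sub>C b)))"
    and G_close: "\<And>j z. \<bar>G j z - level_line D j z\<bar> \<le> 1 / 8"
    and G_smooth: "\<And>j n. usmooth n V (G j)"
    and G_submean: "\<And>j p b. (\<And>x. norm x \<le> exp (- (real j + 3)) / 2 \<Longrightarrow>
      level_line D j (p + x) \<le> circle_mean (\<lambda>\<theta>. level_line D j (p + x + ecis \<theta> *\<^sub>C b))) \<Longrightarrow>
      G j p \<le> circle_mean (\<lambda>\<theta>. G j (p + ecis \<theta> *\<^sub>C b))"
    and w_smooth: "\<And>n. Cn n w" and w_deriv: "\<And>x. (w has_real_derivative w' x) (at x)"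
    and w': "\<And>x. 0 \<le> w' x" "\<And>x. w' x \<le> 1" "mono w'"
    and w_low: "\<And>x. x \<le> -2 \<Longrightarrow> w x = 0" and w_high: "\<And>x. x \<ge> 2 \<Longrightarrow> w x = x"
    and w_ge: "\<And>x. w x \<ge> 0" "\<And>x. w x \<ge> x"
begin

definition lev :: "ell2 \<Rightarrow> real" where
  "lev z = max (norm z) (- ln (D z))"

text \<open>Formally a telescoping sum: at levels above \<open>j + 5/4\<close> the \<open>j\<close>-th summand is
  \<open>G (j + 1) - G j\<close>, at levels below \<open>j + 3/4\<close> it vanishes.\<close>

definition exh :: "ell2 \<Rightarrow> real" where
  "exh z = G 0 z + (\<Sum>j. w (G (Suc j) z - G j z))"

lemma lev_nonneg: "lev z \<ge> 0"
  by (simp add: lev_def le_max_iff_disj)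

lemma D_continuous: "continuous_on A D"
proof -
  have "1-lipschitz_on A D"
  proof (rule lipschitz_onI)
    show "dist (D x) (D y) \<le> 1 * dist x y" for x y
      using D_lip[of x y] D_lip[of y x] by (simp add: dist_real_def abs_le_iff dist_commute)
  qed simp
  then show ?thesis by (rule lipschitz_on_continuous_on)
qed

lemma lev_continuous: "continuous_on V lev"
  unfolding lev_def[abs_def]
  using D_pos by (intro continuous_intros D_continuous) force

lemma open_sublevel: "open {z \<in> V. lev z < t}" "open {z \<in> V. s < lev z \<and> lev z < t}"
proof -
  have "open (V \<inter> lev -` {..<t})" "open (V \<inter> lev -` {s<..<t})"
    by (intro continuous_open_preimage[OF lev_continuous V] open_lessThan open_greaterThanLessThan)+
  moreover have "V \<inter> lev -` {..<t} = {z \<in> V. lev z < t}" "V \<inter> lev -` {s<..<t} = {z \<in> V. s < lev z \<and> lev z < t}"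
    by auto
  ultimately show "open {z \<in> V. lev z < t}" "open {z \<in> V. s < lev z \<and> lev z < t}" by simp_all
qed

lemma D_ge_of_lev:
  assumes "z \<in> V" "lev z \<le> t"
  shows "exp (- t) \<le> D z"
proof -
  have "- ln (D z) \<le> t" using assms by (simp add: lev_def)
  then have "exp (- t) \<le> exp (ln (D z))" by simp
  then show ?thesis using assms D_pos by simp
qed

lemma truncated_level_eq:
  assumes "z \<in> V" "lev z \<le> real j + 3"
  shows "truncated_level D j z = lev z"
  using D_ge_of_lev[OF assms] by (simp add: truncated_level_def lev_def max_absorb1)

lemma truncated_level_ge:
  assumes "z \<in> V"
  shows "min (lev z) (real j + 3) \<le> truncated_level D j z"
proof (cases "D z \<ge> exp (- (real j + 3))")
  case True
  then show ?thesis by (simp add: truncated_level_def lev_def max_absorb1)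
next
  case False
  then have "truncated_level D j z = max (norm z) (real j + 3)" by (simp add: truncated_level_def max_absorb2)
  then show ?thesis by simp
qed

lemma truncated_level_mono:
  assumes "z \<in> V"
  shows "truncated_level D j z \<le> truncated_level D (Suc j) z"
proof -
  have "max (D z) (exp (- (real (Suc j) + 3))) \<le> max (D z) (exp (- (real j + 3)))"
    by (intro max.mono) auto
  then have "ln (max (D z) (exp (- (real (Suc j) + 3)))) \<le> ln (max (D z) (exp (- (real j + 3))))"
    by (subst ln_le_cancel_iff) (simp_all only: less_max_iff_disj exp_gt_zero simp_thms)
  then show ?thesis unfolding truncated_level_def by linarith
qed

lemma G_bounds: "level_line D j z - 1 / 8 \<le> G j z" "G j z \<le> level_line D j z + 1 / 8"
  using abs_le_D1[OF G_close[of j z]] abs_le_D2[OF G_close[of j z]] by linarith+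

text \<open>Neighbouring lines differ by 16 times \<open>lev z - (j + 1)\<close>, at most -4 here;
  smoothing costs at most 1/4.\<close>

lemma G_below:
  assumes "z \<in> V" "lev z \<le> real j + 3 / 4"
  shows "G (Suc j) z - G j z \<le> -2"
proof -
  have "level_line D (Suc j) z - level_line D j z = 16 * lev z - 16 * (real j + 1)"
    using assms by (simp add: level_line_def truncated_level_eq algebra_simps)
  then show ?thesis using assms G_bounds[of "Suc j" z] G_bounds[of j z] by argo
qed

text \<open>The truncations may be active at these levels. They are monotone in \<open>j\<close>, so
  the difference is still at least 16 times the \<open>j\<close>-th truncated level minus 16 (j +
  1), hence at least 4.\<close>

lemma G_above:
  assumes "z \<in> V" "lev z \<ge> real j + 5 / 4"
  shows "G (Suc j) z - G j z \<ge> 2"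
proof -
  have "truncated_level D j z \<ge> real j + 5 / 4"
    using truncated_level_ge[OF assms(1), of j] assms(2) by simp
  moreover have "(real j + 2) * truncated_level D j z \<le> (real j + 2) * truncated_level D (Suc j) z"
    by (intro mult_left_mono truncated_level_mono assms) auto
  ultimately have "level_line D (Suc j) z - level_line D j z \<ge> 4"
    by (simp add: level_line_def algebra_simps)
  then show ?thesis using G_bounds[of "Suc j" z] G_bounds[of j z] by argo
qed

lemma exh_finite:
  assumes "z \<in> V" "lev z \<le> real n + 7 / 4"
  shows "exh z = G 0 z + (\<Sum>j<Suc n. w (G (Suc j) z - G j z))"
proof -
  have "w (G (Suc j) z - G j z) = 0" if "j \<notin> {..<Suc n}" for j
    by (rule w_low, rule G_below) (use assms that in auto)
  then show ?thesis unfolding exh_def by (subst suminf_finite[of "{..<Suc n}"]) auto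
qed

text \<open>Above n + 1/4 the summands below \<open>n\<close> are exact differences and telescope to
  \<open>G n\<close>; below n + 7/4 those beyond \<open>n\<close> vanish. What remains is the
  regularized maximum of two pieces. Consecutive windows overlap.\<close>

lemma exh_local:
  assumes "z \<in> V" "n = 0 \<or> real n + 1 / 4 \<le> lev z" "lev z \<le> real n + 7 / 4"
  shows "exh z = G n z + w (G (Suc n) z - G n z)"
proof -
  have "(\<Sum>j<n. w (G (Suc j) z - G j z)) = (\<Sum>j<n. G (Suc j) z - G j z)"
  proof (intro sum.cong refl w_high G_above assms)
    fix j assume "j \<in> {..<n}"
    then show "real j + 5 / 4 \<le> lev z" using assms by auto
  qed
  then show ?thesis
    using exh_finite[OF assms(1,3)] sum_lessThan_telescope[of "\<lambda>j. G j z" n] by simp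
qed

lemma exh_ge_G:
  assumes "z \<in> V"
  shows "exh z \<ge> G n z"
proof -
  obtain N where "lev z \<le> real N" using real_arch_simple by blast
  then have "exh z = G 0 z + (\<Sum>j<Suc (N + n). w (G (Suc j) z - G j z))"
    by (intro exh_finite assms) simp
  moreover have "(\<Sum>j<n. w (G (Suc j) z - G j z)) \<le> (\<Sum>j<Suc (N + n). w (G (Suc j) z - G j z))"
    by (intro sum_mono2) (auto intro: w_ge)
  moreover have "(\<Sum>j<n. G (Suc j) z - G j z) \<le> (\<Sum>j<n. w (G (Suc j) z - G j z))"
    by (intro sum_mono w_ge)
  ultimately show ?thesis using sum_lessThan_telescope[of "\<lambda>j. G j z" n] by linarith
qed

lemma exh_ge_lev:
  assumes "z \<in> V"
  shows "lev z - 1 \<le> exh z"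
proof -
  define n where "n = nat \<lfloor>lev z\<rfloor>"
  have n: "real n \<le> lev z" "lev z \<le> real n + 1"
    using lev_nonneg[of z] by (auto simp: n_def)
  \<comment> \<open>At level t the n-th line is 8 (n + 1) (2 t - n), and 2 t - n is at least t since
    n is at most t.\<close>
  have "1 * lev z \<le> 8 * (real n + 1) * (2 * lev z - real n)"
    using n lev_nonneg[of z] by (intro mult_mono) auto
  also have "\<dots> = level_line D n z"
    using n by (simp add: level_line_def truncated_level_eq[OF assms] algebra_simps)
  finally show ?thesis using exh_ge_G[OF assms, of n] G_bounds[of n z] by linarith
qed

lemma exhaustion_function_exh: "exhaustion_function V exh"
  unfolding exhaustion_function_def uniformly_included_iff[OF V]
proof (intro allI conjI)
  fix t
  have lev: "lev z \<le> t + 1" if "z \<in> V" "exh z \<le> t" for z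
    using exh_ge_lev[OF that(1)] that(2) by linarith
  then show "bounded {z \<in> V. exh z \<le> t}"
    by (auto simp: bounded_iff lev_def intro!: exI[of _ "t + 1"])
  have "ball z (exp (- (t + 1))) \<subseteq> V" if "z \<in> V" "exh z \<le> t" for z
  proof
    fix y assume "y \<in> ball z (exp (- (t + 1)))"
    then have "dist z y < D z" using D_ge_of_lev[OF that(1) lev[OF that]] by simp
    then have "D y > 0" using D_lip[of z y] by linarith
    then show "y \<in> V" by (simp add: D_pos)
  qed
  then show "\<exists>r>0. \<forall>z\<in>{z \<in> V. exh z \<le> t}. ball z r \<subseteq> V"
    by (intro exI[of _ "exp (- (t + 1))"]) auto
qed

lemma usmooth_sum:
  fixes n :: nat
  shows "(\<And>j. j < n \<Longrightarrow> usmooth m V (f j)) \<Longrightarrow> usmooth m V (\<lambda>z. \<Sum>j<n. (f j z :: real))"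
  by (induction n) (auto intro!: usmooth_const usmooth_add V)

lemma usmooth_exh: "usmooth m V exh"
proof (rule usmooth_local[OF V])
  fix S assume "uniformly_included S V"
  then obtain B r where B: "\<And>z. z \<in> S \<Longrightarrow> norm z \<le> B" and r: "r > 0" "\<And>z. z \<in> S \<Longrightarrow> ball z r \<subseteq> V"
    unfolding uniformly_included_iff[OF V] bounded_iff by blast
  \<comment> \<open>Half the radius: \<open>D\<close> is at least \<open>2 * \<rho>\<close> at
    points of \<open>S\<close>, hence still at least \<open>\<rho>\<close> on the balls of radius
    \<open>\<rho>\<close> about them.\<close>
  define \<rho> where "\<rho> = min 1 r / 2"
  have \<rho>: "\<rho> > 0" "\<rho> \<le> 1" "\<rho> \<le> r" using r by (auto simp: \<rho>_def)
  obtain n where n: "max (B + 1) (- ln \<rho>) \<le> real n" using real_arch_simple by blast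
  define W where "W = {z \<in> V. lev z < real n + 7 / 4}"
  have "ball z \<rho> \<subseteq> W" if "z \<in> S" for z
  proof
    fix y assume y: "y \<in> ball z \<rho>"
    have "norm y \<le> B + 1"
      using y B[OF that] \<rho> norm_triangle_ineq2[of y z] by (simp add: dist_norm norm_minus_commute)
    moreover have "D y \<ge> \<rho>"
    proof -
      have "2 * \<rho> \<le> D z" using D_ball[OF r(1) r(2)[OF that]] by (simp add: \<rho>_def)
      moreover have "dist z y < \<rho>" using y by simp
      ultimately show ?thesis using D_lip[of z y] by linarith
    qed
    then have "- ln (D y) \<le> - ln \<rho>" using \<rho> by (subst neg_le_iff_le, subst ln_le_cancel_iff) auto
    moreover have "y \<in> V" using y r(2)[OF that] \<rho> by auto
    ultimately show "y \<in> W" using n by (simp add: W_def lev_def)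
  qed
  moreover have "exh z = G 0 z + (\<Sum>j<Suc n. w (G (Suc j) z + (-1) * G j z))" if "z \<in> W" for z
    using exh_finite[of z n] that by (simp add: W_def)
  moreover have "usmooth m V (\<lambda>z. G 0 z + (\<Sum>j<Suc n. w (G (Suc j) z + (-1) * G j z)))"
  proof (intro usmooth_add usmooth_sum V G_smooth)
    show "usmooth m V (\<lambda>z. w (G (Suc j) z + (-1) * G j z))" for j
      by (rule usmooth_compose[OF _ V w_smooth])
        (intro usmooth_add usmooth_mult usmooth_const V G_smooth)
  qed
  moreover have "open W" "W \<subseteq> V" unfolding W_def by (rule open_sublevel, auto)
  ultimately show "\<exists>W g. usmooth m V g \<and> open W \<and> W \<subseteq> V \<and> (\<exists>r>0. \<forall>z\<in>S. ball z r \<subseteq> W) \<and> (\<forall>z\<in>W. exh z = g z)"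
    using \<rho>(1) by (intro exI[of _ W] exI[of _ "\<lambda>z. G 0 z + (\<Sum>j<Suc n. w (G (Suc j) z + (-1) * G j z))"]) blast
qed

text \<open>Off the truncation the level is the maximum of two functions with the sub-mean property,
  and the line has positive slope.\<close>

lemma level_line_submean:
  assumes disc: "\<And>l. cmod l \<le> 1 \<Longrightarrow> exp (- (real j + 3)) < D (p + l *\<^sub>C b)"
  shows "level_line D j p \<le> circle_mean (\<lambda>\<theta>. level_line D j (p + ecis \<theta> *\<^sub>C b))"
proof -
  have inV: "p + l *\<^sub>C b \<in> V" if "cmod l \<le> 1" for l
    using disc[OF that] exp_gt_zero[of "- (real j + 3)"] D_pos by (metis less_trans)
  have eq: "truncated_level D j (p + l *\<^sub>C b) = lev (p + l *\<^sub>C b)" if "cmod l \<le> 1" for l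
    using disc[OF that] by (simp add: truncated_level_def lev_def max_absorb1)
  have pc: "continuous_on A (\<lambda>\<theta>. p + ecis \<theta> *\<^sub>C b)" for A
    by (intro continuous_intros scaleC.continuous_on)
  have lc: "continuous_on A (\<lambda>\<theta>. lev (p + ecis \<theta> *\<^sub>C b))" for A
    by (rule continuous_on_compose2[OF lev_continuous pc]) (use inV in auto)
  have dc: "continuous_on A (\<lambda>\<theta>. - ln (D (p + ecis \<theta> *\<^sub>C b)))" for A
  proof (intro continuous_intros continuous_on_compose2[OF D_continuous pc])
    have "D (p + ecis \<theta> *\<^sub>C b) > 0" for \<theta> using inV[of "ecis \<theta>"] by (simp add: D_pos)
    then show "\<forall>\<theta>\<in>A. D (p + ecis \<theta> *\<^sub>C b) \<noteq> 0" by (metis less_irrefl)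
  qed auto
  have "norm p \<le> circle_mean (\<lambda>\<theta>. norm (p + ecis \<theta> *\<^sub>C b))" by (rule norm_submean)
  also have "\<dots> \<le> circle_mean (\<lambda>\<theta>. lev (p + ecis \<theta> *\<^sub>C b))"
    by (rule circle_mean_mono[OF _ lc]) (auto simp: lev_def intro!: continuous_intros pc)
  finally have 1: "norm p \<le> circle_mean (\<lambda>\<theta>. lev (p + ecis \<theta> *\<^sub>C b))" .
  have "- ln (D p) \<le> circle_mean (\<lambda>\<theta>. - ln (D (p + ecis \<theta> *\<^sub>C b)))" by (rule D_submean[OF inV])
  also have "\<dots> \<le> circle_mean (\<lambda>\<theta>. lev (p + ecis \<theta> *\<^sub>C b))"
    by (rule circle_mean_mono[OF dc lc]) (simp add: lev_def)
  finally have "lev p \<le> circle_mean (\<lambda>\<theta>. lev (p + ecis \<theta> *\<^sub>C b))" using 1 by (simp add: lev_def)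
  then have "16 * (real j + 1) * lev p - 8 * real j * (real j + 1)
      \<le> 16 * (real j + 1) * circle_mean (\<lambda>\<theta>. lev (p + ecis \<theta> *\<^sub>C b)) - 8 * real j * (real j + 1)"
    by (intro diff_right_mono mult_left_mono) auto
  also have "\<dots> = circle_mean (\<lambda>\<theta>. 16 * (real j + 1) * lev (p + ecis \<theta> *\<^sub>C b) - 8 * real j * (real j + 1))"
    by (subst circle_mean_diff) (auto simp: circle_mean_cmult intro!: continuous_intros lc)
  finally show ?thesis using eq[of 0] eq by (simp add: level_line_def)
qed

text \<open>Since exp 1 is at least 2, \<open>D\<close> is at least 2 exp(-(j + 3)) on the disc;
  translations by half of exp(-(j + 3)) leave it above the truncation threshold. The bound j + 2
  suffices for both pieces active in a window ending at n + 7/4.\<close>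

lemma G_submean_local:
  assumes disc: "\<And>l. cmod l \<le> 1 \<Longrightarrow> p + l *\<^sub>C b \<in> V \<and> lev (p + l *\<^sub>C b) \<le> real j + 2"
  shows "G j p \<le> circle_mean (\<lambda>\<theta>. G j (p + ecis \<theta> *\<^sub>C b))"
proof (rule G_submean, rule level_line_submean)
  fix x :: ell2 and l
  assume x: "norm x \<le> exp (- (real j + 3)) / 2" and l: "cmod l \<le> 1"
  have "D (p + l *\<^sub>C b) \<le> D (p + x + l *\<^sub>C b) + norm x"
    using D_lip[of "p + l *\<^sub>C b" "p + x + l *\<^sub>C b"] by (simp add: dist_norm)
  moreover have "exp (- (real j + 2)) \<le> D (p + l *\<^sub>C b)"
    by (rule D_ge_of_lev) (use disc[OF l] in auto)
  moreover have "2 * exp (- (real j + 3)) \<le> exp (- (real j + 2))"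
  proof -
    have "2 * exp (- (real j + 3)) \<le> exp 1 * exp (- (real j + 3))"
      using exp_ge_add_one_self[of 1] by (intro mult_right_mono) auto
    also have "\<dots> = exp (- (real j + 2))" by (simp add: exp_add[symmetric])
    finally show ?thesis .
  qed
  ultimately show "exp (- (real j + 3)) < D (p + x + l *\<^sub>C b)"
    using x exp_gt_zero[of "- (real j + 3)"] by linarith
qed

lemma w_tangent: "w x + w' x * (y - x) \<le> w y"
proof (cases x y rule: linorder_cases)
  case less
  then obtain z where "x < z" "w y - w x = (y - x) * w' z"
    using MVT2[of x y w w'] w_deriv by blast
  moreover have "(y - x) * w' x \<le> (y - x) * w' z"
    using less \<open>x < z\<close> monoD[OF w'(3), of x z] by (intro mult_left_mono) auto
  ultimately show ?thesis by (simp add: mult.commute)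
next
  case greater
  then obtain z where "z < x" "w x - w y = (x - y) * w' z"
    using MVT2[of y x w w'] w_deriv by blast
  moreover have "(x - y) * w' z \<le> (x - y) * w' x"
    using greater \<open>z < x\<close> monoD[OF w'(3), of z x] by (intro mult_left_mono) auto
  ultimately show ?thesis by (simp add: algebra_simps)
qed simp

text \<open>The tangent to \<open>w\<close> at the value of the centre has slope \<open>q\<close> in
  [0, 1]. It gives a minorant of \<open>exh\<close>, a convex combination of \<open>G n\<close> and
  \<open>G (Suc n)\<close> plus a constant, that is exact at the centre and has the sub-mean
  property.\<close>

lemma exh_submean_local:
  assumes disc: "\<And>l. cmod l \<le> 1 \<Longrightarrow> p + l *\<^sub>C b \<in> V \<and> (n = 0 \<or> real n + 1 / 4 < lev (p + l *\<^sub>C b)) \<and>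
      lev (p + l *\<^sub>C b) < real n + 7 / 4"
  shows "exh p \<le> circle_mean (\<lambda>\<theta>. exh (p + ecis \<theta> *\<^sub>C b))"
proof -
  define q where "q = w' (G (Suc n) p - G n p)"
  have q: "0 \<le> q" "q \<le> 1" using w' by (auto simp: q_def)
  have eq: "exh (p + l *\<^sub>C b) = G n (p + l *\<^sub>C b) + w (G (Suc n) (p + l *\<^sub>C b) - G n (p + l *\<^sub>C b))"
    if "cmod l \<le> 1" for l
    using disc[OF that] by (intro exh_local) auto
  let ?K = "w (G (Suc n) p - G n p) - q * (G (Suc n) p - G n p)"
  have pc: "continuous_on A (\<lambda>\<theta>. p + ecis \<theta> *\<^sub>C b)" for A
    by (intro continuous_intros scaleC.continuous_on)
  have Gc: "continuous_on A (\<lambda>\<theta>. G j (p + ecis \<theta> *\<^sub>C b))" for A j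
    by (rule continuous_on_compose2[OF ulip_continuous[OF usmooth_ulip[OF G_smooth[of 0]] V] pc])
      (use disc in auto)
  have ec: "continuous_on A (\<lambda>\<theta>. exh (p + ecis \<theta> *\<^sub>C b))" for A
    by (rule continuous_on_compose2[OF ulip_continuous[OF usmooth_ulip[OF usmooth_exh[of 0]] V] pc])
      (use disc in auto)
  have G: "G n p \<le> circle_mean (\<lambda>\<theta>. G n (p + ecis \<theta> *\<^sub>C b))"
    "G (Suc n) p \<le> circle_mean (\<lambda>\<theta>. G (Suc n) (p + ecis \<theta> *\<^sub>C b))"
    using disc by (intro G_submean_local; fastforce)+
  have "exh p = (1 - q) * G n p + (q * G (Suc n) p + ?K)"
    using eq[of 0] by (simp add: algebra_simps)
  also have "\<dots> \<le> (1 - q) * circle_mean (\<lambda>\<theta>. G n (p + ecis \<theta> *\<^sub>C b))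
      + (q * circle_mean (\<lambda>\<theta>. G (Suc n) (p + ecis \<theta> *\<^sub>C b)) + ?K)"
    using q G by (intro add_mono mult_left_mono) auto
  also have "\<dots> = circle_mean (\<lambda>\<theta>. (1 - q) * G n (p + ecis \<theta> *\<^sub>C b) + (q * G (Suc n) (p + ecis \<theta> *\<^sub>C b) + ?K))"
    by (subst circle_mean_add, (intro continuous_intros Gc)+, subst circle_mean_add, (intro continuous_intros Gc)+)
      (simp add: circle_mean_cmult)
  also have "\<dots> \<le> circle_mean (\<lambda>\<theta>. exh (p + ecis \<theta> *\<^sub>C b))"
  proof (rule circle_mean_mono[OF _ ec])
    show "continuous_on {0..2 * pi} (\<lambda>\<theta>. (1 - q) * G n (p + ecis \<theta> *\<^sub>C b) + (q * G (Suc n) (p + ecis \<theta> *\<^sub>C b) + ?K))"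
      by (intro continuous_intros Gc)
    show "(1 - q) * G n (p + ecis \<theta> *\<^sub>C b) + (q * G (Suc n) (p + ecis \<theta> *\<^sub>C b) + ?K) \<le> exh (p + ecis \<theta> *\<^sub>C b)" for \<theta>
      using w_tangent[of "G (Suc n) p - G n p" "G (Suc n) (p + ecis \<theta> *\<^sub>C b) - G n (p + ecis \<theta> *\<^sub>C b)"] eq[of "ecis \<theta>"]
      by (simp add: q_def[symmetric] algebra_simps)
  qed
  finally show ?thesis .
qed

text \<open>A given disc may cross many windows, while the sub-mean inequality is known inside one
  window only; small circles and \<open>local_submean_imp_submean\<close> bridge the
  difference.\<close>

lemma plurisubharmonic_exh: "plurisubharmonic_on UNIV V exh"
proof -
  have ec: "continuous_on V exh"
    by (rule ulip_continuous[OF usmooth_ulip[OF usmooth_exh[of 0]] V])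
  have "exh a \<le> circle_mean (\<lambda>\<theta>. exh (a + ecis \<theta> *\<^sub>C b))" if disc: "\<And>l. cmod l \<le> 1 \<Longrightarrow> a + l *\<^sub>C b \<in> V" for a b
  proof -
    have "(\<lambda>l. exh (a + l *\<^sub>C b)) 0 \<le> circle_mean (\<lambda>\<theta>. (\<lambda>l. exh (a + l *\<^sub>C b)) (ecis \<theta>))"
    proof (rule local_submean_imp_submean)
      show "continuous_on (cball 0 1) (\<lambda>l. exh (a + l *\<^sub>C b))"
        by (rule continuous_on_compose2[OF ec]) (use disc in \<open>auto intro!: continuous_intros scaleC.continuous_on\<close>)
      fix z :: complex assume "cmod z < 1"
      define p where "p = a + z *\<^sub>C b"
      have p: "p \<in> V" using disc \<open>cmod z < 1\<close> by (simp add: p_def)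
      \<comment> \<open>Subtracting 1/2 places the level in [n + 1/2, n + 3/2), strictly inside the
        n-th window; levels below 1/2 go to n = 0, whose window has no lower end.\<close>
      define n where "n = nat \<lfloor>lev p - 1 / 2\<rfloor>"
      have n: "n = 0 \<or> real n + 1 / 4 < lev p" "lev p < real n + 7 / 4"
        unfolding n_def by linarith+
      define W where "W = (if n = 0 then {z \<in> V. lev z < real n + 7 / 4}
        else {z \<in> V. real n + 1 / 4 < lev z \<and> lev z < real n + 7 / 4})"
      have "open W" unfolding W_def by (simp only: open_sublevel split: if_split) blast
      moreover have "p \<in> W" using n p by (auto simp: W_def)
      ultimately obtain \<rho> where \<rho>: "\<rho> > 0" "ball p \<rho> \<subseteq> W" using open_contains_ball by blast
      have W: "y \<in> V \<and> (n = 0 \<or> real n + 1 / 4 < lev y) \<and> lev y < real n + 7 / 4" if "y \<in> W" for y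
        using that by (auto simp: W_def split: if_splits)
      show "\<exists>r0>0. \<forall>r. 0 < r \<and> r < r0 \<longrightarrow>
          exh (a + z *\<^sub>C b) \<le> circle_mean (\<lambda>\<theta>. exh (a + (z + of_real r * ecis \<theta>) *\<^sub>C b))"
      proof (intro exI[of _ "\<rho> / (norm b + 1)"] conjI allI impI)
        show "\<rho> / (norm b + 1) > 0" using \<rho> by (simp add: add_nonneg_pos)
        fix r assume r: "0 < r \<and> r < \<rho> / (norm b + 1)"
        have "r * (norm b + 1) < \<rho>"
          using r by (subst pos_less_divide_eq[symmetric]) (auto simp: add_nonneg_pos)
        then have rb: "r * norm b < \<rho>" using r by (simp add: algebra_simps)
        have "p + l *\<^sub>C (of_real r *\<^sub>C b) \<in> ball p \<rho>" if "cmod l \<le> 1" for l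
        proof -
          have "norm (l *\<^sub>C (of_real r *\<^sub>C b)) = cmod l * (r * norm b)" using r by (simp add: norm_scaleC del: ell2.scale_scale)
          also have "\<dots> \<le> 1 * (r * norm b)" using that r by (intro mult_right_mono) auto
          finally show ?thesis using rb by (simp add: dist_norm del: ell2.scale_scale)
        qed
        then have "exh p \<le> circle_mean (\<lambda>\<theta>. exh (p + ecis \<theta> *\<^sub>C (of_real r *\<^sub>C b)))"
          using W \<rho>(2) by (intro exh_submean_local[of p _ n]) blast
        moreover have "p + ecis \<theta> *\<^sub>C (of_real r *\<^sub>C b) = a + (z + of_real r * ecis \<theta>) *\<^sub>C b" for \<theta>
          unfolding p_def by (rule ell2_eqI) (simp add: algebra_simps)
        ultimately show "exh (a + z *\<^sub>C b) \<le> circle_mean (\<lambda>\<theta>. exh (a + (z + of_real r * ecis \<theta>) *\<^sub>C b))"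
          unfolding p_def[symmetric] by (simp only:)
      qed
    qed
    then show ?thesis by simp
  qed
  with ec show ?thesis
    unfolding plurisubharmonic_on_def by (auto simp: circle_mean_def)
qed

end

theorem theorem5p1:
  fixes V :: "ell2 set"
  assumes "V \<noteq> {}" and "open V"
    and "pseudoconvex_domain V"
  shows "\<exists>\<eta> :: ell2 \<Rightarrow> real.
           exhaustion_function V \<eta> \<and>
           (\<lambda>z. complex_of_real (\<eta> z)) \<in> CinfFinf V \<and>
           (\<lambda>z. complex_of_real (\<eta> z)) \<in> Ck 2 V \<and>
           plurisubharmonic_on UNIV V \<eta>"
proof -
  \<comment> \<open>The infimum distance to the empty set is 0 by convention, so the whole space
    gets the constant 1, whose logarithm vanishes.\<close>
  define D where "D z = (if V = UNIV then 1 else infdist z (- V))" for z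
  have D_lip: "D x \<le> D y + dist x y" for x y
    using infdist_triangle[of x "- V" y] by (simp add: D_def)
  have "\<exists>G. (\<forall>z. \<bar>G z - level_line D j z\<bar> \<le> 1 / 8) \<and> (\<forall>n. usmooth n V G) \<and>
      (\<forall>p b. (\<forall>x. norm x \<le> exp (- (real j + 3)) / 2 \<longrightarrow>
        level_line D j (p + x) \<le> circle_mean (\<lambda>\<theta>. level_line D j (p + x + ecis \<theta> *\<^sub>C b))) \<longrightarrow>
        G p \<le> circle_mean (\<lambda>\<theta>. G (p + ecis \<theta> *\<^sub>C b)))" for j
  proof -
    obtain L where "L-lipschitz_on UNIV (level_line D j)" using level_line_lipschitz[OF D_lip] by blast
    \<comment> \<open>The same number serves as accuracy of the approximation, 1/8 for the gluing
      margin, and as bound for the translations, which must not reach the truncation.\<close>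
    moreover have "min (1 / 8) (exp (- (real j + 3)) / 2) > 0" by simp
    ultimately obtain G where G: "\<And>z. \<bar>G z - level_line D j z\<bar> \<le> min (1 / 8) (exp (- (real j + 3)) / 2)"
      "\<And>V n. open V \<Longrightarrow> usmooth n V G"
      "\<And>p b. (\<And>x. norm x \<le> min (1 / 8) (exp (- (real j + 3)) / 2) \<Longrightarrow>
        level_line D j (p + x) \<le> circle_mean (\<lambda>\<theta>. level_line D j (p + x + ecis \<theta> *\<^sub>C b))) \<Longrightarrow>
        G p \<le> circle_mean (\<lambda>\<theta>. G (p + ecis \<theta> *\<^sub>C b))"
      by (rule smooth_approximation) blast
    show ?thesis
    proof (intro exI[of _ G] conjI allI impI)
      show "\<bar>G z - level_line D j z\<bar> \<le> 1 / 8" for z using G(1)[of z] by simp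
      show "usmooth n V G" for n using G(2) assms(2) .
    qed (use G(3) in simp)
  qed
  then obtain G where G: "\<And>j z. \<bar>G j z - level_line D j z\<bar> \<le> 1 / 8" "\<And>j n. usmooth n V (G j)"
    "\<And>j p b. (\<And>x. norm x \<le> exp (- (real j + 3)) / 2 \<Longrightarrow>
        level_line D j (p + x) \<le> circle_mean (\<lambda>\<theta>. level_line D j (p + x + ecis \<theta> *\<^sub>C b))) \<Longrightarrow>
        G j p \<le> circle_mean (\<lambda>\<theta>. G j (p + ecis \<theta> *\<^sub>C b))"
    by metis
  obtain w w' where w: "\<And>n. Cn n w" "\<And>x. (w has_real_derivative w' x) (at x)"
    "\<And>x. 0 \<le> w' x" "\<And>x. w' x \<le> 1" "mono w'"
    "\<And>x. x \<le> -2 \<Longrightarrow> w x = 0" "\<And>x. x \<ge> 2 \<Longrightarrow> w x = x" "\<And>x. w x \<ge> 0" "\<And>x. w x \<ge> x"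
    using smooth_positive_part by metis
  interpret glued_exhaustion V D G w w'
  proof
    show "D z > 0 \<longleftrightarrow> z \<in> V" for z
    proof (cases "V = UNIV")
      case False
      then have "closed (- V)" "- V \<noteq> {}" using assms by auto
      from in_closed_iff_infdist_zero[OF this, of z] show ?thesis
        using False infdist_nonneg[of z "- V"] by (auto simp: D_def)
    qed (simp add: D_def)
    show "min 1 r \<le> D z" if "r > 0" "ball z r \<subseteq> V" for z r
    proof (cases "V = UNIV")
      case False
      then have ne: "- V \<noteq> {}" by auto
      have "r \<le> (INF a\<in>- V. dist z a)"
        by (rule cINF_greatest[OF ne]) (use that in force)
      then show ?thesis using False ne by (simp add: D_def infdist_notempty)
    qed (simp add: D_def)
    show "- ln (D p) \<le> circle_mean (\<lambda>\<theta>. - ln (D (p + ecis \<theta> *\<^sub>C b)))"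
      if "\<And>l. cmod l \<le> 1 \<Longrightarrow> p + l *\<^sub>C b \<in> V" for p b
      using neg_ln_boundary_distance_submean[OF assms(3) _ that] by (cases "V = UNIV") (auto simp: D_def)
  qed (use assms(2) D_lip G w in auto)
  have "usmooth n V (\<lambda>z. complex_of_real (exh z))" for n
    by (intro usmooth_of_real usmooth_exh)
  then show ?thesis
    using exhaustion_function_exh plurisubharmonic_exh usmooth_CinfFinf[OF assms(2)] usmooth_Ck assms(2) by blast
qed

end
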